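(* Let $s\in\{+,-\}$, $\ell\in\{1,\dots,N\}$ and $w_{h,\ell}\in V_{0,\ell}^s$. Then for any $(j,t)\in\{(\ell-1,+),(\ell+1,-)\}$ (with $1\le j\le N$), $$\mathrm{imp}^h_{\Gamma_j^t}\big(\mathcal T_{h;j,\ell}w_{h,\ell}\big)=\mathcal I^h_{\Gamma_\ell^s\to\Gamma_j^t}\big(\mathrm{imp}^h_{\Gamma_\ell^s}w_{h,\ell}\big).$$
   Context: Strip setting. $k>0$; $\Omega\subset\mathbb R^2$ is a rectangle with vertical and horizontal sides; $V\subset H^1(\Omega)$ is the nodal finite element space of (complex-valued) continuous piecewise polynomials of total degree $\le p$ on a conforming simplicial mesh $T^h$. $\Omega$ is covered by overlapping rectangular strips $\Omega_1,\dots,\Omega_N$ of the same height as $\Omega$, numbered from left to right, with boundaries resolved by $T^h$; $\Omega_\ell$ is overlapped only by $\Omega_{\ell-1}$ and $\Omega_{\ell+1}$, and $\Omega_j,\Omega_\ell$ with $|j-\ell|\ge2$ are separated by at least one layer of elements. $\Gamma_\ell:=\partial\Omega_\ell\setminus\partial\Omega=\Gamma_\ell^-\cup\Gamma_\ell^+$, where $\Gamma_\ell^-$, $\Gamma_\ell^+$ are the left and right vertical sides of $\Omega_\ell$ (inside $\Omega$, so $\Gamma_1^-=\emptyset=\Gamma_N^+$; function spaces on $\emptyset$ are $\{0\}$). $V_\ell:=\{v_h|_{\overline{\Omega_\ell}}:v_h\in V\}$; $V(\Gamma)$ denotes restrictions of $V$ to $\Gamma$; $\langle v,w\rangle_\Gamma=\int_\Gamma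 v\overline w$. For $D\subset\Omega$: $a_D(v,w):=\int_D(\nabla v\cdot\overline{\nabla w}-k^2v\overline w)-\mathrm{i}k\int_{\partial D}v\overline w$; $a:=a_\Omega$. Standing assumption: for each $\ell$, $a_{\Omega_\ell}$ induces an invertible operator $V_\ell\to V_\ell'$. $\mathcal R_{h,j}^\top:V_j\to V$ is the zero nodal extension (equal to its argument at nodes in $\overline{\Omega_j}$, zero at other nodes). $\{\chi_j\}$ is a continuous partition of unity on $\overline\Omega$: $\operatorname{supp}\chi_j\subset\overline{\Omega_j}$, $0\le\chi_j\le1$, $\sum_j\chi_j=1$. $\widetilde{\mathcal R}_{h,j}^\top v:=\mathcal R_{h,j}^\top(\Pi_h(\chi_jv))$ with $\Pi_h$ nodal interpolation. $b_{h,j}(w,v):=a_{\Omega_j}(w,v)-a(w,\mathcal R_{h,j}^\top v)$ for $w\in H^1(\Omega)$, $v\in V_j$. For $w_{h,\ell}\in V_\ell$, $\mathcal T_{h;j,\ell}w_{h,\ell}\in V_j$ is the solution of $a_{\Omega_j}(\mathcal T_{h;j,\ell}w_{h,\ell},v)=b_{h,j}(\widetilde{\mathcal R}_{h,\ell}^\top w_{h,\ell},v)$ for all $v\in V_j$. $H^1_{0,\Gamma}(\Omega_\ell)$ denotes functions in $H^1(\Omega_\ell)$ vanishing on $\Gamma$. $V_{0,\ell}:=\{w\in V_\ell:a_{\Omega_\ell}(w,v)=0\ \forall v\in V_\ell\cap H^1_{0,\Gamma_\ell}(\Omega_\ell)\}$ and, for $s\in\{+,-\}$, $V_{0,\ell}^s:=\{w\in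 V_\ell:a_{\Omega_\ell}(w,v)=0\ \forall v\in V_\ell\cap H^1_{0,\Gamma_\ell^s}(\Omega_\ell)\}\subset V_{0,\ell}$. For $w\in V_{0,\ell}$, $\mathrm{imp}^h_{\Gamma_\ell}w\in V(\Gamma_\ell)$ is the unique function with $\langle\mathrm{imp}^h_{\Gamma_\ell}w,v\rangle_{\Gamma_\ell}=a_{\Omega_\ell}(w,v)$ for all $v\in V_\ell$, and $\mathrm{imp}^h_{\Gamma_\ell^s}w:=(\mathrm{imp}^h_{\Gamma_\ell}w)|_{\Gamma_\ell^s}$. (One has $\mathcal T_{h;j,\ell}w_{h,\ell}\in V_{0,j}$.) Discrete impedance-to-impedance maps: for $g\in L^2(\Gamma_\ell^s)$ let $w\in V_\ell$ solve $a_{\Omega_\ell}(w,v)=\langle g,v\rangle_{\Gamma_\ell^s}$ for all $v\in V_\ell$. For $(j,t)\in\{(\ell-1,+),(\ell+1,-)\}$, $\mathcal I^h_{\Gamma_\ell^s\to\Gamma_j^t}g\in V(\Gamma_j^t)$ is defined by $$\langle\mathcal I^h_{\Gamma_\ell^s\to\Gamma_j^t}g,v\rangle_{\Gamma_j^t}=a_{\Omega_\ell\cap\Omega_j}(w,\widehat v)-a_{\Omega_\ell}(w,\mathcal R_{h,j}^\top\widehat v)\quad\forall v\in V(\Gamma_j^t),$$ where $\widehat v\in V_j$ equals $v$ at nodes on $\Gamma_j^t$ and vanishes at all other nodes of $\overline{\Omega_j}$. *)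

theory Defs
  imports "HOL-Analysis.Analysis"
begin

type_synonym plane = "real \<times> real"

text \<open>A function on a set \<open>D\<close> is represented by the total function that is zero outside \<open>D\<close>, so
  that equality of functions on \<open>D\<close> is equality in HOL.\<close>

definition restr :: "plane set \<Rightarrow> (plane \<Rightarrow> complex) \<Rightarrow> plane \<Rightarrow> complex" where
  "restr D v = (\<lambda>x. if x \<in> D then v x else 0)"


subsection \<open>Sobolev functions and arc-length integrals\<close>

definition L2_on :: "plane set \<Rightarrow> (plane \<Rightarrow> complex) set" where
  "L2_on D = {v. set_borel_measurable lborel D v \<and> set_integrable lborel D (\<lambda>x. (norm (v x))\<^sup>2)}"

text \<open>\<open>\<phi>\<close> is a continuously differentiable function with gradient \<open>\<phi>'\<close> and compact support in \<open>D\<close>.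
  For first-order weak derivatives these test functions are as good as smooth ones.\<close>

definition test_function :: "plane set \<Rightarrow> (plane \<Rightarrow> real) \<Rightarrow> (plane \<Rightarrow> plane) \<Rightarrow> bool" where
  "test_function D \<phi> \<phi>' \<longleftrightarrow>
     (\<forall>x. GDERIV \<phi> x :> \<phi>' x) \<and> continuous_on UNIV \<phi>' \<and>
     compact (closure {x. \<phi> x \<noteq> 0}) \<and> closure {x. \<phi> x \<noteq> 0} \<subseteq> D"

definition weak_gradient :: "plane set \<Rightarrow> (plane \<Rightarrow> complex) \<Rightarrow> (plane \<Rightarrow> complex \<times> complex) \<Rightarrow> bool" where
  "weak_gradient D v g \<longleftrightarrow>
     v \<in> L2_on D \<and> (\<lambda>x. fst (g x)) \<in> L2_on D \<and> (\<lambda>x. snd (g x)) \<in> L2_on D \<and>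
     (\<forall>\<phi> \<phi>'. test_function D \<phi> \<phi>' \<longrightarrow>
        (LINT x:D|lborel. v x * of_real (fst (\<phi>' x))) = - (LINT x:D|lborel. fst (g x) * of_real (\<phi> x)) \<and>
        (LINT x:D|lborel. v x * of_real (snd (\<phi>' x))) = - (LINT x:D|lborel. snd (g x) * of_real (\<phi> x)))"

definition H1 :: "plane set \<Rightarrow> (plane \<Rightarrow> complex) set" where
  "H1 D = {v. \<exists>g. weak_gradient D v g}"

text \<open>Weak gradients on open sets are determined up to null sets, which the integrals below
  do not see.\<close>

definition grad :: "plane set \<Rightarrow> (plane \<Rightarrow> complex) \<Rightarrow> plane \<Rightarrow> complex \<times> complex" where
  "grad D v = (SOME g. weak_gradient D v g)"

text \<open>Traces are pointwise values: boundary values are only ever taken of functions that are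
  continuous up to the boundary.\<close>

definition H1_0 :: "plane set \<Rightarrow> plane set \<Rightarrow> (plane \<Rightarrow> complex) set" where
  "H1_0 \<Gamma> D = {v \<in> H1 D. \<forall>x\<in>\<Gamma>. v x = 0}"

text \<open>The arc-length integral over a set \<open>\<Gamma>\<close> contained in finitely many axis-parallel lines: only
  finitely many sections of \<open>\<Gamma>\<close> have positive length, the vertical pieces of \<open>\<Gamma>\<close> being collected
  by the first sum and the horizontal ones by the second.\<close>

definition arc_integral :: "plane set \<Rightarrow> (plane \<Rightarrow> complex) \<Rightarrow> complex" where
  "arc_integral \<Gamma> f =
     (\<Sum>x | emeasure lborel {y. (x, y) \<in> \<Gamma>} \<noteq> 0. LINT y:{y. (x, y) \<in> \<Gamma>}|lborel. f (x, y)) +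
     (\<Sum>y | emeasure lborel {x. (x, y) \<in> \<Gamma>} \<noteq> 0. LINT x:{x. (x, y) \<in> \<Gamma>}|lborel. f (x, y))"

definition inner_on :: "plane set \<Rightarrow> (plane \<Rightarrow> complex) \<Rightarrow> (plane \<Rightarrow> complex) \<Rightarrow> complex" where
  "inner_on \<Gamma> v w = arc_integral \<Gamma> (\<lambda>x. v x * cnj (w x))"

definition helmholtz_form ::
    "real \<Rightarrow> plane set \<Rightarrow> (plane \<Rightarrow> complex) \<Rightarrow> (plane \<Rightarrow> complex) \<Rightarrow> complex" where
  "helmholtz_form k D v w =
     (LINT x:D|lborel.
        fst (grad D v x) * cnj (fst (grad D w x)) + snd (grad D v x) * cnj (snd (grad D w x))
        - of_real (k\<^sup>2) * v x * cnj (w x))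
     - \<i> * of_real k * inner_on (frontier D) v w"


subsection \<open>The strip decomposition and its finite element spaces\<close>

datatype side = Minus | Plus

text \<open>The domain is \<open>(x_lo, x_hi) \<times> (y_lo, y_hi)\<close>; the strip with number \<open>l \<in> {1..N}\<close> has the
  horizontal extent \<open>(strip_lo l, strip_hi l)\<close>.\<close>

record strip_setting =
  wavenumber :: real
  deg :: nat
  x_lo :: real
  x_hi :: real
  y_lo :: real
  y_hi :: real
  mesh :: "plane set set"
  num_strips :: nat
  strip_lo :: "nat \<Rightarrow> real"
  strip_hi :: "nat \<Rightarrow> real"
  pou :: "nat \<Rightarrow> plane \<Rightarrow> real"

definition Omega :: "strip_setting \<Rightarrow> plane set" where
  "Omega S = box (x_lo S, y_lo S) (x_hi S, y_hi S)"

definition strip :: "strip_setting \<Rightarrow> nat \<Rightarrow> plane set" where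
  "strip S l = box (strip_lo S l, y_lo S) (strip_hi S l, y_hi S)"

text \<open>Interfaces are taken closed, so that their end points on the boundary of the domain, which
  may be nodes, belong to them.\<close>

definition Gamma :: "strip_setting \<Rightarrow> nat \<Rightarrow> plane set" where
  "Gamma S l = closure (frontier (strip S l) - frontier (Omega S))"

fun strip_end :: "strip_setting \<Rightarrow> side \<Rightarrow> nat \<Rightarrow> real" where
  "strip_end S Minus l = strip_lo S l"
| "strip_end S Plus l = strip_hi S l"

definition Gamma_side :: "strip_setting \<Rightarrow> side \<Rightarrow> nat \<Rightarrow> plane set" where
  "Gamma_side S s l = {x \<in> Gamma S l. fst x = strip_end S s l}"

definition conforming_mesh :: "plane set set \<Rightarrow> plane set \<Rightarrow> bool" where
  "conforming_mesh M D \<longleftrightarrow> triangulation M \<and> (\<forall>K\<in>M. 2 simplex K) \<and> \<Union>M = closure D"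

text \<open>Since the strips are resolved by the mesh, the gap between two disjoint closed strips is a
  nonempty union of elements; hence separation by at least one layer of elements is the strict
  inequality \<open>strip_hi S j < strip_lo S l\<close>.\<close>

definition strip_decomposition :: "strip_setting \<Rightarrow> bool" where
  "strip_decomposition S \<longleftrightarrow>
     1 \<le> num_strips S \<and>
     (\<forall>l\<in>{1..num_strips S}. x_lo S \<le> strip_lo S l \<and> strip_lo S l < strip_hi S l \<and> strip_hi S l \<le> x_hi S) \<and>
     (\<forall>l\<in>{1..<num_strips S}. strip_lo S l < strip_lo S (Suc l) \<and> strip_hi S l < strip_hi S (Suc l)) \<and>
     (\<Union>l\<in>{1..num_strips S}. strip S l) = Omega S \<and>
     (\<forall>l\<in>{1..<num_strips S}. strip S l \<inter> strip S (Suc l) \<noteq> {}) \<and>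
     (\<forall>j\<in>{1..num_strips S}. \<forall>l\<in>{1..num_strips S}. j + 2 \<le> l \<longrightarrow> strip_hi S j < strip_lo S l) \<and>
     (\<forall>l\<in>{1..num_strips S}. \<exists>M\<subseteq>mesh S. \<Union>M = closure (strip S l))"

definition partition_of_unity :: "strip_setting \<Rightarrow> bool" where
  "partition_of_unity S \<longleftrightarrow>
     (\<forall>j\<in>{1..num_strips S}.
        continuous_on (closure (Omega S)) (pou S j) \<and>
        closure {x \<in> closure (Omega S). pou S j x \<noteq> 0} \<subseteq> closure (strip S j) \<and>
        (\<forall>x\<in>closure (Omega S). 0 \<le> pou S j x \<and> pou S j x \<le> 1)) \<and>
     (\<forall>x\<in>closure (Omega S). (\<Sum>j\<in>{1..num_strips S}. pou S j x) = 1)"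

definition valid_setting :: "strip_setting \<Rightarrow> bool" where
  "valid_setting S \<longleftrightarrow>
     0 < wavenumber S \<and> 1 \<le> deg S \<and> x_lo S < x_hi S \<and> y_lo S < y_hi S \<and>
     conforming_mesh (mesh S) (Omega S) \<and> strip_decomposition S \<and> partition_of_unity S"

text \<open>Complex polynomials in two real variables of total degree at most \<open>p\<close>.\<close>

definition polys2 :: "nat \<Rightarrow> (plane \<Rightarrow> complex) set" where
  "polys2 p = {q. \<exists>c. \<forall>x y. q (x, y) = (\<Sum>i\<le>p. \<Sum>j\<le>p - i. c i j * of_real x ^ i * of_real y ^ j)}"

definition V_space :: "strip_setting \<Rightarrow> (plane \<Rightarrow> complex) set" where
  "V_space S = {v. continuous_on (closure (Omega S)) v \<and>
                   (\<forall>K\<in>mesh S. \<exists>q\<in>polys2 (deg S). \<forall>x\<in>K. v x = q x) \<and>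
                   (\<forall>x. x \<notin> closure (Omega S) \<longrightarrow> v x = 0)}"

definition V_loc :: "strip_setting \<Rightarrow> nat \<Rightarrow> (plane \<Rightarrow> complex) set" where
  "V_loc S l = restr (closure (strip S l)) ` V_space S"

definition V_trace :: "strip_setting \<Rightarrow> plane set \<Rightarrow> (plane \<Rightarrow> complex) set" where
  "V_trace S \<Gamma> = restr \<Gamma> ` V_space S"

text \<open>The Lagrange nodes of degree \<open>p\<close> of the simplex \<open>K\<close>: the points whose barycentric coordinates
  are multiples of \<open>1/p\<close>.\<close>

definition lagrange_nodes :: "nat \<Rightarrow> plane set \<Rightarrow> plane set" where
  "lagrange_nodes p K =
     {(\<Sum>z | z extreme_point_of K. (real (m z) / real p) *\<^sub>R z) | m :: plane \<Rightarrow> nat.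
        (\<Sum>z | z extreme_point_of K. m z) = p}"

definition nodes :: "strip_setting \<Rightarrow> plane set" where
  "nodes S = (\<Union>K\<in>mesh S. lagrange_nodes (deg S) K)"


subsection \<open>Extension, interpolation and the local problems\<close>

abbreviation form ::
    "strip_setting \<Rightarrow> plane set \<Rightarrow> (plane \<Rightarrow> complex) \<Rightarrow> (plane \<Rightarrow> complex) \<Rightarrow> complex" where
  "form S \<equiv> helmholtz_form (wavenumber S)"

text \<open>The form is conjugate linear in its second argument, so \<open>w \<mapsto> a(w, \<cdot>)\<close> maps into the space of
  conjugate linear functionals.\<close>

definition antidual :: "(plane \<Rightarrow> complex) set \<Rightarrow> ((plane \<Rightarrow> complex) \<Rightarrow> complex) set" where
  "antidual W = {F \<in> extensional W.
     (\<forall>u\<in>W. \<forall>v\<in>W. F (\<lambda>x. u x + v x) = F u + F v) \<and>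
     (\<forall>c. \<forall>v\<in>W. F (\<lambda>x. c * v x) = cnj c * F v)}"

definition locally_invertible :: "strip_setting \<Rightarrow> nat \<Rightarrow> bool" where
  "locally_invertible S l \<longleftrightarrow>
     bij_betw (\<lambda>w. restrict (form S (strip S l) w) (V_loc S l)) (V_loc S l) (antidual (V_loc S l))"

definition nodal_ext :: "strip_setting \<Rightarrow> nat \<Rightarrow> (plane \<Rightarrow> complex) \<Rightarrow> plane \<Rightarrow> complex" where
  "nodal_ext S j v =
     (THE u. u \<in> V_space S \<and> (\<forall>z\<in>nodes S. u z = (if z \<in> closure (strip S j) then v z else 0)))"

definition nodal_interp :: "strip_setting \<Rightarrow> nat \<Rightarrow> (plane \<Rightarrow> complex) \<Rightarrow> plane \<Rightarrow> complex" where
  "nodal_interp S j f =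
     (THE u. u \<in> V_loc S j \<and> (\<forall>z\<in>nodes S \<inter> closure (strip S j). u z = f z))"

definition weighted_ext :: "strip_setting \<Rightarrow> nat \<Rightarrow> (plane \<Rightarrow> complex) \<Rightarrow> plane \<Rightarrow> complex" where
  "weighted_ext S j v = nodal_ext S j (nodal_interp S j (\<lambda>x. of_real (pou S j x) * v x))"

definition b_form ::
    "strip_setting \<Rightarrow> nat \<Rightarrow> (plane \<Rightarrow> complex) \<Rightarrow> (plane \<Rightarrow> complex) \<Rightarrow> complex" where
  "b_form S j w v = form S (strip S j) w v - form S (Omega S) w (nodal_ext S j v)"

definition T_op :: "strip_setting \<Rightarrow> nat \<Rightarrow> nat \<Rightarrow> (plane \<Rightarrow> complex) \<Rightarrow> plane \<Rightarrow> complex" where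
  "T_op S j l w =
     (THE u. u \<in> V_loc S j \<and>
        (\<forall>v\<in>V_loc S j. form S (strip S j) u v = b_form S j (weighted_ext S l w) v))"


subsection \<open>Discrete impedance data and impedance-to-impedance maps\<close>

definition V0 :: "strip_setting \<Rightarrow> nat \<Rightarrow> (plane \<Rightarrow> complex) set" where
  "V0 S l = {w \<in> V_loc S l. \<forall>v\<in>V_loc S l \<inter> H1_0 (Gamma S l) (strip S l). form S (strip S l) w v = 0}"

definition V0_side :: "strip_setting \<Rightarrow> side \<Rightarrow> nat \<Rightarrow> (plane \<Rightarrow> complex) set" where
  "V0_side S s l =
     {w \<in> V_loc S l. \<forall>v\<in>V_loc S l \<inter> H1_0 (Gamma_side S s l) (strip S l). form S (strip S l) w v = 0}"

text \<open>Meaningful for \<open>w \<in> V0 S l\<close>, where the defining problem has exactly one solution.\<close>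

definition imp :: "strip_setting \<Rightarrow> nat \<Rightarrow> (plane \<Rightarrow> complex) \<Rightarrow> plane \<Rightarrow> complex" where
  "imp S l w =
     (THE g. g \<in> V_trace S (Gamma S l) \<and>
        (\<forall>v\<in>V_loc S l. inner_on (Gamma S l) g v = form S (strip S l) w v))"

definition imp_side :: "strip_setting \<Rightarrow> side \<Rightarrow> nat \<Rightarrow> (plane \<Rightarrow> complex) \<Rightarrow> plane \<Rightarrow> complex" where
  "imp_side S s l w = restr (Gamma_side S s l) (imp S l w)"

definition impedance_solution ::
    "strip_setting \<Rightarrow> side \<Rightarrow> nat \<Rightarrow> (plane \<Rightarrow> complex) \<Rightarrow> plane \<Rightarrow> complex" where
  "impedance_solution S s l g =
     (THE w. w \<in> V_loc S l \<and>
        (\<forall>v\<in>V_loc S l. form S (strip S l) w v = inner_on (Gamma_side S s l) g v))"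

definition hat :: "strip_setting \<Rightarrow> side \<Rightarrow> nat \<Rightarrow> (plane \<Rightarrow> complex) \<Rightarrow> plane \<Rightarrow> complex" where
  "hat S t j v =
     (THE u. u \<in> V_loc S j \<and>
        (\<forall>z\<in>nodes S \<inter> closure (strip S j). u z = (if z \<in> Gamma_side S t j then v z else 0)))"

definition imp_map ::
    "strip_setting \<Rightarrow> side \<Rightarrow> nat \<Rightarrow> side \<Rightarrow> nat \<Rightarrow> (plane \<Rightarrow> complex) \<Rightarrow> plane \<Rightarrow> complex" where
  "imp_map S s l t j g =
     (let w = impedance_solution S s l g in
      THE u. u \<in> V_trace S (Gamma_side S t j) \<and>
        (\<forall>v\<in>V_trace S (Gamma_side S t j).
           inner_on (Gamma_side S t j) u v =
             form S (strip S l \<inter> strip S j) w (hat S t j v)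
             - form S (strip S l) w (nodal_ext S j (hat S t j v))))"

end

theory Submission
  imports Defs "HOL-Library.Function_Algebras"
begin

text \<open>
  Let \<open>u\<close> be the weighted extension of \<open>w\<close>, let \<open>v\<close> be a function on \<open>\<Gamma>\<^sub>j\<^sup>t\<close>, \<open>h\<close> the hat function of \<open>v\<close>
  on the strip \<open>j\<close>, and \<open>R\<close> the nodal extension of \<open>h\<close> by zero. Both sides of the claim are
  functions on \<open>\<Gamma>\<^sub>j\<^sup>t\<close>, and pairing them with \<open>v\<close> gives

  \<^item> on the left \<open>a\<^sub>j(T w, h) = a\<^sub>j(u, R) - a(u, R)\<close>, by the definitions of impedance data and of \<open>T\<close>;
  \<^item> on the right \<open>a\<^sub>l\<^sub>j(w, R) - a\<^sub>l(w, R)\<close>, where \<open>a\<^sub>l\<^sub>j\<close> is the form on the overlap of the strips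
    \<open>l\<close> and \<open>j\<close>, provided that \<open>w\<close> is the impedance solution with its own impedance data.

  In both differences the contributions of the strip \<open>j\<close> cancel. There remain the integrals over the
  elements beyond \<open>\<Gamma>\<^sub>j\<^sup>t\<close> on which \<open>R\<close> does not vanish, and a boundary integral over \<open>\<Gamma>\<^sub>j\<^sup>t\<close>. These
  elements touch \<open>\<Gamma>\<^sub>j\<^sup>t\<close>; since non-neighbouring strips are separated by a layer of elements, they lie
  between \<open>\<Gamma>\<^sub>j\<^sup>t\<close> and the other neighbour of the strip \<open>l\<close> (or the boundary of the domain) and are covered
  by the strip \<open>l\<close> alone. There the partition function of the strip \<open>l\<close> is \<open>1\<close>, so \<open>u = w\<close> and both differences agree. This is
  \<open>b_form_interface\<close>, with the two geometric cases in \<open>form_defect_right_interface\<close> and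
  \<open>form_defect_left_interface\<close>. That \<open>w\<close> solves its own impedance problem,
  \<open>impedance_solution_of_imp_side\<close>, holds because \<open>a\<^sub>l(w, \<cdot>)\<close> only sees values on \<open>\<Gamma>\<^sub>l\<^sup>s\<close>.

  The objects in the claim are given by definite descriptions, so existence and uniqueness have to be
  shown for each. Nodal extensions exist and are unique because Lagrange nodes are unisolvent on every
  face of an element (\<open>polys2_zero_on_face\<close>, \<open>nodal_function_exists\<close>); impedance data exist by Riesz
  representation (\<open>trace_riesz_representation\<close>), as the functional in question depends on the trace
  only (\<open>T_op_trace\<close> for \<open>T w\<close>). Forms on different domains can be compared because weak gradients are
  unique up to null sets and restrict to subdomains (\<open>weak_gradient_unique\<close>, \<open>weak_gradient_mono\<close>), and
  because finite element functions do have weak gradients (\<open>V_space_weak_gradient\<close>).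
\<close>

section \<open>Polynomials in two variables and Lagrange interpolation\<close>

lemma polys2I:
  "(\<And>x y. q (x, y) = (\<Sum>i\<le>p. \<Sum>j\<le>p - i. c i j * of_real x ^ i * of_real y ^ j)) \<Longrightarrow> q \<in> polys2 p"
  unfolding polys2_def by blast

lemma polys2_add:
  assumes "q \<in> polys2 p" "r \<in> polys2 p"
  shows "(\<lambda>z. q z + r z) \<in> polys2 p"
proof -
  obtain c where c: "\<And>x y. q (x, y) = (\<Sum>i\<le>p. \<Sum>j\<le>p - i. c i j * of_real x ^ i * of_real y ^ j)"
    using assms(1) unfolding polys2_def by blast
  obtain d where d: "\<And>x y. r (x, y) = (\<Sum>i\<le>p. \<Sum>j\<le>p - i. d i j * of_real x ^ i * of_real y ^ j)"
    using assms(2) unfolding polys2_def by blast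
  show ?thesis
    by (rule polys2I[where c = "\<lambda>i j. c i j + d i j"]) (simp add: c d sum.distrib algebra_simps)
qed

lemma polys2_scale:
  assumes "q \<in> polys2 p"
  shows "(\<lambda>z. a * q z) \<in> polys2 p"
proof -
  obtain c where c: "\<And>x y. q (x, y) = (\<Sum>i\<le>p. \<Sum>j\<le>p - i. c i j * of_real x ^ i * of_real y ^ j)"
    using assms(1) unfolding polys2_def by blast
  show ?thesis
    by (rule polys2I[where c = "\<lambda>i j. a * c i j"]) (simp add: c sum_distrib_left algebra_simps)
qed

lemma polys2_zero: "(\<lambda>z. 0) \<in> polys2 p"
  by (rule polys2I[where c = "\<lambda>i j. 0"]) simp

lemma polys2_sum:
  "(\<And>i. i \<in> I \<Longrightarrow> f i \<in> polys2 p) \<Longrightarrow> (\<lambda>z. \<Sum>i\<in>I. f i z) \<in> polys2 p"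
  by (induction I rule: infinite_finite_induct) (auto intro: polys2_zero polys2_add)

lemma polys2_diff:
  assumes "q \<in> polys2 p" "r \<in> polys2 p"
  shows "(\<lambda>z. q z - r z) \<in> polys2 p"
  using polys2_add[OF assms(1) polys2_scale[OF assms(2), of "-1"]] by simp

lemma polys2_times_fst:
  assumes "q \<in> polys2 p"
  shows "(\<lambda>z. of_real (fst z) * q z) \<in> polys2 (Suc p)"
proof -
  obtain c where c: "\<And>x y. q (x, y) = (\<Sum>i\<le>p. \<Sum>j\<le>p - i. c i j * of_real x ^ i * of_real y ^ j)"
    using assms(1) unfolding polys2_def by blast
  show ?thesis
    by (rule polys2I[where c = "\<lambda>i j. case i of 0 \<Rightarrow> 0 | Suc i \<Rightarrow> c i j"])
       (simp add: c sum_distrib_left algebra_simps sum.atMost_Suc_shift del: sum.atMost_Suc)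
qed

lemma polys2_times_snd:
  assumes "q \<in> polys2 p"
  shows "(\<lambda>z. of_real (snd z) * q z) \<in> polys2 (Suc p)"
proof -
  obtain c where c: "\<And>x y. q (x, y) = (\<Sum>i\<le>p. \<Sum>j\<le>p - i. c i j * of_real x ^ i * of_real y ^ j)"
    using assms(1) unfolding polys2_def by blast
  have "(\<Sum>j\<le>Suc p - i. (case j of 0 \<Rightarrow> 0 | Suc j \<Rightarrow> c i j) * of_real x ^ i * of_real y ^ j) =
        of_real y * (\<Sum>j\<le>p - i. c i j * of_real x ^ i * of_real y ^ j)" if "i \<le> p" for i x y
  proof -
    have "Suc p - i = Suc (p - i)" using that by simp
    then show ?thesis
      by (simp add: sum_distrib_left algebra_simps sum.atMost_Suc_shift del: sum.atMost_Suc)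
  qed
  then show ?thesis
    by (intro polys2I[where c = "\<lambda>i j. case j of 0 \<Rightarrow> 0 | Suc j \<Rightarrow> c i j"]) (simp add: c sum_distrib_left)
qed

lemma polys2_Suc: "q \<in> polys2 p \<Longrightarrow> q \<in> polys2 (Suc p)"
proof -
  assume "q \<in> polys2 p"
  then obtain c where c: "\<And>x y. q (x, y) = (\<Sum>i\<le>p. \<Sum>j\<le>p - i. c i j * of_real x ^ i * of_real y ^ j)"
    unfolding polys2_def by blast
  have "(\<Sum>j\<le>Suc p - i. (if i + j \<le> p then c i j else 0) * of_real x ^ i * of_real y ^ j) =
        (\<Sum>j\<le>p - i. c i j * of_real x ^ i * of_real y ^ j)" if "i \<le> p" for i x y
  proof -
    have "Suc p - i = Suc (p - i)" using that by simp
    then show ?thesis using that by (auto intro!: sum.cong)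
  qed
  then show ?thesis
    by (intro polys2I[where c = "\<lambda>i j. if i + j \<le> p then c i j else 0"]) (simp add: c)
qed

lemma polys2_mono: "p \<le> p' \<Longrightarrow> q \<in> polys2 p \<Longrightarrow> q \<in> polys2 p'"
  by (induction rule: dec_induct) (auto intro: polys2_Suc)

lemma polys2_const: "(\<lambda>z. a) \<in> polys2 p"
proof -
  have "(\<lambda>z. a) \<in> polys2 0" by (rule polys2I[where c = "\<lambda>i j. a"]) simp
  then show ?thesis by (rule polys2_mono[OF le0])
qed

lemma polys2_mult_affine:
  assumes "q \<in> polys2 p"
  shows "(\<lambda>z. (a + b * of_real (fst z) + c * of_real (snd z)) * q z) \<in> polys2 (Suc p)"
proof -
  have "(\<lambda>z. (a * q z + b * (of_real (fst z) * q z)) + c * (of_real (snd z) * q z)) \<in> polys2 (Suc p)"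
    by (intro polys2_add polys2_scale polys2_times_fst polys2_times_snd polys2_Suc assms)
  then show ?thesis by (simp add: algebra_simps)
qed

definition affine_plane :: "(plane \<Rightarrow> plane) \<Rightarrow> bool" where
  "affine_plane E \<longleftrightarrow> (\<exists>a b c a' b' c'. \<forall>z. E z = (a + b * fst z + c * snd z, a' + b' * fst z + c' * snd z))"

lemma affine_planeI:
  "(\<And>z. E z = (a + b * fst z + c * snd z, a' + b' * fst z + c' * snd z)) \<Longrightarrow> affine_plane E"
  unfolding affine_plane_def by blast

lemma polys2_compose_affine:
  assumes "q \<in> polys2 p" "affine_plane E"
  shows "(\<lambda>z. q (E z)) \<in> polys2 p"
proof -
  obtain d where d: "\<And>x y. q (x, y) = (\<Sum>i\<le>p. \<Sum>j\<le>p - i. d i j * of_real x ^ i * of_real y ^ j)"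
    using assms(1) unfolding polys2_def by blast
  obtain a b c a' b' c' where E: "\<And>z. E z = (a + b * fst z + c * snd z, a' + b' * fst z + c' * snd z)"
    using assms(2) unfolding affine_plane_def by blast
  have L: "(\<lambda>z. of_real (a + b * fst z + c * snd z) * r z) \<in> polys2 (Suc n)" if "r \<in> polys2 n" for r n and a b c :: real
    using polys2_mult_affine[OF that, of "of_real a" "of_real b" "of_real c"] by simp
  have pow: "(\<lambda>z. of_real (a + b * fst z + c * snd z) ^ i * r z) \<in> polys2 (i + n)" if "r \<in> polys2 n" for r n i and a b c :: real
    by (induction i) (use that L in \<open>auto simp: mult.assoc\<close>)
  have "(\<lambda>z. d i j * (of_real (a + b * fst z + c * snd z) ^ i * (of_real (a' + b' * fst z + c' * snd z) ^ j * 1))) \<in> polys2 p"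
    if "i \<le> p" "j \<le> p - i" for i j
    using that by (intro polys2_mono[OF _ polys2_scale[OF pow[OF pow[OF polys2_const[of _ 0]]]]]) simp
  then have "(\<lambda>z. \<Sum>i\<le>p. \<Sum>j\<le>p - i. d i j * (of_real (a + b * fst z + c * snd z) ^ i * (of_real (a' + b' * fst z + c' * snd z) ^ j * 1))) \<in> polys2 p"
    by (intro polys2_sum) auto
  then show ?thesis by (simp add: E d mult.assoc)
qed

lemma polys2_line_coeffs:
  assumes "q \<in> polys2 p"
  obtains d where "\<And>x. q (x, b) = (\<Sum>i\<le>p. d i * of_real x ^ i)"
proof -
  obtain c where c: "\<And>x y. q (x, y) = (\<Sum>i\<le>p. \<Sum>j\<le>p - i. c i j * of_real x ^ i * of_real y ^ j)"
    using assms(1) unfolding polys2_def by blast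
  have "q (x, b) = (\<Sum>i\<le>p. (\<Sum>j\<le>p - i. c i j * of_real b ^ j) * of_real x ^ i)" for x
    by (simp add: c sum_distrib_left mult.assoc mult.commute mult.left_commute)
  then show ?thesis by (rule that)
qed

lemma poly_zero_if_many_roots:
  fixes d :: "nat \<Rightarrow> complex" and a :: "nat \<Rightarrow> real"
  assumes "inj_on a {..n}" "\<And>i. i \<le> n \<Longrightarrow> (\<Sum>k\<le>n. d k * of_real (a i) ^ k) = 0" "k \<le> n"
  shows "d k = 0"
proof (rule ccontr)
  assume "d k \<noteq> 0"
  then have *: "finite {z. (\<Sum>k\<le>n. d k * z ^ k) = 0}" "card {z. (\<Sum>k\<le>n. d k * z ^ k) = 0} \<le> n"
    using Transcendental.polyfun_rootbound[of d k n] assms(3) by auto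
  have "(\<lambda>i. complex_of_real (a i)) ` {..n} \<subseteq> {z. (\<Sum>k\<le>n. d k * z ^ k) = 0}"
    using assms(2) by auto
  from card_mono[OF *(1) this] *(2) have "card ((\<lambda>i. complex_of_real (a i)) ` {..n}) \<le> n" by linarith
  moreover have "inj_on (\<lambda>i. complex_of_real (a i)) {..n}"
    using assms(1) by (auto simp: inj_on_def)
  ultimately show False by (simp add: card_image)
qed

lemma polys2_zero_on_line:
  fixes a :: "nat \<Rightarrow> real"
  assumes "q \<in> polys2 n" "inj_on a {..n}" "\<And>i. i \<le> n \<Longrightarrow> q (a i, b) = 0"
  shows "q (x, b) = 0"
proof -
  obtain d where d: "\<And>x. q (x, b) = (\<Sum>i\<le>n. d i * of_real x ^ i)"
    using polys2_line_coeffs[OF assms(1)] by blast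
  have "d k = 0" if "k \<le> n" for k
    using poly_zero_if_many_roots[OF assms(2), of d k] assms(3) d that by simp
  then show ?thesis by (simp add: d)
qed

text \<open>After a shift to \<open>b = 0\<close>, the restriction to the line consists of the monomials free of \<open>y\<close>. Their
  coefficients vanish, so that every remaining monomial has a factor \<open>y\<close>.\<close>

lemma polys2_factor_line:
  assumes "q \<in> polys2 (Suc n)" "\<And>x. q (x, b) = 0"
  obtains r where "r \<in> polys2 n" "\<And>x y. q (x, y) = of_real (y - b) * r (x, y)"
proof -
  have "affine_plane (\<lambda>z. (fst z, snd z + b))"
    by (rule affine_planeI[of _ 0 1 0 b 0 1]) auto
  from polys2_compose_affine[OF assms(1) this]
  obtain c where c: "\<And>x y. q (x, y + b) = (\<Sum>i\<le>Suc n. \<Sum>j\<le>Suc n - i. c i j * of_real x ^ i * of_real y ^ j)"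
    unfolding polys2_def by auto
  have s0: "(\<Sum>i\<le>Suc n. c i 0 * of_real x ^ i) = 0" for x :: real
  proof -
    have "(\<Sum>j\<le>Suc n - i. c i j * of_real x ^ i * of_real 0 ^ j) = c i 0 * of_real x ^ i" for i
    proof -
      have "(\<Sum>j\<le>Suc n - i. c i j * of_real x ^ i * of_real 0 ^ j)
         = (\<Sum>j\<in>{0}. c i j * of_real x ^ i * of_real 0 ^ j)"
        by (rule sum.mono_neutral_right) auto
      then show ?thesis by simp
    qed
    then show ?thesis using c[of x 0] assms(2)[of x] by simp
  qed
  have c0: "c i 0 = 0" if "i \<le> Suc n" for i
    by (rule poly_zero_if_many_roots[of real "Suc n" "\<lambda>i. c i 0"])
       (use that s0[of "real _"] in \<open>simp_all del: sum.atMost_Suc\<close>)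
  define r' where "r' z = (\<Sum>i\<le>n. \<Sum>j\<le>n - i. c i (Suc j) * of_real (fst z) ^ i * of_real (snd z) ^ j)" for z :: plane
  have "r' \<in> polys2 n" by (rule polys2I) (simp add: r'_def)
  have step: "(\<Sum>j\<le>Suc n - i. c i j * of_real x ^ i * of_real y ^ j) =
      of_real y * (\<Sum>j\<le>n - i. c i (Suc j) * of_real x ^ i * of_real y ^ j)" if "i \<le> n" for i and x y :: real
  proof -
    have "Suc n - i = Suc (n - i)" using that by simp
    then show ?thesis using that c0[of i]
      by (simp add: sum_distrib_left algebra_simps sum.atMost_Suc_shift del: sum.atMost_Suc)
  qed
  have q: "q (x, y + b) = of_real y * r' (x, y)" for x y
  proof -
    have "q (x, y + b) = (\<Sum>i\<le>n. \<Sum>j\<le>Suc n - i. c i j * of_real x ^ i * of_real y ^ j)"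
      using c0[of "Suc n"] by (simp add: c)
    also have "\<dots> = of_real y * r' (x, y)" by (simp add: step r'_def sum_distrib_left)
    finally show ?thesis .
  qed
  have aff: "affine_plane (\<lambda>z. (fst z, snd z - b))"
    by (rule affine_planeI[of _ 0 1 0 "-b" 0 1]) auto
  show ?thesis
    by (rule that[OF polys2_compose_affine[OF \<open>r' \<in> polys2 n\<close> aff]]) (use q[of _ "_ - b"] in simp)
qed

text \<open>On the line \<open>y = b 0\<close> there are \<open>n + 1\<close> roots. So \<open>q\<close> vanishes on this line, and the factor
  \<open>y - b 0\<close> splits off. The quotient vanishes on the grid without its first row, which is the grid
  for \<open>n - 1\<close>.\<close>

lemma polys2_unisolvent:
  fixes a b :: "nat \<Rightarrow> real"
  assumes "q \<in> polys2 n" "inj_on a {..n}" "inj_on b {..n}" "\<And>i j. i + j \<le> n \<Longrightarrow> q (a i, b j) = 0"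
  shows "q (x, y) = 0"
  using assms
proof (induction n arbitrary: q b)
  case 0
  obtain c where "\<And>x y. q (x, y) = c"
    using 0(1) unfolding polys2_def by auto
  then show ?case using 0(4)[of 0 0] by simp
next
  case (Suc n)
  have "q (x, b 0) = 0" for x
    by (rule polys2_zero_on_line[OF Suc.prems(1,2)]) (use Suc.prems(4) in auto)
  then obtain r where r: "r \<in> polys2 n" "\<And>x y. q (x, y) = of_real (y - b 0) * r (x, y)"
    using polys2_factor_line[OF Suc.prems(1)] by blast
  have "r (x, y) = 0"
  proof (rule Suc.IH[OF r(1), where b = "\<lambda>j. b (Suc j)"])
    show "inj_on a {..n}" by (rule inj_on_subset[OF Suc.prems(2)]) auto
    show "inj_on (\<lambda>j. b (Suc j)) {..n}" using Suc.prems(3) by (auto simp: inj_on_def)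
    show "r (a i, b (Suc j)) = 0" if "i + j \<le> n" for i j
    proof -
      have "b (Suc j) \<noteq> b 0" using Suc.prems(3) that by (auto simp: inj_on_def)
      then show ?thesis using r(2)[of "a i" "b (Suc j)"] Suc.prems(4)[of i "Suc j"] that by simp
    qed
  qed
  then show ?case by (simp add: r(2))
qed

lemma polys2_interpolate_line:
  fixes a :: "nat \<Rightarrow> real" and f :: "nat \<Rightarrow> complex"
  assumes "inj_on a {..n}"
  shows "\<exists>q\<in>polys2 n. \<forall>i\<le>n. \<forall>y. q (a i, y) = f i"
proof -
  have "\<exists>q\<in>polys2 m. (\<forall>x y. q (x, y) = q (x, 0)) \<and> (\<forall>i\<le>m. q (a i, 0) = f i)" if "m \<le> n" for m
    using that
  proof (induction m)
    case 0
    show ?case by (rule bexI[OF _ polys2_const[of "f 0"]]) auto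
  next
    case (Suc m)
    then obtain q where q: "q \<in> polys2 m" "\<And>x y. q (x, y) = q (x, 0)" "\<And>i. i \<le> m \<Longrightarrow> q (a i, 0) = f i"
      using Suc_leD by blast
    \<comment> \<open>Newton form: the product added in step \<open>m\<close> vanishes at the earlier nodes.\<close>
    define P where "P k z = (\<Prod>i<k. complex_of_real (fst z - a i))" for k and z :: plane
    have P: "P k \<in> polys2 k" for k
    proof (induction k)
      case 0
      then show ?case using polys2_const[of 1 0] by (simp add: P_def[abs_def])
    next
      case (Suc k)
      have "P (Suc k) = (\<lambda>z. (- of_real (a k) + 1 * of_real (fst z) + 0 * of_real (snd z)) * P k z)"
        by (auto simp: P_def fun_eq_iff)
      then show ?case using polys2_mult_affine[OF Suc.IH, of "- of_real (a k)" 1 0] by (simp del: mult_1)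
    qed
    have "a (Suc m) \<noteq> a i" if "i \<le> m" for i
      using inj_onD[OF assms, of "Suc m" i] Suc.prems that by fastforce
    then have nz: "P (Suc m) (a (Suc m), 0) \<noteq> 0"
      by (simp add: P_def less_Suc_eq_le)
    have z: "P (Suc m) (a i, 0) = 0" if "i \<le> m" for i
      using that by (auto simp: P_def less_Suc_eq_le simp del: prod.lessThan_Suc)
    define q' where "q' z = q z + (f (Suc m) - q (a (Suc m), 0)) / P (Suc m) (a (Suc m), 0) * P (Suc m) z" for z
    show ?case
    proof (rule bexI[of _ q'], intro conjI allI impI)
      show "q' \<in> polys2 (Suc m)"
        unfolding q'_def by (intro polys2_add polys2_scale P polys2_Suc q(1))
      show "q' (x, y) = q' (x, 0)" for x y
        using q(2)[of x y] by (simp add: q'_def P_def)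
      show "q' (a i, 0) = f i" if "i \<le> Suc m" for i
        using that q(3)[of i] z[of i] nz by (cases "i = Suc m") (auto simp: q'_def)
    qed
  qed
  then show ?thesis by (metis order_refl)
qed

text \<open>The recursion of \<open>polys2_unisolvent\<close> read as a construction: the values in the first row are attained
  by a function of \<open>x\<close> alone, and a correction with the factor \<open>y - b 0\<close> leaves that row unchanged.\<close>

lemma polys2_interpolate:
  fixes a b :: "nat \<Rightarrow> real" and f :: "nat \<Rightarrow> nat \<Rightarrow> complex"
  assumes "inj_on a {..n}" "inj_on b {..n}"
  shows "\<exists>q\<in>polys2 n. \<forall>i j. i + j \<le> n \<longrightarrow> q (a i, b j) = f i j"
  using assms
proof (induction n arbitrary: f b)
  case 0
  show ?case by (rule bexI[OF _ polys2_const[of "f 0 0"]]) auto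
next
  case (Suc n)
  obtain q where q: "q \<in> polys2 (Suc n)" "\<And>i y. i \<le> Suc n \<Longrightarrow> q (a i, y) = f i 0"
    using polys2_interpolate_line[OF Suc.prems(1), of "\<lambda>i. f i 0"] by blast
  have "inj_on a {..n}" by (rule inj_on_subset[OF Suc.prems(1)]) auto
  moreover have "inj_on (\<lambda>j. b (Suc j)) {..n}" using Suc.prems(2) by (auto simp: inj_on_def)
  ultimately obtain r where r: "r \<in> polys2 n"
    "\<And>i j. i + j \<le> n \<Longrightarrow> r (a i, b (Suc j)) = (f i (Suc j) - f i 0) / of_real (b (Suc j) - b 0)"
    using Suc.IH[of "\<lambda>j. b (Suc j)" "\<lambda>i j. (f i (Suc j) - f i 0) / of_real (b (Suc j) - b 0)"] by blast
  define q' where "q' z = q z + (- of_real (b 0) + 0 * of_real (fst z) + 1 * of_real (snd z)) * r z" for z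
  show ?case
  proof (rule bexI[of _ q'], intro allI impI)
    show "q' \<in> polys2 (Suc n)" unfolding q'_def by (intro polys2_add q(1) polys2_mult_affine r(1))
    fix i j assume ij: "i + j \<le> Suc n"
    show "q' (a i, b j) = f i j"
    proof (cases j)
      case 0
      then show ?thesis using q(2)[of i] ij by (simp add: q'_def)
    next
      case (Suc k)
      then have ne: "b (Suc k) \<noteq> b 0" using inj_onD[OF Suc.prems(2), of "Suc k" 0] ij by auto
      have "q' (a i, b j) = f i 0 + of_real (b (Suc k) - b 0) * ((f i (Suc k) - f i 0) / of_real (b (Suc k) - b 0))"
        using Suc q(2)[of i "b j"] ij r(2)[of i k] by (simp add: q'_def del: times_divide_eq_right)
      also have "\<dots> = f i j" using ne Suc by simp
      finally show ?thesis .
    qed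
  qed
qed

lemma lagrange_nodes_convex_hull:
  assumes "\<not> affine_dependent C"
  shows "lagrange_nodes p (convex hull C) =
    {(\<Sum>z\<in>C. (real (m z) / real p) *\<^sub>R z) | m. (\<Sum>z\<in>C. m z) = p}"
proof -
  have "{z. z extreme_point_of convex hull C} = C"
    using extreme_point_of_convex_hull_affine_independent[OF assms] by auto
  then show ?thesis by (simp add: lagrange_nodes_def)
qed

lemma lagrange_nodes_subset:
  assumes "\<not> affine_dependent C" "1 \<le> p"
  shows "lagrange_nodes p (convex hull C) \<subseteq> convex hull C"
proof
  fix z assume "z \<in> lagrange_nodes p (convex hull C)"
  then obtain m where m: "z = (\<Sum>v\<in>C. (real (m v) / real p) *\<^sub>R v)" "(\<Sum>v\<in>C. m v) = p"
    by (auto simp: lagrange_nodes_convex_hull[OF assms(1)])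
  have "(\<Sum>v\<in>C. real (m v) / real p) = real (\<Sum>v\<in>C. m v) / real p"
    by (simp add: sum_divide_distrib)
  then have "(\<Sum>v\<in>C. real (m v) / real p) = 1" using m(2) assms(2) by simp
  then show "z \<in> convex hull C"
    unfolding m(1) using aff_independent_finite[OF assms(1)] by (intro convex_sum convex_convex_hull) (auto intro: hull_inc)
qed

text \<open>By uniqueness of barycentric coordinates, the weights of a node in a face vanish at the vertices
  outside the face. Two elements with a common face thus have the same nodes on it, which is why
  piecewise interpolation is continuous.\<close>

lemma lagrange_nodes_face:
  assumes C: "\<not> affine_dependent C" and p: "1 \<le> p" and F: "F face_of convex hull C"
  shows "lagrange_nodes p F = lagrange_nodes p (convex hull C) \<inter> F"
proof -
  obtain C' where C': "C' \<subseteq> C" "F = convex hull C'"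
    using F face_of_convex_hull_affine_independent[OF C] by blast
  have fin: "finite C" using C by (rule aff_independent_finite)
  then have fin': "finite C'" using C'(1) finite_subset by blast
  have ind': "\<not> affine_dependent C'" using C C'(1) affine_dependent_subset by blast
  note N = lagrange_nodes_convex_hull[OF C] lagrange_nodes_convex_hull[OF ind']
  show ?thesis
  proof (intro equalityI subsetI)
    fix z assume z: "z \<in> lagrange_nodes p F"
    then obtain m where m: "z = (\<Sum>v\<in>C'. (real (m v) / real p) *\<^sub>R v)" "(\<Sum>v\<in>C'. m v) = p"
      by (auto simp: C'(2) N)
    define m' where "m' v = (if v \<in> C' then m v else 0)" for v
    have "z = (\<Sum>v\<in>C. (real (m' v) / real p) *\<^sub>R v)" "(\<Sum>v\<in>C. m' v) = p"
      unfolding m(1) m(2)[symmetric]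
      by (rule sum.mono_neutral_cong_left[OF fin C'(1)]; simp add: m'_def)
         (rule sum.mono_neutral_cong_right[OF fin C'(1)]; simp add: m'_def)
    then have "z \<in> lagrange_nodes p (convex hull C)" unfolding N by blast
    moreover have "z \<in> F" using z lagrange_nodes_subset[OF ind' p] C'(2) by blast
    ultimately show "z \<in> lagrange_nodes p (convex hull C) \<inter> F" by blast
  next
    fix z assume z: "z \<in> lagrange_nodes p (convex hull C) \<inter> F"
    then obtain m where m: "z = (\<Sum>v\<in>C. (real (m v) / real p) *\<^sub>R v)" "(\<Sum>v\<in>C. m v) = p"
      by (auto simp: N)
    obtain u where u: "sum u C' = 1" "(\<Sum>v\<in>C'. u v *\<^sub>R v) = z"
      using z fin' by (auto simp: C'(2) convex_hull_finite)
    define U where "U v = real (m v) / real p - (if v \<in> C' then u v else 0)" for v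
    have 1: "(\<Sum>v\<in>C. if v \<in> C' then u v else 0) = 1"
      unfolding u(1)[symmetric] by (rule sum.mono_neutral_cong_right[OF fin C'(1)]) auto
    have 2: "(\<Sum>v\<in>C. (if v \<in> C' then u v else 0) *\<^sub>R v) = z"
      unfolding u(2)[symmetric] by (rule sum.mono_neutral_cong_right[OF fin C'(1)]) auto
    have "(\<Sum>v\<in>C. real (m v) / real p) = real (\<Sum>v\<in>C. m v) / real p"
      by (simp add: sum_divide_distrib)
    then have "sum U C = 0" using m(2) p 1 by (simp add: U_def sum_subtractf)
    moreover have "(\<Sum>v\<in>C. U v *\<^sub>R v) = 0"
      using m(1) 2 by (simp add: U_def scaleR_diff_left sum_subtractf)
    ultimately have "U v = 0" if "v \<in> C" for v
      using C that by (auto simp: affine_dependent_explicit_finite[OF fin])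
    then have "U v = 0" if "v \<in> C - C'" for v using that by blast
    then have 0: "m v = 0" if "v \<in> C - C'" for v
      using that p unfolding U_def by fastforce
    have "z = (\<Sum>v\<in>C'. (real (m v) / real p) *\<^sub>R v)"
      unfolding m(1) by (rule sum.mono_neutral_right[OF fin C'(1)]) (use 0 in auto)
    moreover have "(\<Sum>v\<in>C'. m v) = p"
      unfolding m(2)[symmetric] by (rule sum.mono_neutral_left[OF fin C'(1)]) (use 0 in auto)
    ultimately show "z \<in> lagrange_nodes p F" unfolding C'(2) N by blast
  qed
qed

text \<open>The points may coincide, so that edges and vertices are covered as well; the weight of a vertex then
  adds up over its occurrences in \<open>a\<close>, \<open>b\<close>, \<open>c\<close>.\<close>

lemma lagrange_node_of_triangle:
  assumes "\<not> affine_dependent {a, b, c}" "1 \<le> p" "i + j \<le> p"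
  shows "a + (real i / real p) *\<^sub>R (b - a) + (real j / real p) *\<^sub>R (c - a) \<in> lagrange_nodes p (convex hull {a, b, c})"
proof -
  define m where "m v = (if v = a then p - (i + j) else 0) + (if v = b then i else 0) + (if v = c then j else 0)" for v
  have delta: "(\<Sum>v\<in>{a,b,c}. (if v = w then k else 0)) = k" if "w \<in> {a, b, c}" for w k
    using that by (simp only: sum.delta finite.intros finite_insert if_True)
  have delta': "(\<Sum>v\<in>{a,b,c}. (real (if v = w then k else 0) / real p) *\<^sub>R v) = (real k / real p) *\<^sub>R w"
    if "w \<in> {a, b, c}" for w k
  proof -
    have "(\<Sum>v\<in>{a,b,c}. (real (if v = w then k else 0) / real p) *\<^sub>R v)
        = (\<Sum>v\<in>{a,b,c}. if v = w then (real k / real p) *\<^sub>R w else 0)"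
      by (rule sum.cong) auto
    then show ?thesis using that by (simp only: sum.delta finite.intros finite_insert if_True)
  qed
  have "(\<Sum>v\<in>{a,b,c}. m v) = p"
    unfolding m_def sum.distrib using delta[of a] delta[of b] delta[of c] assms(3) by simp
  moreover have "(\<Sum>v\<in>{a,b,c}. (real (m v) / real p) *\<^sub>R v) =
      (real (p - (i + j)) / real p) *\<^sub>R a + (real i / real p) *\<^sub>R b + (real j / real p) *\<^sub>R c"
    unfolding m_def of_nat_add add_divide_distrib scaleR_add_left sum.distrib
    using delta'[of a] delta'[of b] delta'[of c] by simp
  moreover have "(real (p - (i + j)) / real p) = 1 - real i / real p - real j / real p"
    using assms(2,3) by (simp add: of_nat_diff field_simps)
  ultimately show ?thesis
    unfolding lagrange_nodes_convex_hull[OF assms(1)]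
    by (intro CollectI exI[of _ m]) (simp add: algebra_simps)
qed

lemma affine_plane_triangle:
  fixes a b c :: plane
  shows "affine_plane (\<lambda>z. a + fst z *\<^sub>R (b - a) + snd z *\<^sub>R (c - a))"
  by (rule affine_planeI[of _ "fst a" "fst (b - a)" "fst (c - a)" "snd a" "snd (b - a)" "snd (c - a)"])
     (simp add: prod_eq_iff)

lemma inj_on_multiples:
  assumes "1 \<le> p" shows "inj_on (\<lambda>i. real i / real p) {..p}"
  using assms by (auto simp: inj_on_def)

text \<open>In affine coordinates the nodes are the grid of \<open>polys2_unisolvent\<close>. The points \<open>a\<close>, \<open>b\<close>, \<open>c\<close> may
  coincide, so this covers triangles, edges and vertices at once.\<close>

lemma polys2_unisolvent_simplex:
  assumes "q \<in> polys2 p" "1 \<le> p" "\<not> affine_dependent {a, b, c}"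
    and "\<And>z. z \<in> lagrange_nodes p (convex hull {a, b, c}) \<Longrightarrow> q z = 0"
    and "z \<in> convex hull {a, b, c}"
  shows "q z = 0"
proof -
  define E where "E z = a + fst z *\<^sub>R (b - a) + snd z *\<^sub>R (c - a)" for z
  have "(\<lambda>z. q (E z)) \<in> polys2 p"
    unfolding E_def by (rule polys2_compose_affine[OF assms(1) affine_plane_triangle])
  from polys2_unisolvent[OF this inj_on_multiples[OF assms(2)] inj_on_multiples[OF assms(2)]]
  have "q (E (s, t)) = 0" for s t
    using assms(4)[OF lagrange_node_of_triangle[OF assms(3,2)]] by (simp add: E_def)
  moreover obtain s t where "z = a + s *\<^sub>R (b - a) + t *\<^sub>R (c - a)"
    using assms(5) by (auto simp: convex_hull_3_alt)
  ultimately show ?thesis by (metis E_def fst_conv snd_conv)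
qed

text \<open>The determinant of the affine coordinates of a triangle. If it is zero, then \<open>c - a\<close> is a multiple of
  \<open>b - a\<close>.\<close>

lemma triangle_nondegenerate:
  fixes a b c :: plane
  assumes "\<not> affine_dependent {a, b, c}" "card {a, b, c} = 3"
  shows "(fst b - fst a) * (snd c - snd a) - (snd b - snd a) * (fst c - fst a) \<noteq> 0"
proof
  assume D: "(fst b - fst a) * (snd c - snd a) - (snd b - snd a) * (fst c - fst a) = 0"
  have ne: "a \<noteq> b" "a \<noteq> c" "b \<noteq> c" using assms(2) by (auto simp: card_insert_if split: if_splits)
  have "\<exists>r. c - a = r *\<^sub>R (b - a)"
  proof (cases "fst b = fst a")
    case True
    then have "snd b \<noteq> snd a" using ne by (auto simp: prod_eq_iff)
    moreover from this have "fst c = fst a" using D True by simp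
    ultimately show ?thesis using True
      by (intro exI[of _ "(snd c - snd a) / (snd b - snd a)"]) (simp add: prod_eq_iff)
  next
    case False
    then have "snd c - snd a = (fst c - fst a) / (fst b - fst a) * (snd b - snd a)"
      using D by (simp add: field_simps)
    with False show ?thesis
      by (intro exI[of _ "(fst c - fst a) / (fst b - fst a)"]) (simp add: prod_eq_iff)
  qed
  then have "collinear {0, b - a, c - a}" by (auto simp: collinear_lemma)
  then have "collinear {b, a, c}" using collinear_3[of b a c] by simp
  then have "collinear {a, b, c}" by (simp add: insert_commute)
  then show False using assms(1) ne by (simp add: collinear_3_eq_affine_dependent)
qed

lemma polys2_interpolate_triangle:
  assumes "1 \<le> p" "\<not> affine_dependent {a, b, c}" "card {a, b, c} = 3"
  shows "\<exists>q\<in>polys2 p. \<forall>z\<in>lagrange_nodes p (convex hull {a, b, c}). q z = f z"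
proof -
  define D where "D = (fst b - fst a) * (snd c - snd a) - (snd b - snd a) * (fst c - fst a)"
  have D: "D \<noteq> 0" using triangle_nondegenerate[OF assms(2,3)] by (simp add: D_def)
  define E where "E z = a + fst z *\<^sub>R (b - a) + snd z *\<^sub>R (c - a)" for z
  define E' where "E' z = (((fst z - fst a) * (snd c - snd a) - (snd z - snd a) * (fst c - fst a)) / D,
     ((fst b - fst a) * (snd z - snd a) - (snd b - snd a) * (fst z - fst a)) / D)" for z
  have E'E: "E' (E z) = z" for z
  proof -
    have "(fst (E z) - fst a) * (snd c - snd a) - (snd (E z) - snd a) * (fst c - fst a) = D * fst z"
      "(fst b - fst a) * (snd (E z) - snd a) - (snd b - snd a) * (fst (E z) - fst a) = D * snd z"
      by (simp_all add: E_def D_def algebra_simps)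
    then show ?thesis using D by (simp add: E'_def)
  qed
  have "affine_plane E'"
    unfolding E'_def
    by (rule affine_planeI[of _
          "(- fst a * (snd c - snd a) + snd a * (fst c - fst a)) / D" "(snd c - snd a) / D" "- (fst c - fst a) / D"
          "(- (fst b - fst a) * snd a + (snd b - snd a) * fst a) / D" "- (snd b - snd a) / D" "(fst b - fst a) / D"])
       (use D in \<open>simp add: field_simps\<close>)
  obtain q where q: "q \<in> polys2 p" "\<And>i j. i + j \<le> p \<Longrightarrow> q (real i / real p, real j / real p) = f (E (real i / real p, real j / real p))"
    using polys2_interpolate[OF inj_on_multiples[OF assms(1)] inj_on_multiples[OF assms(1)],
        of "\<lambda>i j. f (E (real i / real p, real j / real p))"] by blast
  show ?thesis
  proof (rule bexI[of _ "\<lambda>z. q (E' z)"], intro ballI)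
    show "(\<lambda>z. q (E' z)) \<in> polys2 p" by (rule polys2_compose_affine) fact+
    fix z assume "z \<in> lagrange_nodes p (convex hull {a, b, c})"
    then obtain m where m: "z = (\<Sum>v\<in>{a,b,c}. (real (m v) / real p) *\<^sub>R v)" "(\<Sum>v\<in>{a,b,c}. m v) = p"
      by (auto simp: lagrange_nodes_convex_hull[OF assms(2)])
    have ne: "a \<noteq> b" "a \<noteq> c" "b \<noteq> c" using assms(3) by (auto simp: card_insert_if split: if_splits)
    have p: "m a + m b + m c = p" using m(2) ne by simp
    then have "real (m a) / real p = 1 - real (m b) / real p - real (m c) / real p"
      using assms(1) by (auto simp: field_simps)
    moreover have "z = (real (m a) / real p) *\<^sub>R a + (real (m b) / real p) *\<^sub>R b + (real (m c) / real p) *\<^sub>R c"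
      using m(1) ne by simp
    ultimately have "z = E (real (m b) / real p, real (m c) / real p)"
      by (simp only: E_def) (simp add: algebra_simps)
    then show "q (E' z) = f z" using q(2)[of "m b" "m c"] p by (simp add: E'E)
  qed
qed

lemma polys2_continuous:
  assumes "q \<in> polys2 p"
  shows "continuous_on UNIV q"
proof -
  obtain c where c: "\<And>x y. q (x, y) = (\<Sum>i\<le>p. \<Sum>j\<le>p - i. c i j * of_real x ^ i * of_real y ^ j)"
    using assms unfolding polys2_def by blast
  have "q = (\<lambda>z. (\<Sum>i\<le>p. \<Sum>j\<le>p - i. c i j * of_real (fst z) ^ i * of_real (snd z) ^ j))"
    using c by (auto simp: fun_eq_iff)
  then show ?thesis by (auto intro!: continuous_intros)
qed

section \<open>Finite element functions and their nodal values\<close>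

text \<open>A region that meets every element in a face (possibly the empty face, or the whole element). On such a
  region a finite element function is determined by its nodal values in the region; in general the
  elements that reach into a region have nodes outside it.\<close>

definition resolved :: "strip_setting \<Rightarrow> plane set \<Rightarrow> bool" where
  "resolved S H \<longleftrightarrow> (\<forall>K\<in>mesh S. K \<inter> H face_of K)"

locale fe_mesh =
  fixes S :: strip_setting
  assumes deg: "1 \<le> deg S" and x_lo_less: "x_lo S < x_hi S" and y_lo_less: "y_lo S < y_hi S"
    and conforming: "conforming_mesh (mesh S) (Omega S)"
begin

lemma finite_mesh: "finite (mesh S)"
  using conforming by (simp add: conforming_mesh_def triangulation_def)

lemma Union_mesh: "\<Union>(mesh S) = closure (Omega S)"
  using conforming by (simp add: conforming_mesh_def)

lemma element_triangle:
  assumes "K \<in> mesh S"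
  obtains a b c where "K = convex hull {a, b, c}" "\<not> affine_dependent {a, b, c}" "card {a, b, c} = 3"
proof -
  have "2 simplex K" using assms conforming by (simp add: conforming_mesh_def)
  then obtain C where C: "\<not> affine_dependent C" "int (card C) = 2 + 1" "K = convex hull C"
    unfolding simplex_def by blast
  then have "card C = 3" by simp
  then obtain a b c where "C = {a, b, c}" by (auto simp: card_3_iff)
  with C \<open>card C = 3\<close> show ?thesis by (intro that) auto
qed

lemma elements_meet_in_face: "K \<in> mesh S \<Longrightarrow> K' \<in> mesh S \<Longrightarrow> K \<inter> K' face_of K"
  using conforming by (simp add: conforming_mesh_def triangulation_def)

lemma lagrange_nodes_face_of_element:
  assumes "K \<in> mesh S" "F face_of K"
  shows "lagrange_nodes (deg S) F = lagrange_nodes (deg S) K \<inter> F"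
proof -
  obtain a b c where "K = convex hull {a, b, c}" "\<not> affine_dependent {a, b, c}"
    using element_triangle[OF assms(1)] by blast
  then show ?thesis using lagrange_nodes_face[OF _ deg, of "{a, b, c}"] assms(2) by simp
qed

lemma lagrange_nodes_subset_element:
  assumes "K \<in> mesh S"
  shows "lagrange_nodes (deg S) K \<subseteq> K"
proof -
  obtain a b c where "K = convex hull {a, b, c}" "\<not> affine_dependent {a, b, c}"
    using element_triangle[OF assms] by blast
  then show ?thesis using lagrange_nodes_subset[OF _ deg, of "{a, b, c}"] by simp
qed

lemma finite_nodes: "finite (nodes S)"
proof -
  have "finite (lagrange_nodes (deg S) K)" if "K \<in> mesh S" for K
  proof -
    obtain a b c where K: "K = convex hull {a, b, c}" "\<not> affine_dependent {a, b, c}"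
      using element_triangle[OF \<open>K \<in> mesh S\<close>] by blast
    let ?F = "\<lambda>(i, j, k). (\<Sum>v\<in>{a,b,c}. (real ((\<lambda>v. if v = a then i else if v = b then j else k) v) / real (deg S)) *\<^sub>R v)"
    have "lagrange_nodes (deg S) K \<subseteq> ?F ` ({..deg S} \<times> {..deg S} \<times> {..deg S})"
    proof
      fix z assume "z \<in> lagrange_nodes (deg S) K"
      then obtain m where m: "z = (\<Sum>v\<in>{a,b,c}. (real (m v) / real (deg S)) *\<^sub>R v)" "(\<Sum>v\<in>{a,b,c}. m v) = deg S"
        by (auto simp: K lagrange_nodes_convex_hull)
      have "z = ?F (m a, m b, m c)"
        unfolding m(1) prod.case by (rule sum.cong) auto
      moreover have "m v \<le> deg S" if "v \<in> {a, b, c}" for v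
        unfolding m(2)[symmetric] by (rule member_le_sum) (use that in auto)
      ultimately show "z \<in> ?F ` ({..deg S} \<times> {..deg S} \<times> {..deg S})" by blast
    qed
    then show ?thesis by (rule finite_subset) simp
  qed
  then show ?thesis by (simp add: nodes_def finite_mesh)
qed

lemma nodes_Int_element:
  assumes "K \<in> mesh S"
  shows "nodes S \<inter> K = lagrange_nodes (deg S) K"
proof (intro equalityI subsetI)
  fix z assume z: "z \<in> nodes S \<inter> K"
  then obtain K' where K': "K' \<in> mesh S" "z \<in> lagrange_nodes (deg S) K'"
    by (auto simp: nodes_def)
  have "z \<in> K'"
    using K' lagrange_nodes_subset_element by blast
  have "z \<in> lagrange_nodes (deg S) (K' \<inter> K)"
    using lagrange_nodes_face_of_element[OF K'(1) elements_meet_in_face[OF K'(1) assms]] K'(2) z \<open>z \<in> K'\<close> by blast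
  then show "z \<in> lagrange_nodes (deg S) K"
    using lagrange_nodes_face_of_element[OF assms elements_meet_in_face[OF assms K'(1)]] by (simp add: Int_commute)
next
  fix z assume "z \<in> lagrange_nodes (deg S) K"
  then show "z \<in> nodes S \<inter> K"
    using assms lagrange_nodes_subset_element unfolding nodes_def by blast
qed

text \<open>Only the nodes in the face enter, and these are the Lagrange nodes of the face as a simplex.\<close>

lemma polys2_zero_on_face:
  assumes "K \<in> mesh S" "F face_of K" "q \<in> polys2 (deg S)"
    and "\<And>z. z \<in> nodes S \<inter> F \<Longrightarrow> q z = 0" and "x \<in> F"
  shows "q x = 0"
proof -
  obtain a b c where K: "K = convex hull {a, b, c}" "\<not> affine_dependent {a, b, c}"
    using element_triangle[OF assms(1)] by blast
  obtain C where C: "C \<subseteq> {a, b, c}" "F = convex hull C"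
    using face_of_convex_hull_affine_independent[OF K(2)] assms(2) K(1) by blast
  have ind: "\<not> affine_dependent C" using K(2) C(1) affine_dependent_subset by blast
  have "C \<noteq> {}" using C(2) assms(5) by auto
  then obtain d where "d \<in> C" by blast
  \<comment> \<open>The vertices of the face, filled up by repetition to three points.\<close>
  define e f where "e = (if b \<in> C then b else d)" and "f = (if c \<in> C then c else d)"
  define g where "g = (if a \<in> C then a else d)"
  have Ceq: "C = {g, e, f}" using C(1) \<open>d \<in> C\<close> by (auto simp: g_def e_def f_def)
  have "F \<subseteq> K" using assms(2) by (rule face_of_imp_subset)
  have "lagrange_nodes (deg S) F = nodes S \<inter> F"
    using lagrange_nodes_face_of_element[OF assms(1,2)] nodes_Int_element[OF assms(1)] \<open>F \<subseteq> K\<close> by blast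
  then show ?thesis
    using polys2_unisolvent_simplex[OF assms(3) deg, of g e f x] ind assms(4,5) C(2) Ceq by simp
qed

lemma V_space_outside: "v \<in> V_space S \<Longrightarrow> x \<notin> closure (Omega S) \<Longrightarrow> v x = 0"
  unfolding V_space_def by blast

lemma V_spaceI:
  assumes "continuous_on (closure (Omega S)) v" "\<And>x. x \<notin> closure (Omega S) \<Longrightarrow> v x = 0"
    and "\<And>K. K \<in> mesh S \<Longrightarrow> \<exists>q\<in>polys2 (deg S). \<forall>x\<in>K. v x = q x"
  shows "v \<in> V_space S"
  using assms unfolding V_space_def by blast

lemma V_space_continuous: "v \<in> V_space S \<Longrightarrow> continuous_on (closure (Omega S)) v"
  unfolding V_space_def by blast

lemma V_space_on_element:
  assumes "v \<in> V_space S" "K \<in> mesh S"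
  obtains q where "q \<in> polys2 (deg S)" "\<And>x. x \<in> K \<Longrightarrow> v x = q x"
  using assms unfolding V_space_def by blast

lemma V_space_zero_on_resolved:
  assumes "v \<in> V_space S" "resolved S H" "\<And>z. z \<in> nodes S \<Longrightarrow> z \<in> H \<Longrightarrow> v z = 0" "x \<in> H"
  shows "v x = 0"
proof (cases "x \<in> closure (Omega S)")
  case True
  then obtain K where K: "K \<in> mesh S" "x \<in> K" using Union_mesh by blast
  obtain q where q: "q \<in> polys2 (deg S)" "\<And>x. x \<in> K \<Longrightarrow> v x = q x"
    using assms(1) K(1) unfolding V_space_def by blast
  have "q x = 0"
  proof (rule polys2_zero_on_face[OF K(1) _ q(1), of "K \<inter> H"])
    show "K \<inter> H face_of K" using assms(2) K(1) by (simp add: resolved_def)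
    show "q z = 0" if "z \<in> nodes S \<inter> (K \<inter> H)" for z using q(2)[of z] assms(3) that by simp
  qed (use assms K in auto)
  then show ?thesis using q(2) K(2) by simp
next
  case False
  then show ?thesis using assms(1) by (rule V_space_outside[rotated])
qed

lemma V_space_add:
  assumes "u \<in> V_space S" "v \<in> V_space S"
  shows "(\<lambda>x. u x + v x) \<in> V_space S"
proof (rule V_spaceI)
  show "continuous_on (closure (Omega S)) (\<lambda>x. u x + v x)"
    by (intro continuous_intros V_space_continuous assms)
  show "u x + v x = 0" if "x \<notin> closure (Omega S)" for x
    using assms that by (simp add: V_space_outside)
  fix K assume K: "K \<in> mesh S"
  obtain q where q: "q \<in> polys2 (deg S)" "\<And>x. x \<in> K \<Longrightarrow> u x = q x"
    using V_space_on_element[OF assms(1) K] by blast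
  obtain r where r: "r \<in> polys2 (deg S)" "\<And>x. x \<in> K \<Longrightarrow> v x = r x"
    using V_space_on_element[OF assms(2) K] by blast
  show "\<exists>q\<in>polys2 (deg S). \<forall>x\<in>K. u x + v x = q x"
    by (rule bexI[OF _ polys2_add[OF q(1) r(1)]]) (simp add: q r)
qed

lemma V_space_scale:
  assumes "u \<in> V_space S"
  shows "(\<lambda>x. c * u x) \<in> V_space S"
proof (rule V_spaceI)
  show "continuous_on (closure (Omega S)) (\<lambda>x. c * u x)"
    by (intro continuous_intros V_space_continuous assms)
  show "c * u x = 0" if "x \<notin> closure (Omega S)" for x
    using assms that by (simp add: V_space_outside)
  fix K assume K: "K \<in> mesh S"
  obtain q where q: "q \<in> polys2 (deg S)" "\<And>x. x \<in> K \<Longrightarrow> u x = q x"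
    using V_space_on_element[OF assms(1) K] by blast
  show "\<exists>q\<in>polys2 (deg S). \<forall>x\<in>K. c * u x = q x"
    by (rule bexI[OF _ polys2_scale[OF q(1), of c]]) (simp add: q)
qed

lemma V_space_zero: "(\<lambda>x. 0) \<in> V_space S"
  by (rule V_spaceI) (auto intro!: bexI[OF _ polys2_zero])

lemma V_space_diff: "u \<in> V_space S \<Longrightarrow> v \<in> V_space S \<Longrightarrow> (\<lambda>x. u x - v x) \<in> V_space S"
  using V_space_add[OF _ V_space_scale[of v "-1"], of u] by simp

lemma V_space_eq_on_resolved:
  assumes "u \<in> V_space S" "v \<in> V_space S" "resolved S H"
    and "\<And>z. z \<in> nodes S \<Longrightarrow> z \<in> H \<Longrightarrow> u z = v z" "x \<in> H"
  shows "u x = v x"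
  using V_space_zero_on_resolved[OF V_space_diff[OF assms(1,2)] assms(3) _ assms(5)] assms(4) by simp

lemma resolved_UNIV: "resolved S UNIV"
proof -
  have "K face_of K" if "K \<in> mesh S" for K
    by (rule element_triangle[OF that]) (simp add: face_of_refl)
  then show ?thesis by (simp add: resolved_def)
qed

lemma resolved_Int: "resolved S H \<Longrightarrow> resolved S H' \<Longrightarrow> resolved S (H \<inter> H')"
proof -
  assume "resolved S H" "resolved S H'"
  moreover have "K \<inter> (H \<inter> H') = (K \<inter> H) \<inter> (K \<inter> H')" for K by blast
  ultimately show ?thesis unfolding resolved_def by (simp add: face_of_Int)
qed

text \<open>Interpolate on each element. On a common face the two interpolants agree at all nodes of the face and
  hence on the face, so the pieces fit together continuously.\<close>

lemma nodal_function_exists: "\<exists>u\<in>V_space S. \<forall>z\<in>nodes S. u z = f z"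
proof -
  have "\<exists>q\<in>polys2 (deg S). \<forall>z\<in>nodes S \<inter> K. q z = f z" if K: "K \<in> mesh S" for K
  proof -
    obtain a b c where "K = convex hull {a, b, c}" "\<not> affine_dependent {a, b, c}" "card {a, b, c} = 3"
      using element_triangle[OF K] by blast
    then show ?thesis
      using polys2_interpolate_triangle[OF deg, of a b c f] nodes_Int_element[OF K] by simp
  qed
  then have "\<forall>K\<in>mesh S. \<exists>q. q \<in> polys2 (deg S) \<and> (\<forall>z\<in>nodes S \<inter> K. q z = f z)"
    by blast
  from bchoice[OF this] obtain Q where Q: "\<And>K. K \<in> mesh S \<Longrightarrow> Q K \<in> polys2 (deg S)"
      "\<And>K z. K \<in> mesh S \<Longrightarrow> z \<in> nodes S \<Longrightarrow> z \<in> K \<Longrightarrow> Q K z = f z"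
    by blast
  have agree: "Q K x = Q K' x" if "K \<in> mesh S" "K' \<in> mesh S" "x \<in> K" "x \<in> K'" for K K' x
  proof -
    have "Q K x - Q K' x = 0"
      by (rule polys2_zero_on_face[OF that(1) elements_meet_in_face[OF that(1,2)] polys2_diff[OF Q(1)[OF that(1)] Q(1)[OF that(2)]]])
         (use Q(2) that in auto)
    then show ?thesis by simp
  qed
  define u where "u x = (if x \<in> closure (Omega S) then Q (SOME K. K \<in> mesh S \<and> x \<in> K) x else 0)" for x
  have u: "u x = Q K x" if "K \<in> mesh S" "x \<in> K" for K x
  proof -
    have "(SOME K. K \<in> mesh S \<and> x \<in> K) \<in> mesh S \<and> x \<in> (SOME K. K \<in> mesh S \<and> x \<in> K)"
      by (rule someI[of _ K]) (use that in simp)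
    moreover have "x \<in> closure (Omega S)" using that unfolding Union_mesh[symmetric] by blast
    ultimately show ?thesis using agree[of _ K x] that unfolding u_def by metis
  qed
  have "continuous_on (\<Union>K\<in>mesh S. K) u"
  proof (rule continuous_on_closed_Union[OF finite_mesh])
    fix K assume K: "K \<in> mesh S"
    show "closed K"
      by (rule element_triangle[OF K]) (simp add: compact_imp_closed finite_imp_compact_convex_hull)
    have "continuous_on K (Q K)" by (rule continuous_on_subset[OF polys2_continuous[OF Q(1)[OF K]]]) auto
    then show "continuous_on K u" by (rule continuous_on_eq) (simp add: u[OF K])
  qed
  then have "u \<in> V_space S"
  proof (intro V_spaceI)
    show "u x = 0" if "x \<notin> closure (Omega S)" for x
      using that by (simp add: u_def)
    show "\<exists>q\<in>polys2 (deg S). \<forall>x\<in>K. u x = q x" if "K \<in> mesh S" for K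
      using Q(1)[OF that] u[OF that] by blast
  qed (simp add: Union_mesh)
  moreover have "u z = f z" if "z \<in> nodes S" for z
  proof -
    obtain K where "K \<in> mesh S" "z \<in> K"
      using \<open>z \<in> nodes S\<close> nodes_Int_element unfolding nodes_def by blast
    then show ?thesis using u[of K z] Q(2)[of K z] that by simp
  qed
  ultimately show ?thesis by blast
qed

end

section \<open>Uniqueness and locality of weak gradients\<close>

text \<open>A continuously differentiable substitute for a step function: it vanishes for \<open>t \<le> 0\<close> and tends to \<open>1\<close> at
  infinity.\<close>

definition ramp :: "real \<Rightarrow> real" where
  "ramp t = (max 0 t)\<^sup>2 / (1 + (max 0 t)\<^sup>2)"

lemma has_derivative_max0_square: "((\<lambda>t::real. (max 0 t)\<^sup>2) has_field_derivative 2 * max 0 t) (at t)"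
proof (cases t "0::real" rule: linorder_cases)
  case less
  have "((\<lambda>t::real. 0) has_field_derivative 2 * max 0 t) (at t)"
    using less by (auto intro!: derivative_eq_intros simp: max_def)
  then show ?thesis
    by (rule has_field_derivative_transform_within_open[of _ _ _ "{..<0}"]) (use less in \<open>auto simp: max_def\<close>)
next
  case greater
  have "((\<lambda>t::real. t\<^sup>2) has_field_derivative 2 * max 0 t) (at t)"
    using greater by (auto intro!: derivative_eq_intros simp: max_def)
  then show ?thesis
    by (rule has_field_derivative_transform_within_open[of _ _ _ "{0<..}"]) (use greater in \<open>auto simp: max_def\<close>)
next
  case equal
  have "(\<lambda>h::real. max 0 h) \<midarrow>0\<rightarrow> max 0 0" by (intro tendsto_intros)
  moreover have "\<forall>\<^sub>F h in at (0::real). ((max 0 h)\<^sup>2 - 0) / h = max 0 h"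
    by (auto simp: eventually_at_filter max_def power2_eq_square)
  ultimately have "(\<lambda>h::real. ((max 0 h)\<^sup>2 - 0) / h) \<midarrow>0\<rightarrow> 0"
    by (subst tendsto_cong) auto
  then show ?thesis unfolding DERIV_def equal by simp
qed

definition ramp' :: "real \<Rightarrow> real" where
  "ramp' t = 2 * max 0 t / (1 + (max 0 t)\<^sup>2)\<^sup>2"

lemma one_plus_square_ne: "1 + (x::real)\<^sup>2 \<noteq> 0"
  using zero_le_power2[of x] by linarith

lemma DERIV_ramp: "(ramp has_field_derivative ramp' t) (at t)"
proof -
  have "((\<lambda>t. (max 0 t)\<^sup>2 / (1 + (max 0 t)\<^sup>2)) has_field_derivative ramp' t) (at t)"
    by (rule derivative_eq_intros has_derivative_max0_square refl one_plus_square_ne)+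
       (simp add: ramp'_def field_simps power2_eq_square)
  then show ?thesis by (simp add: ramp_def[abs_def])
qed

lemma continuous_on_ramp': "continuous_on UNIV ramp'"
  unfolding ramp'_def[abs_def] by (intro continuous_intros) (simp add: one_plus_square_ne)

lemma continuous_on_ramp: "continuous_on UNIV ramp"
  unfolding ramp_def[abs_def] by (intro continuous_intros) (simp add: one_plus_square_ne)

lemma ramp_bounds: "0 \<le> ramp t" "ramp t \<le> 1"
proof -
  have "0 < 1 + (max 0 t)\<^sup>2" by (rule add_pos_nonneg) auto
  then show "0 \<le> ramp t" "ramp t \<le> 1" by (simp_all add: ramp_def)
qed

lemma ramp_eq_0: "t \<le> 0 \<Longrightarrow> ramp t = 0"
  by (simp add: ramp_def max_def)

lemma ramp_tendsto_1: "filterlim u at_top F \<Longrightarrow> ((\<lambda>n. ramp (u n)) \<longlongrightarrow> 1) F"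
proof -
  assume u: "filterlim u at_top F"
  have ev: "\<forall>\<^sub>F n in F. ramp (u n) = 1 - inverse (1 + (u n)\<^sup>2)"
    using filterlim_at_top_dense[THEN iffD1, OF u, rule_format, of 0]
    by eventually_elim (use one_plus_square_ne in \<open>simp add: ramp_def max_def field_simps\<close>)
  have "filterlim (\<lambda>n. 1 + (u n)\<^sup>2) at_top F"
    by (intro filterlim_tendsto_add_at_top[OF tendsto_const] filterlim_pow_at_top u) auto
  then have "((\<lambda>n. inverse (1 + (u n)\<^sup>2)) \<longlongrightarrow> 0) F"
    by (rule tendsto_inverse_0_at_top)
  then have "((\<lambda>n. 1 - inverse (1 + (u n)\<^sup>2)) \<longlongrightarrow> 1 - 0) F"
    by (intro tendsto_intros)
  then show ?thesis using tendsto_cong[OF ev] by simp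
qed

text \<open>If \<open>a < b\<close>, then for \<open>n \<rightarrow> \<infinity>\<close> these functions converge to the indicator of the open interval, and the set
  \<open>n (x - a) (b - x) \<ge> 1\<close>, outside which they vanish, is compact in the interval.\<close>

definition cutoff :: "real \<Rightarrow> real \<Rightarrow> nat \<Rightarrow> real \<Rightarrow> real" where
  "cutoff a b n x = ramp (real n * ((x - a) * (b - x)) - 1)"

lemma cutoff_bounds: "0 \<le> cutoff a b n x" "cutoff a b n x \<le> 1"
  by (simp_all add: cutoff_def ramp_bounds)

lemma cutoff_nonzeroD:
  assumes "cutoff a b n x \<noteq> 0" "a < b" shows "1 \<le> real n * ((x - a) * (b - x))"
  using assms ramp_eq_0[of "real n * ((x - a) * (b - x)) - 1"] by (fastforce simp: cutoff_def)

lemma cutoff_supportD: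
  assumes "1 \<le> real n * ((x - a) * (b - x))" "a < b" shows "a < x" "x < b"
proof -
  have "0 < real n * ((x - a) * (b - x))" using assms(1) by linarith
  then have "0 < (x - a) * (b - x)" by (simp add: zero_less_mult_iff)
  then show "a < x" "x < b" using assms(2) by (auto simp: zero_less_mult_iff)
qed

lemma cutoff_tendsto:
  assumes "a < b"
  shows "(\<lambda>n. cutoff a b n x) \<longlonglongrightarrow> indicator {a<..<b} x"
proof (cases "x \<in> {a<..<b}")
  case True
  then have "0 < (x - a) * (b - x)" by simp
  then have "filterlim (\<lambda>n. - 1 + real n * ((x - a) * (b - x))) at_top sequentially"
    by (intro filterlim_tendsto_add_at_top[OF tendsto_const] filterlim_at_top_mult_tendsto_pos[OF tendsto_const]
          filterlim_real_sequentially)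
  from ramp_tendsto_1[OF this] show ?thesis
    using True by (simp add: cutoff_def[abs_def] algebra_simps)
next
  case False
  then have "cutoff a b n x = 0" for n
    using cutoff_nonzeroD[of a b n x] cutoff_supportD[of n x a b] assms by auto
  then show ?thesis using False by simp
qed

lemma cutoff_DERIV:
  "(cutoff a b n has_field_derivative ramp' (real n * ((x - a) * (b - x)) - 1) * (real n * ((b - x) - (x - a)))) (at x)"
  unfolding cutoff_def[abs_def]
  by (rule DERIV_chain2[OF DERIV_ramp]) (auto intro!: derivative_eq_intros simp: algebra_simps)

lemma box_plane: "box (a, c) (b, d :: real) = {a<..<b :: real} \<times> {c<..<d}"
  by (auto simp: box_def Basis_prod_def)

lemma cutoff_test_function:
  assumes "a1 < b1" "a2 < b2" "box (a1, a2) (b1, b2) \<subseteq> D"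
  shows "\<exists>\<phi>'. test_function D (\<lambda>z. cutoff a1 b1 n (fst z) * cutoff a2 b2 n (snd z)) \<phi>'"
proof -
  define d where "d a b x = ramp' (real n * ((x - a) * (b - x)) - 1) * (real n * ((b - x) - (x - a)))" for a b x
  have cd: "continuous_on UNIV (\<lambda>z. d a b (f z))" if "continuous_on UNIV f" for a b and f :: "plane \<Rightarrow> real"
    unfolding d_def using that
    by (intro continuous_intros continuous_on_compose2[OF continuous_on_ramp']) auto
  have cc: "continuous_on UNIV (\<lambda>z. cutoff a b n (f z))" if "continuous_on UNIV f" for a b and f :: "plane \<Rightarrow> real"
    unfolding cutoff_def using that
    by (intro continuous_intros continuous_on_compose2[OF continuous_on_ramp]) auto
  define C where "C = {z::plane. 1 \<le> real n * ((fst z - a1) * (b1 - fst z))} \<inter> {z. 1 \<le> real n * ((snd z - a2) * (b2 - snd z))}"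
  have supp: "{z. cutoff a1 b1 n (fst z) * cutoff a2 b2 n (snd z) \<noteq> 0} \<subseteq> C"
    using cutoff_nonzeroD assms(1,2) by (auto simp: C_def)
  have Cbox: "C \<subseteq> box (a1, a2) (b1, b2)"
    unfolding C_def box_plane using cutoff_supportD assms(1,2) by fastforce
  have "closed C"
    unfolding C_def by (intro closed_Int closed_Collect_le continuous_intros)
  then have cl: "closure {z. cutoff a1 b1 n (fst z) * cutoff a2 b2 n (snd z) \<noteq> 0} \<subseteq> C"
    using supp by (simp add: closure_minimal)
  have "GDERIV (\<lambda>z. cutoff a1 b1 n (fst z) * cutoff a2 b2 n (snd z)) z :>
      (d a1 b1 (fst z) * cutoff a2 b2 n (snd z), cutoff a1 b1 n (fst z) * d a2 b2 (snd z))" for z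
    unfolding gderiv_def d_def
    by (rule has_derivative_eq_rhs[OF has_derivative_mult[OF DERIV_compose_FDERIV[OF cutoff_DERIV has_derivative_fst[OF has_derivative_ident]]
          DERIV_compose_FDERIV[OF cutoff_DERIV has_derivative_snd[OF has_derivative_ident]]]])
       (auto simp: inner_prod_def fun_eq_iff algebra_simps)
  moreover have "continuous_on UNIV (\<lambda>z. (d a1 b1 (fst z) * cutoff a2 b2 n (snd z), cutoff a1 b1 n (fst z) * d a2 b2 (snd z)))"
    by (intro continuous_intros cd cc)
  moreover have "compact (closure {z. cutoff a1 b1 n (fst z) * cutoff a2 b2 n (snd z) \<noteq> 0})"
    using bounded_subset[OF bounded_box, of _ "(a1,a2)" "(b1,b2)"] cl Cbox
    by (auto simp: compact_eq_bounded_closed)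
  ultimately show ?thesis
    unfolding test_function_def using subset_trans[OF subset_trans[OF cl Cbox] assms(3)]
    by (intro exI[of _ "\<lambda>z. (d a1 b1 (fst z) * cutoff a2 b2 n (snd z), cutoff a1 b1 n (fst z) * d a2 b2 (snd z))"] conjI allI)
qed

text \<open>The fundamental lemma of the calculus of variations. Products of cutoff functions converge boundedly to
  indicators of open boxes, so the integral over every open box vanishes by dominated convergence. The
  open boxes are an intersection-stable generator of the Borel sets, hence the integral over every
  Borel set vanishes.\<close>

lemma AE_zero_if_test_integrals_zero:
  fixes f :: "plane \<Rightarrow> complex"
  assumes f: "set_integrable lborel (box a b) f"
    and zero: "\<And>\<phi> \<phi>'. test_function (box a b) \<phi> \<phi>' \<Longrightarrow> (LINT x:box a b|lborel. f x * of_real (\<phi> x)) = 0"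
  shows "AE x in lborel. x \<in> box a b \<longrightarrow> f x = 0"
proof -
  define F where "F x = indicator (box a b) x *\<^sub>R f x" for x
  have F: "integrable lborel F" using f by (simp add: F_def[abs_def] set_integrable_def)
  have Fm: "F \<in> borel_measurable lborel" using F by (rule borel_measurable_integrable)
  have boxF: "(LINT x:box c d|lborel. F x) = 0" if cd: "box c d \<subseteq> box a b" for c d :: plane
  proof (cases "box c d = {}")
    case False
    obtain a1 a2 b1 b2 where c: "c = (a1, a2)" "d = (b1, b2)" by fastforce
    have lt: "a1 < b1" "a2 < b2" using False by (auto simp: c box_plane)
    define \<phi> where "\<phi> n z = cutoff a1 b1 n (fst z) * cutoff a2 b2 n (snd z)" for n and z :: plane
    have "(LINT x|lborel. F x * of_real (\<phi> n x)) = 0" for n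
    proof -
      obtain \<phi>' where "test_function (box a b) (\<phi> n) \<phi>'"
        using cutoff_test_function[OF lt cd[unfolded c]] unfolding \<phi>_def by blast
      from zero[OF this] show ?thesis by (simp add: set_lebesgue_integral_def F_def)
    qed
    moreover have "(\<lambda>n. LINT x|lborel. F x * of_real (\<phi> n x)) \<longlonglongrightarrow> (LINT x|lborel. F x * of_real (indicator (box c d) x))"
    proof (rule integral_dominated_convergence)
      show "integrable lborel (\<lambda>x. norm (F x))" using F by simp
      show "(\<lambda>x. F x * complex_of_real (indicat_real (box c d) x)) \<in> borel_measurable lborel"
        using Fm by measurable
      have "(\<lambda>x. cutoff a b n (g x)) \<in> borel_measurable borel" if "continuous_on UNIV g" for a b n and g :: "plane \<Rightarrow> real"
        unfolding cutoff_def using that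
        by (intro borel_measurable_continuous_onI continuous_intros continuous_on_compose2[OF continuous_on_ramp]) auto
      from this[OF continuous_on_fst[OF continuous_on_id]] this[OF continuous_on_snd[OF continuous_on_id]]
      have [measurable]: "\<phi> n \<in> borel_measurable borel" for n
        unfolding \<phi>_def[abs_def] by (intro borel_measurable_times) simp_all
      show "(\<lambda>x. F x * complex_of_real (\<phi> n x)) \<in> borel_measurable lborel" for n
        using Fm by measurable
      have "(\<lambda>n. \<phi> n x) \<longlonglongrightarrow> indicator (box c d) x" for x
      proof -
        have "(\<lambda>n. \<phi> n x) \<longlonglongrightarrow> indicator {a1<..<b1} (fst x) * indicator {a2<..<b2} (snd x)"
          unfolding \<phi>_def by (intro tendsto_mult cutoff_tendsto lt)
        also have "indicator {a1<..<b1} (fst x) * indicator {a2<..<b2} (snd x) = (indicator (box c d) x :: real)"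
          by (cases x) (simp add: c box_plane indicator_def)
        finally show ?thesis .
      qed
      then show "AE x in lborel. (\<lambda>n. F x * complex_of_real (\<phi> n x)) \<longlonglongrightarrow> F x * complex_of_real (indicator (box c d) x)"
        by (intro AE_I2 tendsto_intros)
      have "0 \<le> \<phi> n x" "\<phi> n x \<le> 1" for n x
        using cutoff_bounds by (auto simp: \<phi>_def intro!: mult_le_one)
      then have "norm (F x * complex_of_real (\<phi> n x)) \<le> norm (F x)" for n x
        by (simp add: norm_mult mult_left_le)
      then show "AE x in lborel. norm (F x * complex_of_real (\<phi> n x)) \<le> norm (F x)" for n by simp
    qed
    ultimately have "(LINT x|lborel. F x * of_real (indicator (box c d) x)) = 0"
      by (simp add: LIMSEQ_const_iff)
    then show ?thesis by (simp add: set_lebesgue_integral_def scaleR_conv_of_real mult.commute)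
  qed (simp add: set_lebesgue_integral_def)
  have Fin: "set_integrable lborel A F" if "A \<in> sets borel" for A
    using F that integrable_mult_indicator[of A lborel F] by (simp add: set_integrable_def)
  have total: "(LINT x|lborel. F x) = 0"
    using boxF[of a b] by (simp add: set_lebesgue_integral_def F_def flip: indicator_inter_arith)
  have "(LINT x:A|lborel. F x) = 0" if "A \<in> sets borel" for A
  proof -
    have "Int_stable (range (\<lambda>(a, b). box a b :: plane set))"
      by (auto simp: Int_stable_def box_Int_box)
    moreover have "range (\<lambda>(a, b). box a b :: plane set) \<subseteq> Pow UNIV" by simp
    moreover have "A \<in> sigma_sets UNIV (range (\<lambda>(a, b). box a b :: plane set))"
      using that unfolding borel_eq_box by simp
    ultimately show ?thesis
    proof (induction rule: sigma_sets_induct_disjoint)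
      case (basic A)
      then obtain c d where A: "A = box c d" by auto
      obtain c' d' where cd': "box c d \<inter> box a b = box c' d'"
        by (auto simp: box_Int_box)
      have "(LINT x:A|lborel. F x) = (LINT x:box c' d'|lborel. F x)"
        unfolding set_lebesgue_integral_def A cd'[symmetric]
        by (rule Bochner_Integration.integral_cong) (auto simp: F_def indicator_def)
      then show ?case using boxF[of c' d'] cd' by auto
    next
      case empty then show ?case by (simp add: set_lebesgue_integral_def)
    next
      case (compl A)
      then have A: "A \<in> sets borel" unfolding borel_eq_box by simp
      have "(LINT x:-A|lborel. F x) = (LINT x|lborel. F x) - (LINT x:A|lborel. F x)"
      proof -
        have "(LINT x:(A \<union> -A)|lborel. F x) = (LINT x:A|lborel. F x) + (LINT x:-A|lborel. F x)"
          by (rule set_integral_Un) (use Fin A in auto)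
        then show ?thesis by (simp add: set_lebesgue_integral_def)
      qed
      then show ?case using compl total by (simp add: Compl_eq_Diff_UNIV)
    next
      case (union A)
      then have A: "A i \<in> sets borel" for i unfolding borel_eq_box by auto
      have "(LINT x:(\<Union>i. A i)|lborel. F x) = (\<Sum>i. LINT x:A i|lborel. F x)"
        by (rule lebesgue_integral_countable_add) (use A union Fin in \<open>auto simp: disjoint_family_on_def\<close>)
      then show ?case using union by simp
    qed
  qed
  then have "AE x in lborel. F x = 0"
    by (intro sigma_finite_measure.density_zero[OF sigma_finite_lborel F]) simp
  then show ?thesis
    by eventually_elim (auto simp: F_def indicator_def split: if_splits)
qed

lemma set_integrable_bounded_by:
  fixes f :: "plane \<Rightarrow> complex" and g :: "plane \<Rightarrow> real"
  assumes "set_integrable lborel D g" "set_borel_measurable lborel D f" "\<And>x. x \<in> D \<Longrightarrow> norm (f x) \<le> g x"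
  shows "set_integrable lborel D f"
  unfolding set_integrable_def
proof (rule Bochner_Integration.integrable_bound)
  show "integrable lborel (\<lambda>x. indicator D x *\<^sub>R g x)" using assms(1) by (simp add: set_integrable_def)
  show "(\<lambda>x. indicat_real D x *\<^sub>R f x) \<in> borel_measurable lborel" using assms(2) by (simp add: set_borel_measurable_def)
  show "AE x in lborel. norm (indicat_real D x *\<^sub>R f x) \<le> norm (indicat_real D x *\<^sub>R g x)"
    using assms(3) by (auto simp: indicator_def intro!: AE_I2 order_trans[OF assms(3)])
qed

lemma set_borel_measurable_continuous:
  fixes h :: "'b :: real_normed_vector \<Rightarrow> 'c :: real_normed_vector"
  assumes "continuous_on UNIV h" "h 0 = 0" "set_borel_measurable M D v"
  shows "set_borel_measurable M D (\<lambda>x. h (v x))"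
proof -
  have "(\<lambda>x. h (indicat_real D x *\<^sub>R v x)) \<in> borel_measurable M"
    using assms(3) borel_measurable_continuous_onI[OF assms(1)] unfolding set_borel_measurable_def
    by (rule measurable_compose)
  also have "(\<lambda>x. h (indicat_real D x *\<^sub>R v x)) = (\<lambda>x. indicat_real D x *\<^sub>R h (v x))"
    using assms(2) by (auto simp: indicator_def fun_eq_iff)
  finally show ?thesis by (simp add: set_borel_measurable_def)
qed

lemma set_borel_measurable_continuous2:
  fixes u v :: "'a \<Rightarrow> complex" and h :: "complex \<times> complex \<Rightarrow> complex"
  assumes "continuous_on UNIV h" "h 0 = 0" "set_borel_measurable M D u" "set_borel_measurable M D v"
  shows "set_borel_measurable M D (\<lambda>x. h (u x, v x))"
  by (rule set_borel_measurable_continuous[OF assms(1,2)])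
     (use assms(3,4) in \<open>simp add: set_borel_measurable_def borel_measurable_Pair\<close>)

lemma L2_on_measurable: "v \<in> L2_on D \<Longrightarrow> set_borel_measurable lborel D v"
  by (simp add: L2_on_def)

lemma L2_on_square: "v \<in> L2_on D \<Longrightarrow> set_integrable lborel D (\<lambda>x. (norm (v x))\<^sup>2)"
  by (simp add: L2_on_def)

lemma set_borel_measurable_mult:
  assumes "set_borel_measurable M D u" "set_borel_measurable M D (v :: _ \<Rightarrow> complex)"
  shows "set_borel_measurable M D (\<lambda>x. u x * v x)"
  using set_borel_measurable_continuous2[of "\<lambda>z. fst z * snd z", OF _ _ assms] by (simp add: continuous_intros)

lemma L2_on_mult_cnj_integrable:
  assumes "u \<in> L2_on D" "v \<in> L2_on D"
  shows "set_integrable lborel D (\<lambda>x. u x * cnj (v x))"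
proof (rule set_integrable_bounded_by)
  show "set_integrable lborel D (\<lambda>x. (norm (u x))\<^sup>2 + (norm (v x))\<^sup>2)"
    by (intro set_integral_add L2_on_square assms)
  show "set_borel_measurable lborel D (\<lambda>x. u x * cnj (v x))"
    by (intro set_borel_measurable_mult set_borel_measurable_continuous[of cnj] L2_on_measurable assms continuous_intros) simp
  show "norm (u x * cnj (v x)) \<le> (norm (u x))\<^sup>2 + (norm (v x))\<^sup>2" for x
  proof -
    have "2 * (norm (u x) * norm (v x)) \<le> (norm (u x))\<^sup>2 + (norm (v x))\<^sup>2"
      using sum_squares_bound[of "norm (u x)" "norm (v x)"] by simp
    moreover have "0 \<le> norm (u x) * norm (v x)" by simp
    ultimately show ?thesis unfolding norm_mult complex_mod_cnj by linarith
  qed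
qed

lemma finite_measure_imp_set_integrable_const:
  "emeasure lborel D < \<infinity> \<Longrightarrow> D \<in> sets borel \<Longrightarrow> set_integrable lborel D (\<lambda>x :: plane. c :: real)"
  unfolding set_integrable_def by (intro integrable_scaleR_left) (simp add: integrable_indicator_iff)

lemma L2_on_set_integrable:
  assumes "v \<in> L2_on D" "emeasure lborel D < \<infinity>" "D \<in> sets borel"
  shows "set_integrable lborel D v"
proof (rule set_integrable_bounded_by)
  show "set_integrable lborel D (\<lambda>x. 1 + (norm (v x))\<^sup>2)"
    by (intro set_integral_add finite_measure_imp_set_integrable_const L2_on_square assms)
  show "norm (v x) \<le> 1 + (norm (v x))\<^sup>2" for x
  proof (cases "norm (v x) \<le> 1")
    case False
    then have "norm (v x) * 1 \<le> norm (v x) * norm (v x)" by (intro mult_left_mono) auto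
    then show ?thesis by (simp add: power2_eq_square)
  qed (simp add: add_increasing2)
qed (use assms L2_on_measurable in auto)

lemma L2_on_bounded:
  assumes "set_borel_measurable lborel D v" "\<And>x. x \<in> D \<Longrightarrow> norm (v x) \<le> B"
    and "emeasure lborel D < \<infinity>" "D \<in> sets borel"
  shows "v \<in> L2_on D"
proof -
  have "set_integrable lborel D (\<lambda>x. complex_of_real ((norm (v x))\<^sup>2))"
  proof (rule set_integrable_bounded_by)
    show "set_integrable lborel D (\<lambda>x. B\<^sup>2)" by (rule finite_measure_imp_set_integrable_const) fact+
    show "set_borel_measurable lborel D (\<lambda>x. complex_of_real ((norm (v x))\<^sup>2))"
      by (rule set_borel_measurable_continuous[of "\<lambda>z. complex_of_real ((norm z)\<^sup>2)", OF _ _ assms(1)])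
         (auto intro!: continuous_intros)
    show "norm (complex_of_real ((norm (v x))\<^sup>2)) \<le> B\<^sup>2" if "x \<in> D" for x
      using power_mono[OF assms(2)[OF that], of 2] by (simp add: norm_power)
  qed
  from integrable_Re[OF this[unfolded set_integrable_def]]
  have "set_integrable lborel D (\<lambda>x. (norm (v x))\<^sup>2)"
    by (simp add: set_integrable_def)
  then show ?thesis using assms(1) by (simp add: L2_on_def)
qed

lemma L2_on_add_scaled:
  assumes "u \<in> L2_on D" "v \<in> L2_on D"
  shows "(\<lambda>x. u x + c * v x) \<in> L2_on D"
proof -
  have m: "set_borel_measurable lborel D (\<lambda>x. u x + c * v x)"
    using set_borel_measurable_continuous2[of "\<lambda>z. fst z + c * snd z", OF _ _ assms[THEN L2_on_measurable]]
    by (simp add: continuous_intros)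
  have "set_integrable lborel D (\<lambda>x. (norm (u x + c * v x))\<^sup>2)"
    unfolding set_integrable_def
  proof (rule Bochner_Integration.integrable_bound)
    show "integrable lborel (\<lambda>x. indicator D x *\<^sub>R (2 * (norm (u x))\<^sup>2 + 2 * (norm c)\<^sup>2 * (norm (v x))\<^sup>2))"
      unfolding set_integrable_def[symmetric]
      by (intro set_integral_add set_integrable_mult_right L2_on_square assms)
    show "(\<lambda>x. indicat_real D x *\<^sub>R (norm (u x + c * v x))\<^sup>2) \<in> borel_measurable lborel"
      using set_borel_measurable_continuous[of "\<lambda>z. (norm z)\<^sup>2", OF _ _ m]
      by (simp add: set_borel_measurable_def continuous_intros)
    have "(norm (a + c * b))\<^sup>2 \<le> 2 * (norm a)\<^sup>2 + 2 * (norm c)\<^sup>2 * (norm b)\<^sup>2" for a b :: complex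
    proof -
      have "norm (a + c * b) \<le> norm a + norm c * norm b"
        using norm_triangle_ineq[of a "c * b"] by (simp add: norm_mult)
      then have "(norm (a + c * b))\<^sup>2 \<le> (norm a + norm c * norm b)\<^sup>2" by (rule power_mono) simp
      also have "\<dots> \<le> 2 * (norm a)\<^sup>2 + 2 * (norm c * norm b)\<^sup>2"
        using sum_squares_bound[of "norm a" "norm c * norm b"] by (simp add: power2_sum)
      finally show ?thesis by (simp add: power_mult_distrib)
    qed
    then show "AE x in lborel. norm (indicat_real D x *\<^sub>R (norm (u x + c * v x))\<^sup>2)
        \<le> norm (indicat_real D x *\<^sub>R (2 * (norm (u x))\<^sup>2 + 2 * (norm c)\<^sup>2 * (norm (v x))\<^sup>2))"
      by (intro AE_I2) (auto simp: indicator_def intro: order_trans)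
  qed
  then show ?thesis using m by (simp add: L2_on_def)
qed

lemma L2_on_mono:
  assumes "v \<in> L2_on D" "D' \<subseteq> D" "D' \<in> sets borel" "D \<in> sets borel"
  shows "v \<in> L2_on D'"
  using assms set_integrable_subset[of lborel D "\<lambda>x. (norm (v x))\<^sup>2" D'] set_borel_measurable_subset[of lborel D v D']
  by (simp add: L2_on_def)

lemma L2_on_cong:
  assumes "\<And>x. x \<in> D \<Longrightarrow> u x = v x"
  shows "u \<in> L2_on D \<longleftrightarrow> v \<in> L2_on D"
proof -
  have "(\<lambda>x. indicat_real D x *\<^sub>R u x) = (\<lambda>x. indicat_real D x *\<^sub>R v x)"
    "(\<lambda>x. indicat_real D x *\<^sub>R (norm (u x))\<^sup>2) = (\<lambda>x. indicat_real D x *\<^sub>R (norm (v x))\<^sup>2)"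
    using assms by (auto simp: indicator_def fun_eq_iff)
  then show ?thesis by (simp add: L2_on_def set_borel_measurable_def set_integrable_def)
qed

lemma weak_gradient_cong:
  assumes "\<And>x. x \<in> D \<Longrightarrow> u x = v x"
  shows "weak_gradient D u g \<longleftrightarrow> weak_gradient D v g"
proof -
  have "(LINT x:D|lborel. u x * \<psi> x) = (LINT x:D|lborel. v x * \<psi> x)" for \<psi> :: "plane \<Rightarrow> complex"
    unfolding set_lebesgue_integral_def
    by (rule Bochner_Integration.integral_cong) (auto simp: indicator_def assms)
  then show ?thesis using L2_on_cong[OF assms, of D] by (simp add: weak_gradient_def)
qed

lemma grad_cong:
  assumes "\<And>x. x \<in> D \<Longrightarrow> u x = v x"
  shows "grad D u = grad D v"
  using weak_gradient_cong[OF assms] by (simp add: grad_def)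

lemma test_function_outside:
  assumes "test_function D \<phi> \<phi>'" "x \<notin> D"
  shows "\<phi> x = 0" "\<phi>' x = 0"
proof -
  have x: "x \<notin> closure {x. \<phi> x \<noteq> 0}" using assms unfolding test_function_def by blast
  note sub = closure_subset[of "{x. \<phi> x \<noteq> 0}"]
  from x sub show "\<phi> x = 0" by auto
  have "(\<phi> has_derivative (\<lambda>h. h \<bullet> \<phi>' x)) (at x)"
    using assms(1) unfolding test_function_def gderiv_def by blast
  moreover have "(\<phi> has_derivative (\<lambda>h. 0)) (at x)"
    by (rule has_derivative_transform_within_open[OF has_derivative_const[of 0], where s = "- closure {x. \<phi> x \<noteq> 0}"])
       (use x sub in auto)
  ultimately have "(\<lambda>h. h \<bullet> \<phi>' x) = (\<lambda>h. 0)" by (rule has_derivative_unique)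
  then have "\<phi>' x \<bullet> \<phi>' x = 0" by (rule fun_cong)
  then show "\<phi>' x = 0" by simp
qed

lemma test_function_mono: "test_function D' \<phi> \<phi>' \<Longrightarrow> D' \<subseteq> D \<Longrightarrow> test_function D \<phi> \<phi>'"
  unfolding test_function_def by blast

text \<open>Test functions of the smaller set are test functions of the larger one, and their values and gradients
  vanish outside the smaller set.\<close>

lemma weak_gradient_mono:
  assumes "weak_gradient D v g" "D' \<subseteq> D" "D' \<in> sets borel" "D \<in> sets borel"
  shows "weak_gradient D' v g"
proof -
  have eq: "(LINT x:D'|lborel. f x * of_real (\<psi> x)) = (LINT x:D|lborel. f x * of_real (\<psi> x))"
    if "\<And>x. x \<notin> D' \<Longrightarrow> \<psi> x = 0" for f :: "plane \<Rightarrow> complex" and \<psi> :: "plane \<Rightarrow> real"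
    unfolding set_lebesgue_integral_def
    using that assms(2) by (intro Bochner_Integration.integral_cong) (auto simp: indicator_def)
  show ?thesis
    unfolding weak_gradient_def
  proof (intro conjI allI impI)
    fix \<phi> \<phi>' assume t: "test_function D' \<phi> \<phi>'"
    note t' = test_function_mono[OF t assms(2)]
    have z: "fst (\<phi>' x) = 0" "snd (\<phi>' x) = 0" "\<phi> x = 0" if "x \<notin> D'" for x
      using test_function_outside[OF t that] by auto
    show "(LINT x:D'|lborel. v x * of_real (fst (\<phi>' x))) = - (LINT x:D'|lborel. fst (g x) * of_real (\<phi> x))"
      using assms(1) t' by (simp add: weak_gradient_def eq z)
    show "(LINT x:D'|lborel. v x * of_real (snd (\<phi>' x))) = - (LINT x:D'|lborel. snd (g x) * of_real (\<phi> x))"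
      using assms(1) t' by (simp add: weak_gradient_def eq z)
  qed (use assms L2_on_mono in \<open>auto simp: weak_gradient_def\<close>)
qed

lemma set_integrable_times_test:
  assumes "v \<in> L2_on D" "bounded D" "D \<in> sets borel" "continuous_on UNIV \<psi>"
  shows "set_integrable lborel D (\<lambda>x. v x * of_real (\<psi> x))"
proof -
  have "compact (\<psi> ` closure D)"
    by (intro compact_continuous_image continuous_on_subset[OF assms(4)]) (use assms in \<open>auto simp: compact_closure\<close>)
  then obtain B where B: "\<And>x. x \<in> closure D \<Longrightarrow> norm (\<psi> x) \<le> B"
    by (metis bounded_iff compact_imp_bounded imageI)
  have fin: "emeasure lborel D < \<infinity>" using assms(2,3) by (intro emeasure_bounded_finite)
  have m: "set_borel_measurable lborel D (\<lambda>x. of_real (\<psi> x) :: complex)"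
    unfolding set_borel_measurable_def using borel_measurable_continuous_onI[OF assms(4)] assms(3) by measurable
  show ?thesis
  proof (rule set_integrable_bounded_by)
    show "set_integrable lborel D (\<lambda>x. B * norm (v x))"
      using set_integrable_norm[OF L2_on_set_integrable[OF assms(1) fin assms(3)]] by (rule set_integrable_mult_right)
    show "set_borel_measurable lborel D (\<lambda>x. v x * of_real (\<psi> x))"
      by (intro set_borel_measurable_mult L2_on_measurable assms m)
    show "norm (v x * of_real (\<psi> x)) \<le> B * norm (v x)" if "x \<in> D" for x
      using B[of x] that closure_subset[of D] mult_right_mono[of "norm (\<psi> x)" B "norm (v x)"]
      by (auto simp: norm_mult mult.commute)
  qed
qed

lemma test_function_continuous:
  assumes "test_function D \<phi> \<phi>'"
  shows "continuous_on UNIV \<phi>" "continuous_on UNIV (\<lambda>x. fst (\<phi>' x))" "continuous_on UNIV (\<lambda>x. snd (\<phi>' x))"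
proof -
  have "(\<phi> has_derivative (\<lambda>h. h \<bullet> \<phi>' x)) (at x)" for x
    using assms unfolding test_function_def gderiv_def by blast
  then show "continuous_on UNIV \<phi>"
    by (meson continuous_at_imp_continuous_on has_derivative_continuous)
  show "continuous_on UNIV (\<lambda>x. fst (\<phi>' x))" "continuous_on UNIV (\<lambda>x. snd (\<phi>' x))"
    using assms unfolding test_function_def by (blast intro: continuous_on_fst continuous_on_snd)+
qed

lemma weak_gradient_add_scaled:
  assumes u: "weak_gradient D u g" and v: "weak_gradient D v h" and D: "bounded D" "D \<in> sets borel"
  shows "weak_gradient D (\<lambda>x. u x + c * v x) (\<lambda>x. (fst (g x) + c * fst (h x), snd (g x) + c * snd (h x)))"
proof -
  have lin: "(LINT x:D|lborel. (p x + c * q x) * of_real (\<psi> x)) =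
      (LINT x:D|lborel. p x * of_real (\<psi> x)) + c * (LINT x:D|lborel. q x * of_real (\<psi> x))"
    if "p \<in> L2_on D" "q \<in> L2_on D" "continuous_on UNIV \<psi>" for p q \<psi>
  proof -
    note i = set_integrable_times_test[OF that(1) D that(3)] set_integrable_times_test[OF that(2) D that(3)]
    have "(LINT x:D|lborel. (p x + c * q x) * of_real (\<psi> x)) =
        (LINT x:D|lborel. p x * of_real (\<psi> x) + c * (q x * of_real (\<psi> x)))"
      by (simp add: algebra_simps)
    also have "\<dots> = (LINT x:D|lborel. p x * of_real (\<psi> x)) + (LINT x:D|lborel. c * (q x * of_real (\<psi> x)))"
      using i by (intro set_integral_add set_integrable_mult_right) auto
    finally show ?thesis by simp
  qed
  show ?thesis
    unfolding weak_gradient_def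
  proof (intro conjI allI impI)
    fix \<phi> \<phi>' assume t: "test_function D \<phi> \<phi>'"
    note c = test_function_continuous[OF t]
    show "(LINT x:D|lborel. (u x + c * v x) * of_real (fst (\<phi>' x))) =
        - (LINT x:D|lborel. fst (fst (g x) + c * fst (h x), snd (g x) + c * snd (h x)) * of_real (\<phi> x))"
      using u v t c by (simp add: weak_gradient_def lin)
    show "(LINT x:D|lborel. (u x + c * v x) * of_real (snd (\<phi>' x))) =
        - (LINT x:D|lborel. snd (fst (g x) + c * fst (h x), snd (g x) + c * snd (h x)) * of_real (\<phi> x))"
      using u v t c by (simp add: weak_gradient_def lin)
  qed (use u v in \<open>auto simp: weak_gradient_def intro!: L2_on_add_scaled\<close>)
qed

text \<open>The difference of two weak gradients is a weak gradient of \<open>v - v\<close>, so its components integrate to zero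
  against every test function.\<close>

lemma weak_gradient_unique:
  assumes g: "weak_gradient (box a b) v g" and h: "weak_gradient (box a b) v h"
  shows "AE x in lborel. x \<in> box a b \<longrightarrow> g x = h x"
proof -
  have D: "bounded (box a b)" "box a b \<in> sets borel" by auto
  have fin: "emeasure lborel (box a b) < \<infinity>" using D by (intro emeasure_bounded_finite)
  have d: "weak_gradient (box a b) (\<lambda>x. v x + (-1) * v x) (\<lambda>x. (fst (g x) + (-1) * fst (h x), snd (g x) + (-1) * snd (h x)))"
    by (rule weak_gradient_add_scaled[OF g h D])
  have comp: "AE x in lborel. x \<in> box a b \<longrightarrow> f x = 0"
    if "f \<in> L2_on (box a b)"
      "\<And>\<phi> \<phi>'. test_function (box a b) \<phi> \<phi>' \<Longrightarrow> 0 = - (LINT x:box a b|lborel. f x * of_real (\<phi> x))" for f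
    by (rule AE_zero_if_test_integrals_zero[OF L2_on_set_integrable[OF that(1) fin D(2)]])
       (use that(2) in \<open>simp only: neg_0_equal_iff_equal\<close>)
  note d' = d[unfolded weak_gradient_def fst_conv snd_conv]
  have z: "(LINT x:box a b|lborel. (v x + (-1) * v x) * of_real (\<psi> x)) = 0" for \<psi> :: "plane \<Rightarrow> real"
    by (simp add: set_lebesgue_integral_def)
  have "AE x in lborel. x \<in> box a b \<longrightarrow> fst (g x) + (-1) * fst (h x) = 0"
    "AE x in lborel. x \<in> box a b \<longrightarrow> snd (g x) + (-1) * snd (h x) = 0"
    by (rule comp; use d' in \<open>simp only: z\<close>)+
  then show ?thesis
    by eventually_elim (auto simp: prod_eq_iff)
qed

lemma weak_gradient_grad: "v \<in> H1 D \<Longrightarrow> weak_gradient D v (grad D v)"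
  unfolding H1_def grad_def mem_Collect_eq by (rule someI_ex[of "weak_gradient D v"])

lemma grad_eq_weak_gradient:
  assumes "weak_gradient (box a b) v g"
  shows "AE x in lborel. x \<in> box a b \<longrightarrow> grad (box a b) v x = g x"
  by (rule weak_gradient_unique[OF weak_gradient_grad assms]) (use assms in \<open>auto simp: H1_def\<close>)

section \<open>Finite element functions have weak gradients\<close>

lemma polys2_partial_fst:
  assumes "q \<in> polys2 p"
  shows "\<exists>q'. continuous_on UNIV q' \<and> (\<forall>x y. ((\<lambda>s. q (s, y)) has_vector_derivative q' (x, y)) (at x))"
proof -
  obtain c where c: "\<And>x y. q (x, y) = (\<Sum>i\<le>p. \<Sum>j\<le>p - i. c i j * of_real x ^ i * of_real y ^ j)"
    using assms unfolding polys2_def by blast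
  define q' where "q' z = (\<Sum>i\<le>p. \<Sum>j\<le>p - i. c i j * of_real (of_nat i * fst z ^ (i - 1)) * of_real (snd z) ^ j)" for z :: plane
  have "continuous_on UNIV q'" unfolding q'_def by (intro continuous_intros)
  moreover have "((\<lambda>s. q (s, y)) has_vector_derivative q' (x, y)) (at x)" for x y
  proof -
    have "((\<lambda>s. c i j * of_real (s ^ i) * of_real y ^ j) has_vector_derivative
        c i j * of_real (of_nat i * x ^ (i - 1)) * of_real y ^ j) (at x)" for i j
      by (intro has_vector_derivative_mult_left has_vector_derivative_mult_right has_vector_derivative_of_real)
         (auto intro!: derivative_eq_intros)
    then have "((\<lambda>s. \<Sum>i\<le>p. \<Sum>j\<le>p - i. c i j * of_real (s ^ i) * of_real y ^ j) has_vector_derivative q' (x, y)) (at x)"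
      unfolding q'_def by (auto intro!: has_vector_derivative_sum)
    then show ?thesis by (simp add: c)
  qed
  ultimately show ?thesis by blast
qed

lemma polys2_partial_snd:
  assumes "q \<in> polys2 p"
  shows "\<exists>q'. continuous_on UNIV q' \<and> (\<forall>x y. ((\<lambda>s. q (x, s)) has_vector_derivative q' (x, y)) (at y))"
proof -
  have "affine_plane (\<lambda>z. (snd z, fst z))"
    by (rule affine_planeI[of _ 0 0 1 0 1 0]) simp
  from polys2_partial_fst[OF polys2_compose_affine[OF assms this]]
  obtain q' where q': "continuous_on UNIV q'" "\<And>x y. ((\<lambda>s. q (y, s)) has_vector_derivative q' (x, y)) (at x)"
    by auto
  have "continuous_on UNIV (\<lambda>z :: plane. q' (snd z, fst z))"
    by (intro continuous_on_compose2[OF q'(1)] continuous_intros) auto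
  with q'(2) show ?thesis by (intro exI[of _ "\<lambda>z. q' (snd z, fst z)"]) simp
qed

lemma finite_frontier_compact_convex_real:
  assumes "compact (I :: real set)" "convex I"
  shows "finite (frontier I)"
proof -
  obtain c d where "I = {c..d}"
    using connected_compact_interval_1[of I] assms convex_connected by blast
  then have "frontier I \<subseteq> {c, d}" by (auto simp: frontier_def)
  then show ?thesis by (rule finite_subset) simp
qed

text \<open>The average over all elements that contain the point. Applied to elementwise partial derivatives, it is
  defined everywhere on the domain, edges included, and visibly measurable.\<close>

definition mesh_average :: "plane set set \<Rightarrow> (plane set \<Rightarrow> plane \<Rightarrow> complex) \<Rightarrow> plane \<Rightarrow> complex" where
  "mesh_average M q z = (\<Sum>K\<in>M. indicator K z * q K z) / (\<Sum>K\<in>M. indicator K z)"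

lemma mesh_average_eq:
  assumes "finite M" "K \<in> M" "z \<in> K" "\<And>K. K \<in> M \<Longrightarrow> z \<in> K \<Longrightarrow> q K z = d"
  shows "mesh_average M q z = d"
proof -
  have "(\<Sum>K\<in>M. indicator K z * q K z) = (\<Sum>K\<in>M. indicator K z * d)"
    by (rule sum.cong) (use assms(4) in \<open>auto simp: indicator_def\<close>)
  moreover have "(\<Sum>K\<in>M. indicator K z) = (of_nat (card {K \<in> M. z \<in> K}) :: complex)"
    using assms(1) by (simp add: indicator_def sum.If_cases Int_def)
  moreover have "card {K \<in> M. z \<in> K} \<noteq> 0" using assms(1-3) by auto
  ultimately show ?thesis by (simp add: mesh_average_def sum_distrib_right[symmetric])
qed

context fe_mesh
begin

lemma element_compact_convex:
  assumes "K \<in> mesh S"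
  shows "compact K" "convex K"
proof -
  obtain a b c where "K = convex hull {a, b, c}" using element_triangle[OF assms] by blast
  then show "compact K" "convex K" by (simp_all add: finite_imp_compact_convex_hull)
qed

lemma mesh_average_bounded_measurable:
  assumes "\<And>K. K \<in> mesh S \<Longrightarrow> continuous_on UNIV (q K)"
  shows "mesh_average (mesh S) q \<in> borel_measurable borel"
    and "\<exists>B. \<forall>z\<in>closure (Omega S). norm (mesh_average (mesh S) q z) \<le> B"
proof -
  have [measurable]: "K \<in> sets borel" "q K \<in> borel_measurable borel" if "K \<in> mesh S" for K
    using that element_compact_convex assms by (auto intro: borel_measurable_continuous_onI borel_closed compact_imp_closed)
  show "mesh_average (mesh S) q \<in> borel_measurable borel"
    unfolding mesh_average_def[abs_def] by measurable
  have "\<exists>B. \<forall>z\<in>K. norm (q K z) \<le> B" if "K \<in> mesh S" for K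
  proof -
    have "compact (q K ` K)"
      using assms[OF that] element_compact_convex[OF that]
      by (intro compact_continuous_image) (auto intro: continuous_on_subset)
    then show ?thesis using compact_imp_bounded bounded_iff by (metis imageI)
  qed
  then obtain B where B: "\<And>K z. K \<in> mesh S \<Longrightarrow> z \<in> K \<Longrightarrow> norm (q K z) \<le> B K" by metis
  have "norm (mesh_average (mesh S) q z) \<le> (\<Sum>K\<in>mesh S. \<bar>B K\<bar>)" if "z \<in> closure (Omega S)" for z
  proof -
    obtain K where K: "K \<in> mesh S" "z \<in> K" using \<open>z \<in> closure (Omega S)\<close> unfolding Union_mesh[symmetric] by blast
    have eq: "(\<Sum>K\<in>mesh S. indicator K z) = (of_nat (card {K \<in> mesh S. z \<in> K}) :: complex)"
      using finite_mesh by (simp add: indicator_def sum.If_cases Int_def)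
    have "card {K \<in> mesh S. z \<in> K} \<noteq> 0" using K finite_mesh by auto
    then have n1: "1 \<le> norm (\<Sum>K\<in>mesh S. indicator K z :: complex)" unfolding eq by simp
    have "norm (mesh_average (mesh S) q z) = norm (\<Sum>K\<in>mesh S. indicator K z * q K z) / norm (\<Sum>K\<in>mesh S. indicator K z :: complex)"
      by (simp add: mesh_average_def norm_divide)
    also have "\<dots> \<le> norm (\<Sum>K\<in>mesh S. indicator K z * q K z) / 1"
      using n1 by (intro divide_left_mono) auto
    also have "\<dots> \<le> (\<Sum>K\<in>mesh S. \<bar>B K\<bar>)"
      unfolding div_by_1
      by (rule sum_norm_le) (use B in \<open>fastforce simp: indicator_def\<close>)
    finally show ?thesis .
  qed
  then show "\<exists>B. \<forall>z\<in>closure (Omega S). norm (mesh_average (mesh S) q z) \<le> B" by blast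
qed

text \<open>Each element cuts the line in a compact interval. At all but finitely many points of the line, namely
  the end points of these intervals, the parameter is interior to the interval of every element through
  the point. So these elements all yield the same derivative of \<open>v\<close> along the line, even if the line runs
  along an edge. The fundamental theorem of calculus with finitely many exceptional points applies to
  the product of \<open>v\<close> and \<open>\<phi>\<close>, which vanishes at both ends.\<close>

lemma segment_integral_zero:
  assumes v: "v \<in> V_space S" and d: "norm d = 1" and ab: "a < b"
    and e: "\<And>s. s \<in> {a..b} \<Longrightarrow> p + s *\<^sub>R d \<in> closure (Omega S)"
    and q: "\<And>K x. K \<in> mesh S \<Longrightarrow> x \<in> K \<Longrightarrow> v x = q K x"
    and q': "\<And>K s. K \<in> mesh S \<Longrightarrow> ((\<lambda>s. q K (p + s *\<^sub>R d)) has_vector_derivative q' K (p + s *\<^sub>R d)) (at s)"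
    and \<phi>: "test_function (Omega S) \<phi> \<phi>'" and ends: "p + a *\<^sub>R d \<notin> Omega S" "p + b *\<^sub>R d \<notin> Omega S"
  shows "((\<lambda>s. v (p + s *\<^sub>R d) * of_real (\<phi>' (p + s *\<^sub>R d) \<bullet> d)
            + mesh_average (mesh S) q' (p + s *\<^sub>R d) * of_real (\<phi> (p + s *\<^sub>R d))) has_integral 0) {a..b}"
proof -
  define I where "I K = (\<lambda>s. p + s *\<^sub>R d) -` K" for K
  have I: "compact (I K)" "convex (I K)" if K: "K \<in> mesh S" for K
  proof -
    have "closed (I K)"
      unfolding I_def using element_compact_convex[OF K]
      by (intro closed_vimage compact_imp_closed continuous_intros)
    moreover have "bounded (I K)"
    proof -
      obtain B where B: "\<And>x. x \<in> K \<Longrightarrow> norm x \<le> B"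
        using element_compact_convex(1)[OF K] compact_imp_bounded bounded_iff by metis
      have "norm s \<le> B + norm p" if "s \<in> I K" for s
      proof -
        have "norm s = norm ((p + s *\<^sub>R d) - p)" using d by simp
        also have "\<dots> \<le> norm (p + s *\<^sub>R d) + norm p" by (rule norm_triangle_ineq4)
        finally show ?thesis using B[of "p + s *\<^sub>R d"] that by (simp add: I_def)
      qed
      then show ?thesis by (auto simp: bounded_iff)
    qed
    ultimately show "compact (I K)" by (simp add: compact_eq_bounded_closed)
    show "convex (I K)"
      unfolding convex_def
    proof (intro ballI allI impI)
      fix s t u w :: real assume "s \<in> I K" "t \<in> I K" "0 \<le> u" "0 \<le> w" "u + w = 1"
      then have "u *\<^sub>R (p + s *\<^sub>R d) + w *\<^sub>R (p + t *\<^sub>R d) \<in> K"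
        using element_compact_convex(2)[OF K] by (simp add: I_def convexD)
      moreover have "u *\<^sub>R (p + s *\<^sub>R d) + w *\<^sub>R (p + t *\<^sub>R d) = (u + w) *\<^sub>R p + (u *\<^sub>R s + w *\<^sub>R t) *\<^sub>R d"
        by (simp add: algebra_simps)
      ultimately show "u *\<^sub>R s + w *\<^sub>R t \<in> I K" using \<open>u + w = 1\<close> by (simp add: I_def)
    qed
  qed
  define N where "N = (\<Union>K\<in>mesh S. frontier (I K))"
  have "finite N" unfolding N_def using finite_mesh I finite_frontier_compact_convex_real by blast
  let ?f = "\<lambda>s. v (p + s *\<^sub>R d) * of_real (\<phi> (p + s *\<^sub>R d))"
  have "((\<lambda>s. v (p + s *\<^sub>R d) * of_real (\<phi>' (p + s *\<^sub>R d) \<bullet> d)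
        + mesh_average (mesh S) q' (p + s *\<^sub>R d) * of_real (\<phi> (p + s *\<^sub>R d))) has_integral (?f b - ?f a)) {a..b}"
  proof (rule fundamental_theorem_of_calculus_interior_strong[OF \<open>finite N\<close>])
    show "a \<le> b" using ab by simp
    have "continuous_on {a..b} (\<lambda>s. v (p + s *\<^sub>R d))"
      using e by (intro continuous_on_compose2[OF V_space_continuous[OF v]] continuous_intros) auto
    moreover have "continuous_on {a..b} (\<lambda>s. \<phi> (p + s *\<^sub>R d))"
      by (intro continuous_on_compose2[OF test_function_continuous(1)[OF \<phi>]] continuous_intros) auto
    ultimately show "continuous_on {a..b} ?f" by (intro continuous_intros)
    fix s assume s: "s \<in> {a<..<b} - N"
    have vd: "((\<lambda>s. v (p + s *\<^sub>R d)) has_vector_derivative q' K (p + s *\<^sub>R d)) (at s)"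
      if K: "K \<in> mesh S" "p + s *\<^sub>R d \<in> K" for K
    proof -
      have "s \<in> I K" using K(2) by (simp add: I_def)
      moreover have "s \<notin> frontier (I K)" using s K(1) by (auto simp: N_def)
      ultimately have "s \<in> interior (I K)"
        using compact_imp_closed[OF I(1)[OF K(1)]] by (simp add: frontier_def)
      then show ?thesis
      proof (rule has_vector_derivative_transform_within_open[OF q'[OF K(1)] open_interior])
        show "q K (p + t *\<^sub>R d) = v (p + t *\<^sub>R d)" if "t \<in> interior (I K)" for t
          using q[OF K(1), of "p + t *\<^sub>R d"] interior_subset[of "I K"] that by (auto simp: I_def)
      qed
    qed
    have "p + s *\<^sub>R d \<in> \<Union>(mesh S)"
      unfolding Union_mesh by (rule e) (use s in simp)
    then obtain K where K: "K \<in> mesh S" "p + s *\<^sub>R d \<in> K" by blast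
    have "mesh_average (mesh S) q' (p + s *\<^sub>R d) = q' K (p + s *\<^sub>R d)"
      by (rule mesh_average_eq[OF finite_mesh K]) (rule vector_derivative_unique_at[OF vd vd[OF K]])
    then have 1: "((\<lambda>s. v (p + s *\<^sub>R d)) has_vector_derivative mesh_average (mesh S) q' (p + s *\<^sub>R d)) (at s)"
      using vd[OF K] by simp
    have "(\<phi> has_derivative (\<lambda>h. h \<bullet> \<phi>' (p + s *\<^sub>R d))) (at (p + s *\<^sub>R d))"
      using \<phi> unfolding test_function_def gderiv_def by blast
    moreover have "((\<lambda>s. p + s *\<^sub>R d) has_derivative (\<lambda>h. h *\<^sub>R d)) (at s)"
      by (auto intro!: derivative_eq_intros)
    ultimately have "((\<lambda>s. \<phi> (p + s *\<^sub>R d)) has_derivative (\<lambda>h. (h *\<^sub>R d) \<bullet> \<phi>' (p + s *\<^sub>R d))) (at s)"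
      by (rule has_derivative_compose[rotated])
    then have "((\<lambda>s. \<phi> (p + s *\<^sub>R d)) has_field_derivative (\<phi>' (p + s *\<^sub>R d) \<bullet> d)) (at s)"
      unfolding has_field_derivative_def by (rule has_derivative_eq_rhs) (simp add: fun_eq_iff inner_commute)
    then have 2: "((\<lambda>s. complex_of_real (\<phi> (p + s *\<^sub>R d))) has_vector_derivative of_real (\<phi>' (p + s *\<^sub>R d) \<bullet> d)) (at s)"
      by (rule has_vector_derivative_of_real)
    show "(?f has_vector_derivative v (p + s *\<^sub>R d) * of_real (\<phi>' (p + s *\<^sub>R d) \<bullet> d)
        + mesh_average (mesh S) q' (p + s *\<^sub>R d) * of_real (\<phi> (p + s *\<^sub>R d))) (at s)"
      by (rule has_vector_derivative_mult[OF 1 2])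
  qed
  moreover have "?f b = 0" "?f a = 0"
    using test_function_outside(1)[OF \<phi>] ends by simp_all
  ultimately show ?thesis by simp
qed

lemma Omega_eq: "Omega S = {x_lo S<..<x_hi S} \<times> {y_lo S<..<y_hi S}"
  by (simp add: Omega_def box_plane)

lemma closure_Omega: "closure (Omega S) = {x_lo S..x_hi S} \<times> {y_lo S..y_hi S}"
  using x_lo_less y_lo_less by (simp add: Omega_eq closure_Times closure_greaterThanLessThan)

lemma Omega_finite: "emeasure lborel (Omega S) < \<infinity>" "bounded (Omega S)" "Omega S \<in> sets borel"
proof -
  show "bounded (Omega S)" "Omega S \<in> sets borel" by (auto simp: Omega_def)
  then show "emeasure lborel (Omega S) < \<infinity>" by (intro emeasure_bounded_finite)
qed

lemma L2_on_Omega_bounded: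
  assumes "v \<in> borel_measurable borel" "\<And>z. z \<in> closure (Omega S) \<Longrightarrow> norm (v z) \<le> B"
  shows "v \<in> L2_on (Omega S)"
proof (rule L2_on_bounded[OF _ _ Omega_finite(1,3)])
  show "set_borel_measurable lborel (Omega S) v"
    unfolding set_borel_measurable_def using assms(1) Omega_finite(3) by measurable
  show "norm (v x) \<le> B" if "x \<in> Omega S" for x
    using assms(2) that closure_subset by blast
qed

lemma mesh_average_L2:
  assumes "\<And>K. K \<in> mesh S \<Longrightarrow> continuous_on UNIV (q K)"
  shows "mesh_average (mesh S) q \<in> L2_on (Omega S)"
proof -
  obtain B where "\<And>z. z \<in> closure (Omega S) \<Longrightarrow> norm (mesh_average (mesh S) q z) \<le> B"
    using mesh_average_bounded_measurable(2)[of q] assms by blast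
  then show ?thesis
    by (intro L2_on_Omega_bounded mesh_average_bounded_measurable(1) assms)
qed

lemma V_space_L2:
  assumes "v \<in> V_space S"
  shows "v \<in> L2_on (Omega S)"
proof -
  have cont: "continuous_on (Omega S) v"
    using V_space_continuous[OF assms] closure_subset by (rule continuous_on_subset)
  have "compact (v ` closure (Omega S))"
    using Omega_finite(2) by (intro compact_continuous_image V_space_continuous assms) (simp add: compact_closure)
  then obtain B where B: "\<And>z. z \<in> closure (Omega S) \<Longrightarrow> norm (v z) \<le> B"
    by (metis bounded_iff compact_imp_bounded imageI)
  show ?thesis
  proof (rule L2_on_bounded[OF _ _ Omega_finite(1,3)])
    show "set_borel_measurable lborel (Omega S) v"
      unfolding set_borel_measurable_def
      using borel_measurable_continuous_on_indicator[OF Omega_finite(3) cont] by simp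
    show "norm (v x) \<le> B" if "x \<in> Omega S" for x
      using B that closure_subset by blast
  qed
qed

text \<open>Fubini reduces the identity that defines weak gradients to \<open>segment_integral_zero\<close> on horizontal and
  vertical segments.\<close>

lemma V_space_weak_gradient:
  assumes v: "v \<in> V_space S"
  shows "\<exists>g. weak_gradient (Omega S) v g"
proof -
  have "\<forall>K\<in>mesh S. \<exists>q. q \<in> polys2 (deg S) \<and> (\<forall>x\<in>K. v x = q x)"
    using v unfolding V_space_def by blast
  from bchoice[OF this] obtain q where q': "\<forall>K\<in>mesh S. q K \<in> polys2 (deg S) \<and> (\<forall>x\<in>K. v x = q K x)" ..
  have q: "q K \<in> polys2 (deg S)" "x \<in> K \<Longrightarrow> v x = q K x" if "K \<in> mesh S" for K x
    using q' that by auto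
  have "\<forall>K\<in>mesh S. \<exists>q'. continuous_on UNIV q' \<and> (\<forall>x y. ((\<lambda>s. q K (s, y)) has_vector_derivative q' (x, y)) (at x))"
    by (intro ballI polys2_partial_fst[OF q(1)])
  from bchoice[OF this] obtain qx where qx': "\<forall>K\<in>mesh S. continuous_on UNIV (qx K) \<and> (\<forall>x y. ((\<lambda>s. q K (s, y)) has_vector_derivative qx K (x, y)) (at x))" ..
  have qx: "continuous_on UNIV (qx K)" "((\<lambda>s. q K (s, y)) has_vector_derivative qx K (x, y)) (at x)" if "K \<in> mesh S" for K x y
    using qx' that by auto
  have "\<forall>K\<in>mesh S. \<exists>q'. continuous_on UNIV q' \<and> (\<forall>x y. ((\<lambda>s. q K (x, s)) has_vector_derivative q' (x, y)) (at y))"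
    by (intro ballI polys2_partial_snd[OF q(1)])
  from bchoice[OF this] obtain qy where qy': "\<forall>K\<in>mesh S. continuous_on UNIV (qy K) \<and> (\<forall>x y. ((\<lambda>s. q K (x, s)) has_vector_derivative qy K (x, y)) (at y))" ..
  have qy: "continuous_on UNIV (qy K)" "((\<lambda>s. q K (x, s)) has_vector_derivative qy K (x, y)) (at y)" if "K \<in> mesh S" for K x y
    using qy' that by auto
  define gx where "gx = mesh_average (mesh S) qx"
  define gy where "gy = mesh_average (mesh S) qy"
  have L2: "gx \<in> L2_on (Omega S)" "gy \<in> L2_on (Omega S)"
    unfolding gx_def gy_def using qx(1) qy(1) by (simp_all add: mesh_average_L2)
  note int_test = set_integrable_times_test[OF _ Omega_finite(2,3)]
  note vL2 = V_space_L2[OF v]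
  \<comment> \<open>If \<open>G\<close> is not Lebesgue integrable, then its integral is zero by convention.\<close>
  have line0: "(LINT s|lborel. indicat_real {a<..<b} s *\<^sub>R G s) = 0" if "(G has_integral 0) {a..b}" for G :: "real \<Rightarrow> complex" and a b
  proof (cases "set_integrable lborel {a<..<b} G")
    case True
    have "(G has_integral 0) {a<..<b}"
      using that has_integral_Icc_iff_Ioo by blast
    then show ?thesis
      using set_borel_integral_eq_integral(2)[OF True] by (simp add: set_lebesgue_integral_def integral_unique)
  next
    case False
    then show ?thesis by (simp add: set_integrable_def not_integrable_integral_eq)
  qed
  have "weak_gradient (Omega S) v (\<lambda>z. (gx z, gy z))"
    unfolding weak_gradient_def
  proof (intro conjI allI impI)
    fix \<phi> \<phi>' assume t: "test_function (Omega S) \<phi> \<phi>'"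
    note c = test_function_continuous[OF t]
    have ix: "integrable lborel (\<lambda>z. indicat_real (Omega S) z *\<^sub>R (v z * of_real (fst (\<phi>' z)) + gx z * of_real (\<phi> z)))"
      unfolding set_integrable_def[symmetric] by (intro set_integral_add int_test vL2 L2 c)
    have "(LINT x|lborel. indicat_real (Omega S) (x, y) *\<^sub>R (v (x, y) * of_real (fst (\<phi>' (x, y))) + gx (x, y) * of_real (\<phi> (x, y)))) = 0" for y
    proof (cases "y \<in> {y_lo S<..<y_hi S}")
      case True
      have "((\<lambda>s. v ((0, y) + s *\<^sub>R (1, 0)) * of_real (\<phi>' ((0, y) + s *\<^sub>R (1, 0)) \<bullet> (1, 0))
            + mesh_average (mesh S) qx ((0, y) + s *\<^sub>R (1, 0)) * of_real (\<phi> ((0, y) + s *\<^sub>R (1, 0)))) has_integral 0) {x_lo S..x_hi S}"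
        by (rule segment_integral_zero[OF v _ x_lo_less _ q(2) _ t])
           (use True qx(2) in \<open>auto simp: Omega_eq closure_Times closure_greaterThanLessThan x_lo_less y_lo_less norm_Pair\<close>)
      then have "((\<lambda>x. v (x, y) * of_real (fst (\<phi>' (x, y))) + gx (x, y) * of_real (\<phi> (x, y))) has_integral 0) {x_lo S..x_hi S}"
        by (simp add: inner_prod_def gx_def)
      from line0[OF this] show ?thesis using True by (simp add: Omega_eq indicator_times)
    qed (simp add: Omega_eq indicator_times)
    then have "(LINT z|lborel. indicat_real (Omega S) z *\<^sub>R (v z * of_real (fst (\<phi>' z)) + gx z * of_real (\<phi> z))) = 0"
      using lborel_pair.integral_snd[of "\<lambda>x y. indicat_real (Omega S) (x, y) *\<^sub>R (v (x, y) * of_real (fst (\<phi>' (x, y))) + gx (x, y) * of_real (\<phi> (x, y)))"] ix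
      by (simp add: lborel_prod case_prod_beta')
    moreover have "(LINT z:Omega S|lborel. v z * of_real (fst (\<phi>' z)) + gx z * of_real (\<phi> z)) =
        (LINT z:Omega S|lborel. v z * of_real (fst (\<phi>' z))) + (LINT z:Omega S|lborel. gx z * of_real (\<phi> z))"
      by (intro set_integral_add int_test vL2 L2 c)
    ultimately show "(LINT z:Omega S|lborel. v z * of_real (fst (\<phi>' z))) = - (LINT z:Omega S|lborel. fst (gx z, gy z) * of_real (\<phi> z))"
      by (simp add: set_lebesgue_integral_def eq_neg_iff_add_eq_0)
    have iy: "integrable lborel (\<lambda>z. indicat_real (Omega S) z *\<^sub>R (v z * of_real (snd (\<phi>' z)) + gy z * of_real (\<phi> z)))"
      unfolding set_integrable_def[symmetric] by (intro set_integral_add int_test vL2 L2 c)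
    have "(LINT y|lborel. indicat_real (Omega S) (x, y) *\<^sub>R (v (x, y) * of_real (snd (\<phi>' (x, y))) + gy (x, y) * of_real (\<phi> (x, y)))) = 0" for x
    proof (cases "x \<in> {x_lo S<..<x_hi S}")
      case True
      have "((\<lambda>s. v ((x, 0) + s *\<^sub>R (0, 1)) * of_real (\<phi>' ((x, 0) + s *\<^sub>R (0, 1)) \<bullet> (0, 1))
            + mesh_average (mesh S) qy ((x, 0) + s *\<^sub>R (0, 1)) * of_real (\<phi> ((x, 0) + s *\<^sub>R (0, 1)))) has_integral 0) {y_lo S..y_hi S}"
        by (rule segment_integral_zero[OF v _ y_lo_less _ q(2) _ t])
           (use True qy(2) in \<open>auto simp: Omega_eq closure_Times closure_greaterThanLessThan x_lo_less y_lo_less norm_Pair\<close>)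
      then have "((\<lambda>y. v (x, y) * of_real (snd (\<phi>' (x, y))) + gy (x, y) * of_real (\<phi> (x, y))) has_integral 0) {y_lo S..y_hi S}"
        by (simp add: inner_prod_def gy_def)
      from line0[OF this] show ?thesis using True by (simp add: Omega_eq indicator_times)
    qed (simp add: Omega_eq indicator_times)
    then have "(LINT z|lborel. indicat_real (Omega S) z *\<^sub>R (v z * of_real (snd (\<phi>' z)) + gy z * of_real (\<phi> z))) = 0"
      using lborel_pair.integral_fst[of "\<lambda>x y. indicat_real (Omega S) (x, y) *\<^sub>R (v (x, y) * of_real (snd (\<phi>' (x, y))) + gy (x, y) * of_real (\<phi> (x, y)))"] iy
      by (simp add: lborel_prod case_prod_beta')
    moreover have "(LINT z:Omega S|lborel. v z * of_real (snd (\<phi>' z)) + gy z * of_real (\<phi> z)) =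
        (LINT z:Omega S|lborel. v z * of_real (snd (\<phi>' z))) + (LINT z:Omega S|lborel. gy z * of_real (\<phi> z))"
      by (intro set_integral_add int_test vL2 L2 c)
    ultimately show "(LINT z:Omega S|lborel. v z * of_real (snd (\<phi>' z))) = - (LINT z:Omega S|lborel. snd (gx z, gy z) * of_real (\<phi> z))"
      by (simp add: set_lebesgue_integral_def eq_neg_iff_add_eq_0)
  qed (simp_all add: vL2 L2)
  then show ?thesis by blast
qed

lemma V_space_H1: "v \<in> V_space S \<Longrightarrow> v \<in> H1 (Omega S)"
  using V_space_weak_gradient by (simp add: H1_def)

end

section \<open>The sesquilinear form on vertical bands\<close>

lemma arc_integral_cong:
  assumes "\<And>z. z \<in> \<Gamma> \<Longrightarrow> f z = g z"
  shows "arc_integral \<Gamma> f = arc_integral \<Gamma> g"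
proof -
  have "(LINT y:{y. (x, y) \<in> \<Gamma>}|lborel. f (x, y)) = (LINT y:{y. (x, y) \<in> \<Gamma>}|lborel. g (x, y))" for x
    unfolding set_lebesgue_integral_def
    by (rule Bochner_Integration.integral_cong) (auto simp: indicator_def assms)
  moreover have "(LINT x:{x. (x, y) \<in> \<Gamma>}|lborel. f (x, y)) = (LINT x:{x. (x, y) \<in> \<Gamma>}|lborel. g (x, y))" for y
    unfolding set_lebesgue_integral_def
    by (rule Bochner_Integration.integral_cong) (auto simp: indicator_def assms)
  ultimately show ?thesis by (simp add: arc_integral_def)
qed

lemma inner_on_cong:
  assumes "\<And>z. z \<in> \<Gamma> \<Longrightarrow> u z = u' z" "\<And>z. z \<in> \<Gamma> \<Longrightarrow> v z = v' z"
  shows "inner_on \<Gamma> u v = inner_on \<Gamma> u' v'"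
  unfolding inner_on_def by (rule arc_integral_cong) (simp add: assms)

text \<open>The closure is needed for the boundary term; the gradients depend on the values in \<open>D\<close> only.\<close>

lemma helmholtz_form_cong:
  assumes "open D" "\<And>z. z \<in> closure D \<Longrightarrow> u z = u' z" "\<And>z. z \<in> closure D \<Longrightarrow> v z = v' z"
  shows "helmholtz_form k D u v = helmholtz_form k D u' v'"
proof -
  have D: "u z = u' z" "v z = v' z" if "z \<in> D" for z
    using assms(2,3) closure_subset that by blast+
  have "grad D u = grad D u'" "grad D v = grad D v'"
    by (intro grad_cong D; assumption)+
  moreover have "inner_on (frontier D) u v = inner_on (frontier D) u' v'"
    by (rule inner_on_cong) (use assms in \<open>auto simp: frontier_def\<close>)
  moreover have "(LINT x:D|lborel. p x - c * u x * cnj (v x)) = (LINT x:D|lborel. p x - c * u' x * cnj (v' x))" for p c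
    unfolding set_lebesgue_integral_def
    by (rule Bochner_Integration.integral_cong) (auto simp: indicator_def D)
  ultimately show ?thesis by (simp add: helmholtz_form_def)
qed

definition energy_density :: "real \<Rightarrow> plane set \<Rightarrow> (plane \<Rightarrow> complex) \<Rightarrow> (plane \<Rightarrow> complex) \<Rightarrow> plane \<Rightarrow> complex" where
  "energy_density k D v w x = fst (grad D v x) * cnj (fst (grad D w x)) + snd (grad D v x) * cnj (snd (grad D w x))
        - of_real (k\<^sup>2) * v x * cnj (w x)"

lemma helmholtz_form_energy:
  "helmholtz_form k D v w = (LINT x:D|lborel. energy_density k D v w x) - \<i> * of_real k * inner_on (frontier D) v w"
  by (simp only: helmholtz_form_def energy_density_def)

lemma energy_density_integrable:
  assumes "v \<in> H1 D" "w \<in> H1 D"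
  shows "set_integrable lborel D (energy_density k D v w)"
proof -
  note g = weak_gradient_grad[OF assms(1)] weak_gradient_grad[OF assms(2)]
  have "set_integrable lborel D (\<lambda>x. (fst (grad D v x) * cnj (fst (grad D w x)) + snd (grad D v x) * cnj (snd (grad D w x)))
        - of_real (k\<^sup>2) * (v x * cnj (w x)))"
    using g unfolding weak_gradient_def
    by (intro set_integral_diff set_integral_add set_integrable_mult_right L2_on_mult_cnj_integrable) auto
  then show ?thesis by (simp add: energy_density_def[abs_def] mult.assoc)
qed

lemma energy_integral_add_scaled:
  assumes "u \<in> H1 (box a b)" "v \<in> H1 (box a b)" "w \<in> H1 (box a b)"
  shows "(LINT x:box a b|lborel. energy_density k (box a b) u (\<lambda>x. v x + c * w x) x) =
    (LINT x:box a b|lborel. energy_density k (box a b) u v x) + cnj c * (LINT x:box a b|lborel. energy_density k (box a b) u w x)"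
proof -
  let ?D = "box a b"
  have D: "bounded ?D" "?D \<in> sets borel" by auto
  have wg: "weak_gradient ?D (\<lambda>x. v x + c * w x) (\<lambda>x. (fst (grad ?D v x) + c * fst (grad ?D w x), snd (grad ?D v x) + c * snd (grad ?D w x)))"
    by (intro weak_gradient_add_scaled weak_gradient_grad assms D)
  then have "(\<lambda>x. v x + c * w x) \<in> H1 ?D" by (auto simp: H1_def)
  note i = energy_density_integrable[OF assms(1) this, of k] energy_density_integrable[OF assms(1,2), of k] energy_density_integrable[OF assms(1,3), of k]
  have "(LINT x:?D|lborel. energy_density k ?D u (\<lambda>x. v x + c * w x) x) =
      (LINT x:?D|lborel. energy_density k ?D u v x + cnj c * energy_density k ?D u w x)"
    unfolding set_lebesgue_integral_def
  proof (rule integral_cong_AE)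
    show "(\<lambda>x. indicat_real ?D x *\<^sub>R energy_density k ?D u (\<lambda>x. v x + c * w x) x) \<in> borel_measurable lborel"
      using i(1) by (auto simp: set_integrable_def)
    have "set_integrable lborel ?D (\<lambda>x. energy_density k ?D u v x + cnj c * energy_density k ?D u w x)"
      using i by (intro set_integral_add set_integrable_mult_right) auto
    then show "(\<lambda>x. indicat_real ?D x *\<^sub>R (energy_density k ?D u v x + cnj c * energy_density k ?D u w x)) \<in> borel_measurable lborel"
      by (auto simp: set_integrable_def)
    show "AE x in lborel. indicat_real ?D x *\<^sub>R energy_density k ?D u (\<lambda>x. v x + c * w x) x
        = indicat_real ?D x *\<^sub>R (energy_density k ?D u v x + cnj c * energy_density k ?D u w x)"
      using grad_eq_weak_gradient[OF wg]
      by eventually_elim (simp add: indicator_def energy_density_def algebra_simps)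
  qed
  also have "\<dots> = (LINT x:?D|lborel. energy_density k ?D u v x) + cnj c * (LINT x:?D|lborel. energy_density k ?D u w x)"
    using i by (simp add: set_integral_add)
  finally show ?thesis .
qed

definition side_integral :: "strip_setting \<Rightarrow> real \<Rightarrow> (plane \<Rightarrow> complex) \<Rightarrow> (plane \<Rightarrow> complex) \<Rightarrow> complex" where
  "side_integral S c u v = (LINT y:{y_lo S..y_hi S}|lborel. u (c, y) * cnj (v (c, y)))"

definition base_integral :: "real \<Rightarrow> real \<Rightarrow> real \<Rightarrow> (plane \<Rightarrow> complex) \<Rightarrow> (plane \<Rightarrow> complex) \<Rightarrow> complex" where
  "base_integral \<alpha> \<beta> d u v = (LINT x:{\<alpha>..\<beta>}|lborel. u (x, d) * cnj (v (x, d)))"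

definition band :: "strip_setting \<Rightarrow> real \<Rightarrow> real \<Rightarrow> plane set" where
  "band S \<alpha> \<beta> = box (\<alpha>, y_lo S) (\<beta>, y_hi S)"

text \<open>The form on a band without the integrals over its two vertical sides. When a band is cut by a vertical
  line, this part is additive, whereas the sum of the two forms contains the integral over the cut twice.\<close>

definition bulk :: "strip_setting \<Rightarrow> real \<Rightarrow> real \<Rightarrow> (plane \<Rightarrow> complex) \<Rightarrow> (plane \<Rightarrow> complex) \<Rightarrow> complex" where
  "bulk S \<alpha> \<beta> u v = (LINT x:band S \<alpha> \<beta>|lborel. energy_density (wavenumber S) (Omega S) u v x)
     - \<i> * of_real (wavenumber S) * (base_integral \<alpha> \<beta> (y_lo S) u v + base_integral \<alpha> \<beta> (y_hi S) u v)"

lemma emeasure_countable_lborel: "finite (X :: real set) \<Longrightarrow> emeasure lborel X = 0"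
  by (simp add: emeasure_lborel_countable countable_finite)

context fe_mesh
begin

lemma band_eq: "band S \<alpha> \<beta> = {\<alpha><..<\<beta>} \<times> {y_lo S<..<y_hi S}"
  by (simp add: band_def box_plane)

lemma closure_band: "\<alpha> < \<beta> \<Longrightarrow> closure (band S \<alpha> \<beta>) = {\<alpha>..\<beta>} \<times> {y_lo S..y_hi S}"
  using y_lo_less by (simp add: band_eq closure_Times closure_greaterThanLessThan)

lemma frontier_band:
  assumes "\<alpha> < \<beta>"
  shows "frontier (band S \<alpha> \<beta>) = {\<alpha>..\<beta>} \<times> {y_lo S..y_hi S} - {\<alpha><..<\<beta>} \<times> {y_lo S<..<y_hi S}"
proof -
  have "interior (band S \<alpha> \<beta>) = band S \<alpha> \<beta>" by (intro interior_open) (simp add: band_def open_box)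
  then show ?thesis by (simp add: frontier_def closure_band[OF assms]) (simp add: band_eq)
qed

lemma inner_on_sides:
  assumes "finite X"
  shows "inner_on (X \<times> {y_lo S..y_hi S}) u v = (\<Sum>x\<in>X. side_integral S x u v)"
proof -
  let ?\<Gamma> = "X \<times> {y_lo S..y_hi S}"
  have sec: "{y. (x, y) \<in> ?\<Gamma>} = (if x \<in> X then {y_lo S..y_hi S} else {})" for x by auto
  have "{x. emeasure lborel {y. (x, y) \<in> ?\<Gamma>} \<noteq> 0} = X"
    unfolding sec using y_lo_less by auto
  moreover have "emeasure lborel {x. (x, y) \<in> ?\<Gamma>} = 0" for y
    by (rule emeasure_countable_lborel) (rule finite_subset[OF _ assms], auto)
  ultimately show ?thesis
    unfolding inner_on_def arc_integral_def sec by (simp add: side_integral_def)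
qed

text \<open>All sections of the boundary other than the four sides consist of at most two points.\<close>

lemma inner_on_frontier_band:
  assumes "\<alpha> < \<beta>"
  shows "inner_on (frontier (band S \<alpha> \<beta>)) u v = side_integral S \<alpha> u v + side_integral S \<beta> u v
     + (base_integral \<alpha> \<beta> (y_lo S) u v + base_integral \<alpha> \<beta> (y_hi S) u v)"
proof -
  let ?\<Gamma> = "frontier (band S \<alpha> \<beta>)"
  have v: "{y. (x, y) \<in> ?\<Gamma>} = (if x = \<alpha> \<or> x = \<beta> then {y_lo S..y_hi S} else if \<alpha> < x \<and> x < \<beta> then {y_lo S, y_hi S} else {})" for x
    using y_lo_less assms by (auto simp: frontier_band[OF assms])
  have h: "{x. (x, y) \<in> ?\<Gamma>} = (if y = y_lo S \<or> y = y_hi S then {\<alpha>..\<beta>} else if y_lo S < y \<and> y < y_hi S then {\<alpha>, \<beta>} else {})" for y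
    using y_lo_less assms by (auto simp: frontier_band[OF assms])
  have "{x. emeasure lborel {y. (x, y) \<in> ?\<Gamma>} \<noteq> 0} = {\<alpha>, \<beta>}"
    unfolding v using y_lo_less emeasure_countable_lborel[of "{y_lo S, y_hi S}"] by (auto split: if_splits)
  moreover have "{y. emeasure lborel {x. (x, y) \<in> ?\<Gamma>} \<noteq> 0} = {y_lo S, y_hi S}"
    unfolding h using assms emeasure_countable_lborel[of "{\<alpha>, \<beta>}"] by (auto split: if_splits)
  ultimately show ?thesis
    using assms y_lo_less unfolding inner_on_def arc_integral_def v h
    by (simp add: side_integral_def base_integral_def)
qed

lemma band_subset_Omega: "x_lo S \<le> \<alpha> \<Longrightarrow> \<beta> \<le> x_hi S \<Longrightarrow> band S \<alpha> \<beta> \<subseteq> Omega S"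
  by (auto simp: band_eq Omega_eq)

lemma weak_gradient_band:
  assumes "x_lo S \<le> \<alpha>" "\<beta> \<le> x_hi S" "v \<in> V_space S"
  shows "weak_gradient (band S \<alpha> \<beta>) v (grad (Omega S) v)"
  by (rule weak_gradient_mono[OF weak_gradient_grad[OF V_space_H1[OF assms(3)]] band_subset_Omega[OF assms(1,2)]])
     (auto simp: band_def Omega_finite)

lemma V_space_H1_band:
  assumes "x_lo S \<le> \<alpha>" "\<beta> \<le> x_hi S" "v \<in> V_space S"
  shows "v \<in> H1 (band S \<alpha> \<beta>)"
  using weak_gradient_band[OF assms] by (auto simp: H1_def)

lemma energy_density_Omega_integrable:
  assumes "u \<in> V_space S" "v \<in> V_space S" "A \<in> sets borel" "A \<subseteq> Omega S"
  shows "set_integrable lborel A (energy_density k (Omega S) u v)"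
  by (rule set_integrable_subset[OF energy_density_integrable]) (use assms V_space_H1 in auto)

lemma form_band:
  assumes "x_lo S \<le> \<alpha>" "\<alpha> < \<beta>" "\<beta> \<le> x_hi S" "u \<in> V_space S" "v \<in> V_space S"
  shows "form S (band S \<alpha> \<beta>) u v = bulk S \<alpha> \<beta> u v
     - \<i> * of_real (wavenumber S) * (side_integral S \<alpha> u v + side_integral S \<beta> u v)"
proof -
  let ?D = "band S \<alpha> \<beta>" and ?k = "wavenumber S"
  note H1 = V_space_H1_band[OF assms(1,3,4)] V_space_H1_band[OF assms(1,3,5)]
  have "(LINT x:?D|lborel. energy_density ?k ?D u v x) = (LINT x:?D|lborel. energy_density ?k (Omega S) u v x)"
    unfolding set_lebesgue_integral_def
  proof (rule integral_cong_AE)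
    show "(\<lambda>x. indicat_real ?D x *\<^sub>R energy_density ?k ?D u v x) \<in> borel_measurable lborel"
      using energy_density_integrable[OF H1] by (auto simp: set_integrable_def)
    have "set_integrable lborel ?D (energy_density ?k (Omega S) u v)"
      using band_subset_Omega[OF assms(1,3)] by (intro energy_density_Omega_integrable assms) (simp_all add: band_def)
    then show "(\<lambda>x. indicat_real ?D x *\<^sub>R energy_density ?k (Omega S) u v x) \<in> borel_measurable lborel"
      by (auto simp: set_integrable_def)
    have "AE x in lborel. x \<in> ?D \<longrightarrow> grad ?D w x = grad (Omega S) w x" if "w \<in> V_space S" for w
      using grad_eq_weak_gradient[OF weak_gradient_band[OF assms(1,3) that, unfolded band_def]] by (simp add: band_def)
    from this[OF assms(4)] this[OF assms(5)]
    show "AE x in lborel. indicat_real ?D x *\<^sub>R energy_density ?k ?D u v x = indicat_real ?D x *\<^sub>R energy_density ?k (Omega S) u v x"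
      by eventually_elim (auto simp: indicator_def energy_density_def)
  qed
  then show ?thesis
    using inner_on_frontier_band[OF assms(2), of u v]
    by (simp add: helmholtz_form_energy bulk_def algebra_simps)
qed

lemma V_space_side_continuous:
  assumes "v \<in> V_space S" "x_lo S \<le> c" "c \<le> x_hi S"
  shows "continuous_on {y_lo S..y_hi S} (\<lambda>y. v (c, y))"
  by (rule continuous_on_compose2[OF V_space_continuous[OF assms(1)]])
     (use assms in \<open>auto simp: closure_Omega intro!: continuous_intros\<close>)

lemma V_space_base_continuous:
  assumes "v \<in> V_space S" "x_lo S \<le> \<alpha>" "\<beta> \<le> x_hi S" "y_lo S \<le> d" "d \<le> y_hi S"
  shows "continuous_on {\<alpha>..\<beta>} (\<lambda>x. v (x, d))"
  by (rule continuous_on_compose2[OF V_space_continuous[OF assms(1)]])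
     (use assms in \<open>auto simp: closure_Omega intro!: continuous_intros\<close>)

lemma side_integral_add_scaled:
  assumes "u \<in> V_space S" "v \<in> V_space S" "w \<in> V_space S" "x_lo S \<le> c" "c \<le> x_hi S"
  shows "side_integral S c u (\<lambda>x. v x + a * w x) = side_integral S c u v + cnj a * side_integral S c u w"
    and "side_integral S c (\<lambda>x. v x + a * w x) u = side_integral S c v u + a * side_integral S c w u"
proof -
  have i: "set_integrable lborel {y_lo S..y_hi S} (\<lambda>y. p (c, y) * cnj (q (c, y)))"
    if "p \<in> V_space S" "q \<in> V_space S" for p q
    by (intro borel_integrable_atLeastAtMost' continuous_intros V_space_side_continuous that assms)
  show "side_integral S c u (\<lambda>x. v x + a * w x) = side_integral S c u v + cnj a * side_integral S c u w"
    using set_integral_add(2)[OF i[OF assms(1,2)] set_integrable_mult_right[OF i[OF assms(1,3)], of "cnj a"]]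
    by (simp add: side_integral_def algebra_simps)
  show "side_integral S c (\<lambda>x. v x + a * w x) u = side_integral S c v u + a * side_integral S c w u"
    using set_integral_add(2)[OF i[OF assms(2,1)] set_integrable_mult_right[OF i[OF assms(3,1)], of a]]
    by (simp add: side_integral_def algebra_simps)
qed

lemma base_integral_add_scaled:
  assumes "u \<in> V_space S" "v \<in> V_space S" "w \<in> V_space S" "x_lo S \<le> \<alpha>" "\<beta> \<le> x_hi S" "y_lo S \<le> d" "d \<le> y_hi S"
  shows "base_integral \<alpha> \<beta> d u (\<lambda>x. v x + a * w x) = base_integral \<alpha> \<beta> d u v + cnj a * base_integral \<alpha> \<beta> d u w"
proof -
  have i: "set_integrable lborel {\<alpha>..\<beta>} (\<lambda>x. p (x, d) * cnj (q (x, d)))"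
    if "p \<in> V_space S" "q \<in> V_space S" for p q
    by (intro borel_integrable_atLeastAtMost' continuous_intros V_space_base_continuous that assms)
  show ?thesis
    using set_integral_add(2)[OF i[OF assms(1,2)] set_integrable_mult_right[OF i[OF assms(1,3)], of "cnj a"]]
    by (simp add: base_integral_def algebra_simps)
qed

lemma form_band_add_scaled:
  assumes "x_lo S \<le> \<alpha>" "\<alpha> < \<beta>" "\<beta> \<le> x_hi S" "u \<in> V_space S" "v \<in> V_space S" "w \<in> V_space S"
  shows "form S (band S \<alpha> \<beta>) u (\<lambda>x. v x + c * w x) = form S (band S \<alpha> \<beta>) u v + cnj c * form S (band S \<alpha> \<beta>) u w"
proof -
  have b: "x_lo S \<le> \<alpha>" "\<alpha> \<le> x_hi S" "x_lo S \<le> \<beta>" "\<beta> \<le> x_hi S" using assms by auto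
  have y: "y_lo S \<le> y_hi S" using y_lo_less by simp
  note H1 = V_space_H1_band[OF assms(1,3), unfolded band_def]
  show ?thesis
    using energy_integral_add_scaled[OF H1[OF assms(4)] H1[OF assms(5)] H1[OF assms(6)], of "wavenumber S" c]
    unfolding helmholtz_form_energy inner_on_frontier_band[OF assms(2)]
    using side_integral_add_scaled(1)[OF assms(4-6) b(1,2)] side_integral_add_scaled(1)[OF assms(4-6) b(3,4)]
      base_integral_add_scaled[OF assms(4-6) b(1,4) order_refl y] base_integral_add_scaled[OF assms(4-6) b(1,4) y order_refl]
    by (simp add: algebra_simps flip: band_def)
qed

lemma AE_not_on_vertical_line: "AE z in lborel. fst (z :: plane) \<noteq> c"
proof -
  have "emeasure (lborel \<Otimes>\<^sub>M lborel) ({c} \<times> (UNIV :: real set)) = emeasure lborel {c} * emeasure lborel (UNIV :: real set)"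
    by (rule lborel.emeasure_pair_measure_Times) auto
  then have "{c} \<times> UNIV \<in> null_sets (lborel :: plane measure)"
    by (simp add: null_sets_def lborel_prod borel_prod[symmetric])
  then have "AE z in lborel. z \<notin> {c} \<times> (UNIV :: real set)" by (rule AE_not_in)
  then show ?thesis by eventually_elim (auto simp: mem_Times_iff)
qed

text \<open>The cut itself is a null set, and the densities refer to the gradient on the whole domain, so nothing
  depends on the band.\<close>

lemma bulk_split:
  assumes "x_lo S \<le> \<alpha>" "\<alpha> \<le> \<beta>" "\<beta> \<le> \<gamma>" "\<gamma> \<le> x_hi S" "u \<in> V_space S" "v \<in> V_space S"
  shows "bulk S \<alpha> \<gamma> u v = bulk S \<alpha> \<beta> u v + bulk S \<beta> \<gamma> u v"
proof -
  let ?e = "energy_density (wavenumber S) (Omega S) u v"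
  have i: "set_integrable lborel (band S s t) ?e" if "x_lo S \<le> s" "t \<le> x_hi S" for s t
    using band_subset_Omega[OF that] by (intro energy_density_Omega_integrable assms) (simp_all add: band_def)
  have i3: "set_integrable lborel (band S \<alpha> \<gamma>) ?e" "set_integrable lborel (band S \<alpha> \<beta>) ?e" "set_integrable lborel (band S \<beta> \<gamma>) ?e"
    using assms by (auto intro!: i)
  have "(LINT x:band S \<alpha> \<gamma>|lborel. ?e x) =
      (LINT x|lborel. indicator (band S \<alpha> \<beta>) x *\<^sub>R ?e x + indicator (band S \<beta> \<gamma>) x *\<^sub>R ?e x)"
    unfolding set_lebesgue_integral_def
  proof (rule integral_cong_AE)
    show "AE x in lborel. indicat_real (band S \<alpha> \<gamma>) x *\<^sub>R ?e x =
        indicat_real (band S \<alpha> \<beta>) x *\<^sub>R ?e x + indicat_real (band S \<beta> \<gamma>) x *\<^sub>R ?e x"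
      using AE_not_on_vertical_line[of \<beta>]
      by eventually_elim (use assms in \<open>auto simp: indicator_def band_eq\<close>)
  qed (use i3 in \<open>auto simp: set_integrable_def\<close>)
  also have "\<dots> = (LINT x:band S \<alpha> \<beta>|lborel. ?e x) + (LINT x:band S \<beta> \<gamma>|lborel. ?e x)"
    using i3 unfolding set_integrable_def set_lebesgue_integral_def by (intro Bochner_Integration.integral_add)
  finally have 1: "(LINT x:band S \<alpha> \<gamma>|lborel. ?e x) = \<dots>" .
  have 2: "base_integral \<alpha> \<gamma> d u v = base_integral \<alpha> \<beta> d u v + base_integral \<beta> \<gamma> d u v"
    if "y_lo S \<le> d" "d \<le> y_hi S" for d
  proof -
    let ?f = "\<lambda>x. u (x, d) * cnj (v (x, d))"
    have c: "continuous_on {s..t} ?f" if "x_lo S \<le> s" "t \<le> x_hi S" for s t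
      by (intro continuous_intros V_space_base_continuous assms that \<open>y_lo S \<le> d\<close> \<open>d \<le> y_hi S\<close>)
    have eq: "base_integral s t d u v = integral {s..t} ?f" if "x_lo S \<le> s" "t \<le> x_hi S" for s t
      unfolding base_integral_def
      by (rule set_borel_integral_eq_integral(2)[OF borel_integrable_atLeastAtMost'[OF c[OF that]]])
    have "integral {\<alpha>..\<beta>} ?f + integral {\<beta>..\<gamma>} ?f = integral {\<alpha>..\<gamma>} ?f"
      using assms by (intro Henstock_Kurzweil_Integration.integral_combine integrable_continuous_real c) auto
    then show ?thesis using assms by (simp add: eq)
  qed
  show ?thesis
    using 1 2[of "y_lo S"] 2[of "y_hi S"] y_lo_less by (simp add: bulk_def algebra_simps)
qed

text \<open>In the difference of the forms on nested bands the inner band cancels.\<close>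

lemma form_band_difference:
  assumes "x_lo S \<le> A" "A \<le> \<alpha>" "\<alpha> < \<beta>" "\<beta> \<le> B" "B \<le> x_hi S" "u \<in> V_space S" "v \<in> V_space S"
  shows "form S (band S \<alpha> \<beta>) u v - form S (band S A B) u v = - bulk S A \<alpha> u v - bulk S \<beta> B u v
    - \<i> * of_real (wavenumber S) * (side_integral S \<alpha> u v - side_integral S A u v + (side_integral S \<beta> u v - side_integral S B u v))"
proof -
  have le: "x_lo S \<le> \<alpha>" "\<alpha> \<le> B" "\<alpha> \<le> \<beta>" "\<beta> \<le> x_hi S" "A < B" using assms(1-5) by auto
  show ?thesis
    using bulk_split[OF assms(1,2) le(2) assms(5-7)] bulk_split[OF le(1,3) assms(4-7)]
    unfolding form_band[OF le(1) assms(3) le(4) assms(6,7)] form_band[OF assms(1) le(5) assms(5-7)]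
    by (simp add: algebra_simps)
qed

lemma side_integral_cong:
  assumes "\<And>y. y_lo S \<le> y \<Longrightarrow> y \<le> y_hi S \<Longrightarrow> u (c, y) = u' (c, y)" "\<And>y. y_lo S \<le> y \<Longrightarrow> y \<le> y_hi S \<Longrightarrow> v (c, y) = v' (c, y)"
  shows "side_integral S c u v = side_integral S c u' v'"
  unfolding side_integral_def set_lebesgue_integral_def
  by (rule Bochner_Integration.integral_cong) (auto simp: indicator_def assms)

lemma side_integral_zero:
  assumes "\<And>y. y_lo S \<le> y \<Longrightarrow> y \<le> y_hi S \<Longrightarrow> v (c, y) = 0"
  shows "side_integral S c u v = 0"
  using side_integral_cong[of u c u v "\<lambda>x. 0"] assms by (simp add: side_integral_def)

lemma bulk_degenerate: "bulk S \<alpha> \<alpha> u v = 0"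
proof -
  have "base_integral \<alpha> \<alpha> d u v = 0" for d
    unfolding base_integral_def set_lebesgue_integral_def
  proof (rule integral_eq_zero_AE)
    show "AE x in lborel. indicat_real {\<alpha>..\<alpha>} x *\<^sub>R (u (x, d) * cnj (v (x, d))) = 0"
      using AE_lborel_singleton[of \<alpha>] by eventually_elim simp
  qed
  then show ?thesis by (simp add: bulk_def band_eq set_lebesgue_integral_def)
qed

text \<open>Gradients on an open band depend only on the values there, so the comparison goes through the form on
  the band; an empty band has to be treated apart.\<close>

lemma bulk_cong:
  assumes "x_lo S \<le> \<alpha>" "\<alpha> \<le> \<beta>" "\<beta> \<le> x_hi S" "u \<in> V_space S" "v \<in> V_space S" "u' \<in> V_space S" "v' \<in> V_space S"
    and eq: "\<And>z. \<alpha> \<le> fst z \<Longrightarrow> fst z \<le> \<beta> \<Longrightarrow> u z = u' z" "\<And>z. \<alpha> \<le> fst z \<Longrightarrow> fst z \<le> \<beta> \<Longrightarrow> v z = v' z"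
  shows "bulk S \<alpha> \<beta> u v = bulk S \<alpha> \<beta> u' v'"
proof (cases "\<alpha> = \<beta>")
  case False
  then have lt: "\<alpha> < \<beta>" using assms(2) by simp
  have "form S (band S \<alpha> \<beta>) u v = form S (band S \<alpha> \<beta>) u' v'"
  proof (rule helmholtz_form_cong)
    show "open (band S \<alpha> \<beta>)" by (simp add: band_def open_box)
  qed (use eq in \<open>auto simp: closure_band[OF lt]\<close>)
  moreover have "side_integral S \<alpha> u v = side_integral S \<alpha> u' v'" "side_integral S \<beta> u v = side_integral S \<beta> u' v'"
    by (rule side_integral_cong; simp add: eq assms(2))+
  ultimately show ?thesis
    using form_band[OF assms(1) lt assms(3,4,5)] form_band[OF assms(1) lt assms(3,6,7)] by simp
qed (simp add: bulk_degenerate)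

lemma bulk_zero:
  assumes "x_lo S \<le> \<alpha>" "\<alpha> \<le> \<beta>" "\<beta> \<le> x_hi S" "u \<in> V_space S" "v \<in> V_space S"
    and "\<And>z. \<alpha> \<le> fst z \<Longrightarrow> fst z \<le> \<beta> \<Longrightarrow> v z = 0"
  shows "bulk S \<alpha> \<beta> u v = 0"
proof (cases "\<alpha> = \<beta>")
  case False
  then have lt: "\<alpha> < \<beta>" using assms(2) by simp
  have "form S (band S \<alpha> \<beta>) u (\<lambda>x. 0) = 0"
    using form_band_add_scaled[OF assms(1) lt assms(3,4) V_space_zero V_space_zero, of 1] by simp
  then have "bulk S \<alpha> \<beta> u (\<lambda>x. 0) = 0"
    using form_band[OF assms(1) lt assms(3,4) V_space_zero] by (simp add: side_integral_zero)
  then show ?thesis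
    using bulk_cong[OF assms(1-5) assms(4) V_space_zero] assms(6) by simp
qed (simp add: bulk_degenerate)

lemma side_integral_definite:
  assumes "u \<in> V_space S" "x_lo S \<le> c" "c \<le> x_hi S"
  obtains r where "side_integral S c u u = of_real r" "0 \<le> r" "r = 0 \<Longrightarrow> (\<And>y. y \<in> {y_lo S..y_hi S} \<Longrightarrow> u (c, y) = 0)"
proof -
  let ?f = "\<lambda>y. (norm (u (c, y)))\<^sup>2"
  have cf: "continuous_on {y_lo S..y_hi S} ?f"
    by (intro continuous_intros V_space_side_continuous assms)
  have "side_integral S c u u = (LINT y:{y_lo S..y_hi S}|lborel. complex_of_real (?f y))"
    unfolding side_integral_def complex_norm_square ..
  also have "\<dots> = of_real (LINT y:{y_lo S..y_hi S}|lborel. ?f y)"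
    by (rule set_integral_complex_of_real)
  also have "(LINT y:{y_lo S..y_hi S}|lborel. ?f y) = integral {y_lo S..y_hi S} ?f"
    by (rule set_borel_integral_eq_integral(2)[OF borel_integrable_atLeastAtMost'[OF cf]])
  finally have "side_integral S c u u = of_real (integral {y_lo S..y_hi S} ?f)" .
  moreover have "0 \<le> integral {y_lo S..y_hi S} ?f"
    by (rule integral_nonneg) (auto intro: integrable_continuous_real cf)
  moreover have "u (c, y) = 0" if "integral {y_lo S..y_hi S} ?f = 0" "y \<in> {y_lo S..y_hi S}" for y
  proof -
    have "(?f has_integral 0) (cbox (y_lo S) (y_hi S))"
      using that(1) integrable_integral[OF integrable_continuous_real[OF cf]] by simp
    from has_integral_0_cbox_imp_0[OF _ _ this] cf y_lo_less that(2) have "?f y = 0" by simp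
    then show ?thesis by simp
  qed
  ultimately show ?thesis by (rule that)
qed

end

section \<open>Riesz representation of functionals of the trace\<close>

interpretation cfun: vector_space "\<lambda>(c :: complex) (f :: plane \<Rightarrow> complex) x. c * f x"
  by unfold_locales (auto simp: fun_eq_iff algebra_simps)

text \<open>Gram-Schmidt, one generator at a time. The form \<open>ip\<close> may be degenerate, since functions that vanish on
  an interface are not zero; this is harmless as long as \<open>F\<close> vanishes on its null vectors.\<close>

lemma riesz_representation_finite:
  assumes "finite B" "B \<subseteq> W" and W0: "(\<lambda>x. 0) \<in> W"
    and W: "\<And>u v c. u \<in> W \<Longrightarrow> v \<in> W \<Longrightarrow> (\<lambda>x. u x + c * v x) \<in> W"
    and left: "\<And>u v w c. u \<in> W \<Longrightarrow> v \<in> W \<Longrightarrow> w \<in> W \<Longrightarrow> ip (\<lambda>x. u x + c * v x) w = ip u w + c * ip v w"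
    and right: "\<And>u v w c. u \<in> W \<Longrightarrow> v \<in> W \<Longrightarrow> w \<in> W \<Longrightarrow> ip w (\<lambda>x. u x + c * v x) = ip w u + cnj c * ip w v"
    and null: "\<And>u v. u \<in> W \<Longrightarrow> v \<in> W \<Longrightarrow> ip u u = 0 \<Longrightarrow> ip v u = (0 :: complex)"
    and F: "\<And>u v c. u \<in> W \<Longrightarrow> v \<in> W \<Longrightarrow> F (\<lambda>x. u x + c * v x) = F u + cnj c * F v"
    and F_null: "\<And>u. u \<in> W \<Longrightarrow> ip u u = 0 \<Longrightarrow> F u = 0"
  shows "\<exists>g\<in>cfun.span B. \<forall>v\<in>cfun.span B. ip g v = F v"
  using assms(1,2) F F_null
proof (induction B arbitrary: F)
  case empty
  have "F (\<lambda>x. 0) = 0" using empty(2)[OF W0 W0, of 1] by simp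
  moreover have "ip (\<lambda>x. 0) (\<lambda>x. 0) = 0" using left[OF W0 W0 W0, of 1] by simp
  ultimately show ?case by (simp add: zero_fun_def)
next
  case (insert b B)
  have B: "B \<subseteq> W" and b: "b \<in> W" using insert.prems(1) by auto
  have span: "u \<in> W" if "u \<in> cfun.span B" for u
    using that
  proof (induction rule: cfun.span_induct_alt)
    case base
    show ?case using W0 by (simp add: zero_fun_def)
  next
    case (step c x y)
    then show ?case using W[of y x c] B by (auto simp: plus_fun_def add.commute)
  qed
  have "\<exists>g\<in>cfun.span B. \<forall>v\<in>cfun.span B. ip g v = ip b v"
    by (rule insert.IH[OF B]) (simp_all add: right null b)
  then obtain g where g: "g \<in> cfun.span B" "\<And>v. v \<in> cfun.span B \<Longrightarrow> ip g v = ip b v" by blast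
  have "\<exists>g\<in>cfun.span B. \<forall>v\<in>cfun.span B. ip g v = F v"
    by (rule insert.IH[OF B]) (simp_all add: insert.prems(2,3))
  then obtain g0 where g0: "g0 \<in> cfun.span B" "\<And>v. v \<in> cfun.span B \<Longrightarrow> ip g0 v = F v"
    by blast
  \<comment> \<open>\<open>g\<close> represents the pairing with \<open>b\<close> on the span of \<open>B\<close>,
    so \<open>b'\<close> is the component of \<open>b\<close> orthogonal to that span.\<close>
  define b' where "b' = (\<lambda>x. b x + (-1) * g x)"
  have b': "b' \<in> W" unfolding b'_def by (intro W b span g(1))
  have orth: "ip b' v = 0" if "v \<in> cfun.span B" for v
    unfolding b'_def using left[OF b span[OF g(1)] span[OF that], of "-1"] g(2)[OF that] by simp
  define N where "N = ip b' b'"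
  define c where "c = (if N = 0 then 0 else (F b' - ip g0 b') / N)"
  have c: "ip g0 b' + c * N = F b'"
  proof (cases "N = 0")
    case True
    then show ?thesis
      using null[OF b' span[OF g0(1)]] insert.prems(3)[OF b'] by (simp add: N_def)
  qed (simp add: c_def)
  have b'_span: "b' \<in> cfun.span (insert b B)"
  proof -
    have "b - g \<in> cfun.span (insert b B)"
      using g(1) cfun.span_mono[of B "insert b B"] by (intro cfun.span_diff) (auto intro: cfun.span_base)
    then show ?thesis by (simp add: b'_def fun_diff_def)
  qed
  have "(\<lambda>x. g0 x + c * b' x) \<in> cfun.span (insert b B)"
  proof -
    have "g0 + (\<lambda>x. c * b' x) \<in> cfun.span (insert b B)"
      by (intro cfun.span_add cfun.span_scale b'_span) (use g0(1) cfun.span_mono[of B "insert b B"] in auto)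
    then show ?thesis by (simp add: plus_fun_def)
  qed
  moreover have "ip (\<lambda>x. g0 x + c * b' x) v = F v" if vspan: "v \<in> cfun.span (insert b B)" for v
  proof -
    obtain k where k: "v - (\<lambda>x. k * b x) \<in> cfun.span B"
      using vspan unfolding cfun.span_insert by blast
    define u where "u = (\<lambda>x. (v x - k * b x) + k * g x)"
    have "(v - (\<lambda>x. k * b x)) + (\<lambda>x. k * g x) \<in> cfun.span B"
      by (intro cfun.span_add cfun.span_scale k g(1))
    then have u: "u \<in> cfun.span B" by (simp add: u_def plus_fun_def fun_diff_def)
    have v: "v = (\<lambda>x. u x + k * b' x)" by (simp add: u_def b'_def fun_eq_iff algebra_simps)
    have uW: "u \<in> W" and g0W: "g0 \<in> W" by (intro span u g0(1))+
    have vW: "v \<in> W" unfolding v by (intro W uW b')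
    have "ip (\<lambda>x. g0 x + c * b' x) v = ip g0 v + c * ip b' v"
      by (rule left[OF g0W b' vW])
    also have "ip g0 v = F u + cnj k * ip g0 b'"
      unfolding v using right[OF uW b' g0W] g0(2)[OF u] by simp
    also have "ip b' v = cnj k * N"
      unfolding v using right[OF uW b' b'] orth[OF u] by (simp add: N_def)
    also have "F u + cnj k * ip g0 b' + c * (cnj k * N) = F u + cnj k * (ip g0 b' + c * N)"
      by (simp add: algebra_simps)
    also have "\<dots> = F v" unfolding c v using insert.prems(2)[OF uW b'] by simp
    finally show ?thesis .
  qed
  ultimately show ?case by blast
qed

lemma sum_functions_apply: "(\<Sum>i\<in>I. f i) x = (\<Sum>i\<in>I. f i x :: complex)"
  by (induction I rule: infinite_finite_induct) auto

context fe_mesh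
begin

lemma V_space_add_scaled: "u \<in> V_space S \<Longrightarrow> v \<in> V_space S \<Longrightarrow> (\<lambda>x. u x + c * v x) \<in> V_space S"
  by (intro V_space_add V_space_scale)

lemma V_space_eq_if_nodes_eq:
  assumes "u \<in> V_space S" "v \<in> V_space S" "\<And>z. z \<in> nodes S \<Longrightarrow> u z = v z"
  shows "u = v"
proof
  show "u x = v x" for x
    by (rule V_space_eq_on_resolved[OF assms(1,2) resolved_UNIV]) (use assms(3) in auto)
qed

lemma V_space_sum: "(\<And>i. i \<in> I \<Longrightarrow> f i \<in> V_space S) \<Longrightarrow> (\<lambda>x. \<Sum>i\<in>I. f i x) \<in> V_space S"
  by (induction I rule: infinite_finite_induct) (auto intro: V_space_zero V_space_add)

text \<open>A finite element function is the combination of the nodal basis functions whose coefficients are its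
  nodal values.\<close>

lemma V_space_finite_span:
  obtains B where "finite B" "B \<subseteq> V_space S" "V_space S \<subseteq> cfun.span B"
proof -
  have "\<forall>z. \<exists>u. u \<in> V_space S \<and> (\<forall>y\<in>nodes S. u y = (if y = z then 1 else 0))"
    using nodal_function_exists[of "\<lambda>y. if y = _ then 1 else 0"] by blast
  from choice[OF this] obtain e where e: "\<And>z. e z \<in> V_space S" "\<And>y z. y \<in> nodes S \<Longrightarrow> e z y = (if y = z then 1 else 0)"
    by blast
  have "v \<in> cfun.span (e ` nodes S)" if v: "v \<in> V_space S" for v
  proof -
    have "v = (\<lambda>x. \<Sum>z\<in>nodes S. v z * e z x)"
    proof (rule V_space_eq_if_nodes_eq[OF v])
      show "(\<lambda>x. \<Sum>z\<in>nodes S. v z * e z x) \<in> V_space S" by (intro V_space_sum V_space_scale e)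
      show "v y = (\<Sum>z\<in>nodes S. v z * e z y)" if "y \<in> nodes S" for y
      proof -
        have "(\<Sum>z\<in>nodes S. v z * e z y) = (\<Sum>z\<in>nodes S. if y = z then v z else 0)"
          by (rule sum.cong) (simp_all add: e(2) that)
        also have "\<dots> = v y" using finite_nodes that by (simp add: sum.delta')
        finally show ?thesis by simp
      qed
    qed
    also have "\<dots> = (\<Sum>z\<in>nodes S. (\<lambda>x. v z * e z x))" by (simp add: fun_eq_iff sum_functions_apply)
    also have "\<dots> \<in> cfun.span (e ` nodes S)"
      by (intro cfun.span_sum cfun.span_scale cfun.span_base) auto
    finally show ?thesis .
  qed
  then show ?thesis using that[of "e ` nodes S"] finite_nodes e(1) by blast
qed

lemma inner_on_sides_add_scaled:
  assumes "finite X" "X \<subseteq> {x_lo S..x_hi S}" "u \<in> V_space S" "v \<in> V_space S" "w \<in> V_space S"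
  shows "inner_on (X \<times> {y_lo S..y_hi S}) u (\<lambda>x. v x + a * w x) = inner_on (X \<times> {y_lo S..y_hi S}) u v + cnj a * inner_on (X \<times> {y_lo S..y_hi S}) u w"
    and "inner_on (X \<times> {y_lo S..y_hi S}) (\<lambda>x. v x + a * w x) u = inner_on (X \<times> {y_lo S..y_hi S}) v u + a * inner_on (X \<times> {y_lo S..y_hi S}) w u"
proof -
  have X: "x_lo S \<le> x" "x \<le> x_hi S" if "x \<in> X" for x using assms(2) that by auto
  show "inner_on (X \<times> {y_lo S..y_hi S}) u (\<lambda>x. v x + a * w x) = inner_on (X \<times> {y_lo S..y_hi S}) u v + cnj a * inner_on (X \<times> {y_lo S..y_hi S}) u w"
    by (simp add: inner_on_sides[OF assms(1)] side_integral_add_scaled[OF assms(3-5) X] sum.distrib sum_distrib_left)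
  show "inner_on (X \<times> {y_lo S..y_hi S}) (\<lambda>x. v x + a * w x) u = inner_on (X \<times> {y_lo S..y_hi S}) v u + a * inner_on (X \<times> {y_lo S..y_hi S}) w u"
    by (simp add: inner_on_sides[OF assms(1)] side_integral_add_scaled[OF assms(3-5) X] sum.distrib sum_distrib_left)
qed

text \<open>A sum of nonnegative side integrals; each integrand is continuous, so it vanishes if its integral does.\<close>

lemma inner_on_sides_definite:
  assumes "finite X" "X \<subseteq> {x_lo S..x_hi S}" "u \<in> V_space S" "inner_on (X \<times> {y_lo S..y_hi S}) u u = 0"
    and z: "z \<in> X \<times> {y_lo S..y_hi S}"
  shows "u z = 0"
proof -
  have "\<forall>x\<in>X. \<exists>r. side_integral S x u u = of_real r \<and> 0 \<le> r \<and> (r = 0 \<longrightarrow> (\<forall>y\<in>{y_lo S..y_hi S}. u (x, y) = 0))"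
  proof
    fix x assume "x \<in> X"
    then have x: "x_lo S \<le> x" "x \<le> x_hi S" using assms(2) by auto
    show "\<exists>r. side_integral S x u u = of_real r \<and> 0 \<le> r \<and> (r = 0 \<longrightarrow> (\<forall>y\<in>{y_lo S..y_hi S}. u (x, y) = 0))"
      by (rule side_integral_definite[OF assms(3) x]) blast
  qed
  from bchoice[OF this] obtain r where r: "\<And>x. x \<in> X \<Longrightarrow> side_integral S x u u = of_real (r x)" "\<And>x. x \<in> X \<Longrightarrow> 0 \<le> r x"
      "\<And>x y. x \<in> X \<Longrightarrow> r x = 0 \<Longrightarrow> y \<in> {y_lo S..y_hi S} \<Longrightarrow> u (x, y) = 0"
    by blast
  have "complex_of_real (\<Sum>x\<in>X. r x) = 0"
    using assms(4) by (simp add: inner_on_sides[OF assms(1)] r(1))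
  then have "(\<Sum>x\<in>X. r x) = 0" by (simp only: of_real_eq_0_iff)
  then have "r x = 0" if "x \<in> X" for x
    using sum_nonneg_eq_0_iff[of X r] assms(1) r(2) that by simp
  with r(3) z show ?thesis by (cases z) auto
qed

lemma trace_riesz_representation:
  assumes X: "finite X" "X \<subseteq> {x_lo S..x_hi S}"
    and F: "\<And>u v c. u \<in> V_space S \<Longrightarrow> v \<in> V_space S \<Longrightarrow> F (\<lambda>x. u x + c * v x) = F u + cnj c * F v"
    and F_trace: "\<And>u. u \<in> V_space S \<Longrightarrow> (\<And>z. z \<in> X \<times> {y_lo S..y_hi S} \<Longrightarrow> u z = 0) \<Longrightarrow> F u = 0"
  shows "\<exists>g\<in>V_space S. \<forall>v\<in>V_space S. inner_on (X \<times> {y_lo S..y_hi S}) g v = F v"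
proof -
  let ?ip = "inner_on (X \<times> {y_lo S..y_hi S})"
  obtain B where B: "finite B" "B \<subseteq> V_space S" "V_space S \<subseteq> cfun.span B" by (rule V_space_finite_span)
  have "\<exists>g\<in>cfun.span B. \<forall>v\<in>cfun.span B. ?ip g v = F v"
  proof (rule riesz_representation_finite[OF B(1,2) V_space_zero V_space_add_scaled])
    show "?ip v u = 0" if "u \<in> V_space S" "v \<in> V_space S" "?ip u u = 0" for u v
    proof -
      have "?ip v u = ?ip v (\<lambda>x. 0)"
        by (rule inner_on_cong) (use inner_on_sides_definite[OF X that(1,3)] in auto)
      also have "\<dots> = 0" by (simp add: inner_on_sides[OF X(1)] side_integral_zero)
      finally show ?thesis .
    qed
    show "F u = 0" if "u \<in> V_space S" "?ip u u = 0" for u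
      by (rule F_trace[OF that(1) inner_on_sides_definite[OF X that]])
  qed (use inner_on_sides_add_scaled[OF X] F in auto)
  then obtain g where g: "g \<in> cfun.span B" "\<And>v. v \<in> cfun.span B \<Longrightarrow> ?ip g v = F v" by blast
  have "g \<in> V_space S"
    using g(1)
  proof (induction rule: cfun.span_induct_alt)
    case base
    show ?case using V_space_zero by (simp add: zero_fun_def)
  next
    case (step c x y)
    then show ?case using V_space_add_scaled[of y x c] B(2) by (auto simp: plus_fun_def add.commute)
  qed
  with g(2) B(3) show ?thesis by blast
qed

text \<open>The test function is the difference \<open>g - h\<close> itself.\<close>

lemma trace_eqI:
  assumes X: "finite X" "X \<subseteq> {x_lo S..x_hi S}" and g: "g \<in> V_space S" "h \<in> V_space S"
    and eq: "\<And>v. v \<in> V_space S \<Longrightarrow> inner_on (X \<times> {y_lo S..y_hi S}) g v = inner_on (X \<times> {y_lo S..y_hi S}) h v"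
    and z: "z \<in> X \<times> {y_lo S..y_hi S}"
  shows "g z = h z"
proof -
  let ?d = "\<lambda>x. g x + (-1) * h x"
  have d: "?d \<in> V_space S" by (intro V_space_add_scaled g)
  have "inner_on (X \<times> {y_lo S..y_hi S}) ?d ?d = 0"
    using inner_on_sides_add_scaled(2)[OF X d g, of "-1"] eq[OF d] by simp
  from inner_on_sides_definite[OF X d this z] show ?thesis by simp
qed

end

section \<open>Geometry of the strips and the partition of unity\<close>

locale helmholtz_strips =
  fixes S :: strip_setting
  assumes valid: "valid_setting S"

sublocale helmholtz_strips \<subseteq> fe_mesh
  using valid by unfold_locales (auto simp: valid_setting_def)

context helmholtz_strips
begin

lemma decomposition: "strip_decomposition S"
  using valid by (simp add: valid_setting_def)

lemmas num_strips_pos = decomposition[unfolded strip_decomposition_def, THEN conjunct1]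
lemmas strip_ends_bounds = decomposition[unfolded strip_decomposition_def, THEN conjunct2, THEN conjunct1]
lemmas strip_ends_step = decomposition[unfolded strip_decomposition_def, THEN conjunct2, THEN conjunct2, THEN conjunct1]
lemmas Union_strips = decomposition[unfolded strip_decomposition_def, THEN conjunct2, THEN conjunct2, THEN conjunct2, THEN conjunct1]
lemmas strips_overlap = decomposition[unfolded strip_decomposition_def, THEN conjunct2, THEN conjunct2, THEN conjunct2, THEN conjunct2, THEN conjunct1]
lemmas strips_gap = decomposition[unfolded strip_decomposition_def, THEN conjunct2, THEN conjunct2, THEN conjunct2, THEN conjunct2, THEN conjunct2, THEN conjunct1]
lemmas strips_resolved = decomposition[unfolded strip_decomposition_def, THEN conjunct2, THEN conjunct2, THEN conjunct2, THEN conjunct2, THEN conjunct2, THEN conjunct2]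

lemma strip_bounds:
  assumes "l \<in> {1..num_strips S}"
  shows "x_lo S \<le> strip_lo S l" "strip_lo S l < strip_hi S l" "strip_hi S l \<le> x_hi S"
  using bspec[OF strip_ends_bounds assms] by auto

lemma strip_eq_band: "strip S l = band S (strip_lo S l) (strip_hi S l)"
  by (simp add: strip_def band_def)

lemma strip_ends_mono:
  assumes "1 \<le> i" "i \<le> j" "j \<le> num_strips S"
  shows "strip_lo S i \<le> strip_lo S j" "strip_hi S i \<le> strip_hi S j"
proof -
  have "strip_lo S i \<le> strip_lo S j \<and> strip_hi S i \<le> strip_hi S j"
    using assms(2,3)
  proof (induction j rule: dec_induct)
    case (step n)
    have "n \<in> {1..<num_strips S}" using step assms(1) by auto
    from bspec[OF strip_ends_step this] step show ?case by auto
  qed simp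
  then show "strip_lo S i \<le> strip_lo S j" "strip_hi S i \<le> strip_hi S j" by auto
qed

lemma strip_ends_less_Suc:
  assumes "1 \<le> l" "Suc l \<le> num_strips S"
  shows "strip_lo S l < strip_lo S (Suc l)" "strip_lo S (Suc l) < strip_hi S l" "strip_hi S l < strip_hi S (Suc l)"
proof -
  have l: "l \<in> {1..<num_strips S}" using assms by auto
  show "strip_lo S l < strip_lo S (Suc l)" "strip_hi S l < strip_hi S (Suc l)"
    using bspec[OF strip_ends_step l] by auto
  have "strip S l \<inter> strip S (Suc l) \<noteq> {}" by (rule bspec[OF strips_overlap l])
  then show "strip_lo S (Suc l) < strip_hi S l" by (auto simp: strip_eq_band band_eq)
qed

lemma strips_separated:
  assumes "1 \<le> j" "j + 2 \<le> l" "l \<le> num_strips S"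
  shows "strip_hi S j < strip_lo S l"
proof -
  have "j \<in> {1..num_strips S}" "l \<in> {1..num_strips S}" using assms by auto
  from bspec[OF bspec[OF strips_gap this(1)] this(2)] assms(2) show ?thesis by simp
qed

text \<open>The right ends of the strips increase, so points of the domain beyond the last one would not be covered.\<close>

lemma last_strip_hi: "strip_hi S (num_strips S) = x_hi S"
proof (rule ccontr)
  have N: "num_strips S \<in> {1..num_strips S}" using num_strips_pos by auto
  assume "strip_hi S (num_strips S) \<noteq> x_hi S"
  then have lt: "strip_hi S (num_strips S) < x_hi S" using strip_bounds[OF N] by simp
  have "((strip_hi S (num_strips S) + x_hi S) / 2, (y_lo S + y_hi S) / 2) \<in> Omega S"
    using lt strip_bounds[OF N] y_lo_less by (simp add: Omega_eq)
  also have "Omega S = (\<Union>l\<in>{1..num_strips S}. strip S l)"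
    by (rule Union_strips[symmetric])
  finally obtain l where l: "1 \<le> l" "l \<le> num_strips S" "(strip_hi S (num_strips S) + x_hi S) / 2 < strip_hi S l"
    by (auto simp: strip_eq_band band_eq)
  then show False using strip_ends_mono(2)[of l "num_strips S"] lt by simp
qed

lemma first_strip_lo: "strip_lo S 1 = x_lo S"
proof (rule ccontr)
  have N: "1 \<in> {1..num_strips S}" using num_strips_pos by auto
  assume "strip_lo S 1 \<noteq> x_lo S"
  then have lt: "x_lo S < strip_lo S 1" using strip_bounds[OF N] by simp
  have "((x_lo S + strip_lo S 1) / 2, (y_lo S + y_hi S) / 2) \<in> Omega S"
    using lt strip_bounds[OF N] y_lo_less by (simp add: Omega_eq)
  also have "Omega S = (\<Union>l\<in>{1..num_strips S}. strip S l)"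
    by (rule Union_strips[symmetric])
  finally obtain l where l: "1 \<le> l" "l \<le> num_strips S" "strip_lo S l < (x_lo S + strip_lo S 1) / 2"
    by (auto simp: strip_eq_band band_eq)
  then show False using strip_ends_mono(1)[of 1 l] lt by simp
qed

lemma closure_strip:
  assumes "l \<in> {1..num_strips S}"
  shows "closure (strip S l) = {strip_lo S l..strip_hi S l} \<times> {y_lo S..y_hi S}"
  unfolding strip_eq_band by (rule closure_band[OF strip_bounds(2)[OF assms]])

text \<open>The abscissae of the vertical sides of a strip that lie inside the domain.\<close>

definition interior_ends :: "nat \<Rightarrow> real set" where
  "interior_ends l = {strip_lo S l, strip_hi S l} - {x_lo S, x_hi S}"

lemma Gamma_eq:
  assumes l: "l \<in> {1..num_strips S}"
  shows "Gamma S l = interior_ends l \<times> {y_lo S..y_hi S}"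
proof -
  note b = strip_bounds[OF l]
  have "frontier (Omega S) = {x_lo S..x_hi S} \<times> {y_lo S..y_hi S} - {x_lo S<..<x_hi S} \<times> {y_lo S<..<y_hi S}"
    using frontier_band[OF x_lo_less] by (simp add: band_def Omega_def)
  moreover have "frontier (strip S l) = {strip_lo S l..strip_hi S l} \<times> {y_lo S..y_hi S}
      - {strip_lo S l<..<strip_hi S l} \<times> {y_lo S<..<y_hi S}"
    unfolding strip_eq_band by (rule frontier_band[OF b(2)])
  moreover have "A \<times> Y - B \<times> Y' - (C \<times> Y - C' \<times> Y') = (A \<inter> C' - B) \<times> Y'"
    if "A \<subseteq> C" "B \<subseteq> C'" "Y' \<subseteq> Y" for A B C C' Y Y' :: "real set"
    using that by blast
  moreover have "{strip_lo S l..strip_hi S l} \<inter> {x_lo S<..<x_hi S} - {strip_lo S l<..<strip_hi S l} = interior_ends l"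
    using b by (auto simp: interior_ends_def)
  moreover have "{strip_lo S l..strip_hi S l} \<subseteq> {x_lo S..x_hi S}" "{strip_lo S l<..<strip_hi S l} \<subseteq> {x_lo S<..<x_hi S}"
    "{y_lo S<..<y_hi S} \<subseteq> {y_lo S..y_hi S}"
    using b by auto
  ultimately have "frontier (strip S l) - frontier (Omega S) = interior_ends l \<times> {y_lo S<..<y_hi S}"
    by simp
  moreover have "closure (interior_ends l) = interior_ends l"
    by (simp add: interior_ends_def finite_imp_closed)
  ultimately show ?thesis
    using y_lo_less by (simp add: Gamma_def closure_Times closure_greaterThanLessThan)
qed

lemma Gamma_side_eq:
  assumes "l \<in> {1..num_strips S}"
  shows "Gamma_side S s l = (interior_ends l \<inter> {strip_end S s l}) \<times> {y_lo S..y_hi S}"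
  by (auto simp: Gamma_side_def Gamma_eq[OF assms])

lemma interior_ends_subset:
  assumes "l \<in> {1..num_strips S}"
  shows "finite (interior_ends l)" "interior_ends l \<subseteq> {x_lo S..x_hi S}"
  using strip_bounds[OF assms] by (auto simp: interior_ends_def)

lemma triangle_interior:
  assumes "K \<in> mesh S"
  shows "interior K = rel_interior K" "interior K \<noteq> {}"
proof -
  have K: "2 simplex K" using assms conforming by (simp add: conforming_mesh_def)
  have "aff_dim K = int DIM(plane)" using aff_dim_simplex[OF K] by simp
  then have "affine hull K = UNIV" by (simp only: aff_dim_eq_full)
  then show *: "interior K = rel_interior K" by (simp add: rel_interior_interior)
  have "K \<noteq> {}" using K by (auto dest: aff_dim_simplex)
  then show "interior K \<noteq> {}"
    using rel_interior_eq_empty[OF element_compact_convex(2)[OF assms]] by (simp add: *)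
qed

text \<open>An element that reaches across the line of a strip side has an interior point on the side, and hence
  interior points in the strip. There it meets an element that belongs to the strip. The common face
  contains an interior point, so it is the whole element, which then lies in the closed strip and cannot
  reach across its side.\<close>

lemma element_on_one_side:
  assumes l: "l \<in> {1..num_strips S}" and c: "c \<in> {strip_lo S l, strip_hi S l}" and K: "K \<in> mesh S"
  shows "K \<subseteq> {z. fst z \<le> c} \<or> K \<subseteq> {z. c \<le> fst z}"
proof (rule ccontr)
  assume "\<not> ?thesis"
  then obtain z1 z2 where z: "z1 \<in> K" "c < fst z1" "z2 \<in> K" "fst z2 < c"
    unfolding de_Morgan_disj subset_iff mem_Collect_eq not_all not_imp not_le by blast
  have cl: "K \<subseteq> closure (interior K)"
    using convex_closure_interior[OF element_compact_convex(2)[OF K] triangle_interior(2)[OF K]] closure_subset by blast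
  have "open {z :: plane. c < fst z}" "open {z :: plane. fst z < c}"
    by (intro open_Collect_less continuous_intros)+
  then have "{z :: plane. c < fst z} \<inter> interior K \<noteq> {}" "{z :: plane. fst z < c} \<inter> interior K \<noteq> {}"
    using z cl open_Int_closure_eq_empty by blast+
  then obtain w1 w2 where w: "w1 \<in> interior K" "c < fst w1" "w2 \<in> interior K" "fst w2 < c" by blast
  define t where "t = (c - fst w2) / (fst w1 - fst w2)"
  have t: "0 \<le> t" "0 \<le> 1 - t" using w by (auto simp: t_def field_simps)
  define x where "x = t *\<^sub>R w1 + (1 - t) *\<^sub>R w2"
  have "x \<in> interior K"
    unfolding x_def by (rule convexD[OF convex_interior[OF element_compact_convex(2)[OF K]]]) (use w t in auto)
  have "fst x = fst w2 + t * (fst w1 - fst w2)" by (simp add: x_def algebra_simps)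
  then have fx: "fst x = c" using w by (simp add: t_def)
  have "interior K \<subseteq> interior (closure (Omega S))"
    using K Union_mesh by (intro interior_mono) blast
  also have "\<dots> = Omega S"
    unfolding closure_Omega by (simp add: interior_Times Omega_eq)
  finally have "x \<in> Omega S" using \<open>x \<in> interior K\<close> by blast
  then have "x \<in> closure (strip S l)"
    using fx c strip_bounds[OF l] by (cases x) (auto simp: closure_strip[OF l] Omega_eq)
  then have "interior K \<inter> strip S l \<noteq> {}"
    using \<open>x \<in> interior K\<close> open_Int_closure_eq_empty[OF open_interior] by blast
  then obtain q where q: "q \<in> interior K" "q \<in> strip S l" by blast
  obtain M where M: "M \<subseteq> mesh S" "\<Union>M = closure (strip S l)"
    using bspec[OF strips_resolved l] by blast
  have "q \<in> \<Union>M" using q(2) closure_subset M(2) by blast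
  then obtain K' where K': "K' \<in> M" "q \<in> K'" by blast
  have "K \<subseteq> K \<inter> K'"
  proof (rule subset_of_face_of[OF elements_meet_in_face[OF K]])
    show "K' \<in> mesh S" using K'(1) M(1) by blast
    show "K \<inter> K' \<inter> rel_interior K \<noteq> {}"
      using q(1) K'(2) triangle_interior(1)[OF K] interior_subset[of K] by blast
  qed simp
  then have "K \<subseteq> closure (strip S l)" using K'(1) M(2) by blast
  then have "strip_lo S l \<le> fst z2" "fst z1 \<le> strip_hi S l"
    using z by (auto simp: closure_strip[OF l])
  then show False using z c by auto
qed

definition resolved_abscissa :: "real \<Rightarrow> bool" where
  "resolved_abscissa c \<longleftrightarrow> (\<forall>K\<in>mesh S. K \<subseteq> {z. fst z \<le> c} \<or> K \<subseteq> {z. c \<le> fst z})"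

lemma resolved_abscissa_strip_end:
  assumes "l \<in> {1..num_strips S}"
  shows "resolved_abscissa (strip_lo S l)" "resolved_abscissa (strip_hi S l)"
  using element_on_one_side[OF assms] unfolding resolved_abscissa_def by blast+

lemma resolved_abscissa_domain_end: "resolved_abscissa (x_lo S)" "resolved_abscissa (x_hi S)"
  using resolved_abscissa_strip_end(1)[of 1] resolved_abscissa_strip_end(2)[of "num_strips S"] num_strips_pos
  by (simp_all add: first_strip_lo[unfolded One_nat_def] last_strip_hi)

text \<open>If an element lies on the other side of the line, the half-plane cuts it in the part on the line, which
  is a face because the line supports the element.\<close>

lemma resolved_half_planes:
  assumes "resolved_abscissa c"
  shows "resolved S {z. fst z \<le> c}" "resolved S {z. c \<le> fst z}"
proof -
  have "K \<inter> {z. fst z \<le> c} face_of K \<and> K \<inter> {z. c \<le> fst z} face_of K" if K: "K \<in> mesh S" for K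
  proof -
    note conv = element_compact_convex(2)[OF K]
    have line: "{z :: plane. (1, 0) \<bullet> z = c} = {z. fst z = c}" by (simp add: inner_prod_def)
    consider "K \<subseteq> {z. fst z \<le> c}" | "K \<subseteq> {z. c \<le> fst z}"
      using assms K unfolding resolved_abscissa_def by blast
    then show ?thesis
    proof cases
      case 1
      then have "K \<inter> {z. fst z \<le> c} = K" "K \<inter> {z. c \<le> fst z} = K \<inter> {z. (1, 0) \<bullet> z = c}"
        unfolding line by force+
      moreover have "K \<inter> {z. (1, 0) \<bullet> z = c} face_of K"
        by (rule face_of_Int_supporting_hyperplane_le[OF conv]) (use 1 in \<open>auto simp: inner_prod_def\<close>)
      ultimately show ?thesis using face_of_refl[OF conv] by simp
    next
      case 2
      then have "K \<inter> {z. c \<le> fst z} = K" "K \<inter> {z. fst z \<le> c} = K \<inter> {z. (1, 0) \<bullet> z = c}"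
        unfolding line by force+
      moreover have "K \<inter> {z. (1, 0) \<bullet> z = c} face_of K"
        by (rule face_of_Int_supporting_hyperplane_ge[OF conv]) (use 2 in \<open>auto simp: inner_prod_def\<close>)
      ultimately show ?thesis using face_of_refl[OF conv] by simp
    qed
  qed
  then show "resolved S {z. fst z \<le> c}" "resolved S {z. c \<le> fst z}"
    by (auto simp: resolved_def)
qed

lemma resolved_vertical_band:
  assumes "resolved_abscissa a" "resolved_abscissa b"
  shows "resolved S {z. a \<le> fst z \<and> fst z \<le> b}"
  using resolved_Int[OF resolved_half_planes(2)[OF assms(1)] resolved_half_planes(1)[OF assms(2)]]
  by (simp add: Int_def)

lemma pou_zero_on_closure:
  assumes m: "m \<in> {1..num_strips S}" and U: "U \<subseteq> closure (Omega S)" "U \<inter> closure (strip S m) = {}" and z: "z \<in> closure U"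
  shows "pou S m z = 0"
proof -
  have p: "continuous_on (closure (Omega S)) (pou S m)" "closure {x \<in> closure (Omega S). pou S m x \<noteq> 0} \<subseteq> closure (strip S m)"
    using valid m unfolding valid_setting_def partition_of_unity_def by auto
  have "continuous_on (closure U) (pou S m)"
    by (rule continuous_on_subset[OF p(1)]) (simp add: closure_minimal U(1))
  then show ?thesis
  proof (rule continuous_constant_on_closure[OF _ _ z])
    show "pou S m x = 0" if "x \<in> U" for x
      using that U subset_trans[OF closure_subset p(2)] by blast
  qed
qed

text \<open>The line through the side of the strip is included: there continuity of the partition function enters.\<close>

lemma pou_zero_beside_strip:
  assumes m: "m \<in> {1..num_strips S}" and z: "z \<in> closure (Omega S)"
  shows "strip_hi S m \<le> fst z \<Longrightarrow> strip_hi S m < x_hi S \<Longrightarrow> pou S m z = 0"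
    and "fst z \<le> strip_lo S m \<Longrightarrow> x_lo S < strip_lo S m \<Longrightarrow> pou S m z = 0"
proof -
  note b = strip_bounds[OF m]
  show "pou S m z = 0" if "strip_hi S m \<le> fst z" "strip_hi S m < x_hi S"
    by (rule pou_zero_on_closure[OF m, of "band S (strip_hi S m) (x_hi S)"])
       (use z b that y_lo_less in \<open>auto simp: closure_Omega closure_strip[OF m] band_eq closure_Times
           closure_greaterThanLessThan mem_Times_iff\<close>)
  show "pou S m z = 0" if "fst z \<le> strip_lo S m" "x_lo S < strip_lo S m"
    by (rule pou_zero_on_closure[OF m, of "band S (x_lo S) (strip_lo S m)"])
       (use z b that y_lo_less in \<open>auto simp: closure_Omega closure_strip[OF m] band_eq closure_Times
           closure_greaterThanLessThan mem_Times_iff\<close>)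
qed

text \<open>Between the adjacent strips, sides included, all other partition functions vanish.\<close>

lemma pou_eq_1:
  assumes l: "l \<in> {1..num_strips S}" and z: "z \<in> closure (Omega S)"
    and left: "1 < l \<Longrightarrow> strip_hi S (l - 1) \<le> fst z" and right: "l < num_strips S \<Longrightarrow> fst z \<le> strip_lo S (l + 1)"
  shows "pou S l z = 1"
proof -
  have "pou S m z = 0" if m: "m \<in> {1..num_strips S} - {l}" for m
  proof (cases "m < l")
    case True
    have "strip_hi S m \<le> strip_hi S (l - 1)"
      by (rule strip_ends_mono) (use True m l in auto)
    moreover have "strip_hi S (l - 1) < x_hi S"
    proof -
      have "1 \<le> l - 1" "Suc (l - 1) = l" using True m by auto
      then show ?thesis using strip_ends_less_Suc(3)[of "l - 1"] strip_bounds(3)[OF l] l by simp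
    qed
    ultimately show ?thesis using left True m z by (intro pou_zero_beside_strip(1)) auto
  next
    case False
    then have "l < m" using m by auto
    then have "strip_lo S (l + 1) \<le> strip_lo S m"
      by (intro strip_ends_mono) (use m l in auto)
    moreover have "x_lo S < strip_lo S (l + 1)"
      using strip_ends_less_Suc(1)[of l] strip_bounds(1)[OF l] \<open>l < m\<close> m l by auto
    ultimately show ?thesis using right \<open>l < m\<close> m z by (intro pou_zero_beside_strip(2)) auto
  qed
  then have "(\<Sum>m\<in>{1..num_strips S} - {l}. pou S m z) = 0" by (rule sum.neutral[OF ballI])
  moreover have "(\<Sum>m\<in>{1..num_strips S}. pou S m z) = 1"
    using valid z by (simp add: valid_setting_def partition_of_unity_def)
  ultimately show ?thesis using sum.remove[of "{1..num_strips S}" l "\<lambda>m. pou S m z"] l by simp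
qed

end

section \<open>Nodal extensions and local problems\<close>

definition antilinear_on :: "(plane \<Rightarrow> complex) set \<Rightarrow> ((plane \<Rightarrow> complex) \<Rightarrow> complex) \<Rightarrow> bool" where
  "antilinear_on W F \<longleftrightarrow> (\<forall>u\<in>W. \<forall>v\<in>W. \<forall>c. F (\<lambda>x. u x + c * v x) = F u + cnj c * F v)"

context helmholtz_strips
begin

lemma nodes_subset: "nodes S \<subseteq> closure (Omega S)"
  using lagrange_nodes_subset_element unfolding nodes_def Union_mesh[symmetric] by blast

lemma Gamma_subset: "l \<in> {1..num_strips S} \<Longrightarrow> Gamma S l \<subseteq> closure (strip S l)"
  using strip_bounds[of l] by (auto simp: closure_strip Gamma_eq interior_ends_def)

lemma Gamma_side_subset: "Gamma_side S s l \<subseteq> Gamma S l"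
  by (auto simp: Gamma_side_def)

text \<open>The closed strip is the part of the domain between two lines that no element crosses.\<close>

lemma V_space_eq_on_strip:
  assumes l: "l \<in> {1..num_strips S}" and "u \<in> V_space S" "v \<in> V_space S"
    and eq: "\<And>z. z \<in> nodes S \<Longrightarrow> z \<in> closure (strip S l) \<Longrightarrow> u z = v z" and x: "x \<in> closure (strip S l)"
  shows "u x = v x"
proof (rule V_space_eq_on_resolved[OF assms(2,3)])
  show "resolved S {z. strip_lo S l \<le> fst z \<and> fst z \<le> strip_hi S l}"
    by (intro resolved_vertical_band resolved_abscissa_strip_end l)
  show "x \<in> {z. strip_lo S l \<le> fst z \<and> fst z \<le> strip_hi S l}"
    using x by (auto simp: closure_strip[OF l])
  fix z assume "z \<in> nodes S" "z \<in> {z. strip_lo S l \<le> fst z \<and> fst z \<le> strip_hi S l}"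
  moreover from this have "z \<in> closure (strip S l)"
    using nodes_subset by (cases z) (auto simp: closure_strip[OF l] closure_Omega)
  ultimately show "u z = v z" using eq by blast
qed

lemma V_loc_restr: "u \<in> V_space S \<Longrightarrow> restr (closure (strip S l)) u \<in> V_loc S l"
  by (simp add: V_loc_def)

lemma V_locE:
  assumes "v \<in> V_loc S l"
  obtains u where "u \<in> V_space S" "v = restr (closure (strip S l)) u"
  using assms by (auto simp: V_loc_def)

lemma V_loc_eqI:
  assumes l: "l \<in> {1..num_strips S}" and u: "u \<in> V_loc S l" and v: "v \<in> V_loc S l"
    and eq: "\<And>z. z \<in> nodes S \<Longrightarrow> z \<in> closure (strip S l) \<Longrightarrow> u z = v z"
  shows "u = v"
proof -
  obtain u' where u': "u' \<in> V_space S" "u = restr (closure (strip S l)) u'" using V_locE[OF u] .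
  obtain v' where v': "v' \<in> V_space S" "v = restr (closure (strip S l)) v'" using V_locE[OF v] .
  have "u' x = v' x" if "x \<in> closure (strip S l)" for x
    by (rule V_space_eq_on_strip[OF l u'(1) v'(1) _ that]) (use eq u'(2) v'(2) in \<open>auto simp: restr_def\<close>)
  then show ?thesis unfolding u'(2) v'(2) by (auto simp: restr_def fun_eq_iff)
qed

lemma V_loc_add_scaled:
  assumes "u \<in> V_loc S l" "v \<in> V_loc S l"
  shows "(\<lambda>x. u x + c * v x) \<in> V_loc S l"
proof -
  obtain u' where u': "u' \<in> V_space S" "u = restr (closure (strip S l)) u'" using V_locE[OF assms(1)] .
  obtain v' where v': "v' \<in> V_space S" "v = restr (closure (strip S l)) v'" using V_locE[OF assms(2)] .
  have "(\<lambda>x. u x + c * v x) = restr (closure (strip S l)) (\<lambda>x. u' x + c * v' x)"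
    unfolding u'(2) v'(2) by (auto simp: restr_def fun_eq_iff)
  then show ?thesis using V_loc_restr[OF V_space_add_scaled[OF u'(1) v'(1)]] by simp
qed

lemma V_loc_zero: "(\<lambda>x. 0) \<in> V_loc S l"
proof -
  have "(\<lambda>x. 0) = restr (closure (strip S l)) (\<lambda>x. 0)" by (auto simp: restr_def)
  then show ?thesis using V_loc_restr[OF V_space_zero] by metis
qed

lemma nodal_ext_spec:
  shows "nodal_ext S j v \<in> V_space S"
    and "z \<in> nodes S \<Longrightarrow> nodal_ext S j v z = (if z \<in> closure (strip S j) then v z else 0)"
proof -
  let ?P = "\<lambda>u. u \<in> V_space S \<and> (\<forall>z\<in>nodes S. u z = (if z \<in> closure (strip S j) then v z else 0))"
  obtain u where u: "?P u"
    using nodal_function_exists[of "\<lambda>z. if z \<in> closure (strip S j) then v z else 0"] by blast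
  have "?P (THE u. ?P u)"
  proof (rule theI[of ?P, OF u])
    show "u' = u" if "?P u'" for u'
      by (rule V_space_eq_if_nodes_eq) (use that u in auto)
  qed
  then show "nodal_ext S j v \<in> V_space S"
    "z \<in> nodes S \<Longrightarrow> nodal_ext S j v z = (if z \<in> closure (strip S j) then v z else 0)"
    unfolding nodal_ext_def by blast+
qed

lemma nodal_ext_on_strip:
  assumes j: "j \<in> {1..num_strips S}" and v: "v \<in> V_loc S j" and x: "x \<in> closure (strip S j)"
  shows "nodal_ext S j v x = v x"
proof -
  obtain v' where v': "v' \<in> V_space S" "v = restr (closure (strip S j)) v'" using V_locE[OF v] .
  have "nodal_ext S j v x = v' x"
    by (rule V_space_eq_on_strip[OF j nodal_ext_spec(1) v'(1) _ x]) (simp add: nodal_ext_spec(2) v'(2) restr_def)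
  then show ?thesis using x by (simp add: v'(2) restr_def)
qed

lemma nodal_ext_add_scaled:
  "nodal_ext S j (\<lambda>x. u x + c * v x) = (\<lambda>x. nodal_ext S j u x + c * nodal_ext S j v x)"
  by (rule V_space_eq_if_nodes_eq) (auto intro: nodal_ext_spec V_space_add_scaled simp: nodal_ext_spec(2))

lemma local_nodal_function:
  assumes j: "j \<in> {1..num_strips S}"
  shows "\<exists>!u. u \<in> V_loc S j \<and> (\<forall>z\<in>nodes S \<inter> closure (strip S j). u z = f z)"
proof -
  obtain u where u: "u \<in> V_space S" "\<And>z. z \<in> nodes S \<Longrightarrow> u z = f z"
    using nodal_function_exists[of f] by blast
  show ?thesis
  proof (rule ex1I[of _ "restr (closure (strip S j)) u"])
    show "restr (closure (strip S j)) u \<in> V_loc S j \<and> (\<forall>z\<in>nodes S \<inter> closure (strip S j). restr (closure (strip S j)) u z = f z)"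
      using V_loc_restr[OF u(1)] u(2) by (auto simp: restr_def)
    show "u' = restr (closure (strip S j)) u"
      if "u' \<in> V_loc S j \<and> (\<forall>z\<in>nodes S \<inter> closure (strip S j). u' z = f z)" for u'
      by (rule V_loc_eqI[OF j _ V_loc_restr[OF u(1)]]) (use that u(2) in \<open>auto simp: restr_def\<close>)
  qed
qed

lemma nodal_interp_spec:
  assumes "j \<in> {1..num_strips S}"
  shows "nodal_interp S j f \<in> V_loc S j"
    and "z \<in> nodes S \<Longrightarrow> z \<in> closure (strip S j) \<Longrightarrow> nodal_interp S j f z = f z"
  using theI'[OF local_nodal_function[OF assms, of f]] unfolding nodal_interp_def by blast+

lemma hat_spec:
  assumes "j \<in> {1..num_strips S}"
  shows "hat S t j v \<in> V_loc S j"
    and "z \<in> nodes S \<Longrightarrow> z \<in> closure (strip S j) \<Longrightarrow> hat S t j v z = (if z \<in> Gamma_side S t j then v z else 0)"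
  using theI'[OF local_nodal_function[OF assms, of "\<lambda>z. if z \<in> Gamma_side S t j then v z else 0"]]
  unfolding hat_def by blast+

lemma weighted_ext_spec:
  assumes "l \<in> {1..num_strips S}"
  shows "weighted_ext S l w \<in> V_space S"
    and "z \<in> nodes S \<Longrightarrow> z \<in> closure (strip S l) \<Longrightarrow> weighted_ext S l w z = of_real (pou S l z) * w z"
  by (simp_all add: weighted_ext_def nodal_ext_spec nodal_interp_spec[OF assms])

lemma form_strip_cong:
  assumes "\<And>z. z \<in> closure (strip S l) \<Longrightarrow> u z = u' z" "\<And>z. z \<in> closure (strip S l) \<Longrightarrow> v z = v' z"
  shows "form S (strip S l) u v = form S (strip S l) u' v'"
  by (rule helmholtz_form_cong) (use assms in \<open>auto simp: strip_def open_box\<close>)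

lemma form_strip_antilinear:
  assumes l: "l \<in> {1..num_strips S}" and u: "u \<in> V_space S"
  shows "antilinear_on (V_loc S l) (form S (strip S l) u)"
  unfolding antilinear_on_def
proof (intro ballI allI)
  fix v w c assume v: "v \<in> V_loc S l" and w: "w \<in> V_loc S l"
  obtain v' where v': "v' \<in> V_space S" "v = restr (closure (strip S l)) v'" using V_locE[OF v] .
  obtain w' where w': "w' \<in> V_space S" "w = restr (closure (strip S l)) w'" using V_locE[OF w] .
  note b = strip_bounds[OF l]
  have "form S (strip S l) u (\<lambda>x. v x + c * w x) = form S (strip S l) u (\<lambda>x. v' x + c * w' x)"
    by (rule form_strip_cong) (simp_all add: v'(2) w'(2) restr_def)
  also have "\<dots> = form S (strip S l) u v' + cnj c * form S (strip S l) u w'"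
    unfolding strip_eq_band by (rule form_band_add_scaled[OF b u v'(1) w'(1)])
  also have "form S (strip S l) u v' = form S (strip S l) u v"
    by (rule form_strip_cong) (simp_all add: v'(2) restr_def)
  also have "form S (strip S l) u w' = form S (strip S l) u w"
    by (rule form_strip_cong) (simp_all add: w'(2) restr_def)
  finally show "form S (strip S l) u (\<lambda>x. v x + c * w x) = form S (strip S l) u v + cnj c * form S (strip S l) u w" .
qed

lemma Omega_eq_band: "Omega S = band S (x_lo S) (x_hi S)"
  by (simp add: Omega_def band_def)

lemma b_form_antilinear:
  assumes j: "j \<in> {1..num_strips S}" and u: "u \<in> V_space S"
  shows "antilinear_on (V_loc S j) (b_form S j u)"
  unfolding antilinear_on_def
proof (intro ballI allI)
  fix v w c assume v: "v \<in> V_loc S j" and w: "w \<in> V_loc S j"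
  have "form S (strip S j) u (\<lambda>x. v x + c * w x) = form S (strip S j) u v + cnj c * form S (strip S j) u w"
    using form_strip_antilinear[OF j u] v w unfolding antilinear_on_def by blast
  moreover have "form S (Omega S) u (nodal_ext S j (\<lambda>x. v x + c * w x)) =
      form S (Omega S) u (nodal_ext S j v) + cnj c * form S (Omega S) u (nodal_ext S j w)"
    unfolding nodal_ext_add_scaled Omega_eq_band
    by (rule form_band_add_scaled[OF order_refl x_lo_less order_refl u nodal_ext_spec(1) nodal_ext_spec(1)])
  ultimately show "b_form S j u (\<lambda>x. v x + c * w x) = b_form S j u v + cnj c * b_form S j u w"
    by (simp add: b_form_def algebra_simps)
qed

lemma local_problem_unique_solution:
  assumes inv: "locally_invertible S l" and F: "antilinear_on (V_loc S l) F"
  shows "\<exists>!u. u \<in> V_loc S l \<and> (\<forall>v\<in>V_loc S l. form S (strip S l) u v = F v)"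
proof -
  let ?A = "\<lambda>w. restrict (form S (strip S l) w) (V_loc S l)"
  have bij: "bij_betw ?A (V_loc S l) (antidual (V_loc S l))" using inv by (simp add: locally_invertible_def)
  have F': "F (\<lambda>x. u x + c * v x) = F u + cnj c * F v" if "u \<in> V_loc S l" "v \<in> V_loc S l" for u v c
    using F that unfolding antilinear_on_def by blast
  have add: "F (\<lambda>x. u x + v x) = F u + F v" if "u \<in> V_loc S l" "v \<in> V_loc S l" for u v
    using F'[OF that, of 1] by simp
  have zero: "F (\<lambda>x. 0) = 0" using add[OF V_loc_zero V_loc_zero] by simp
  have scale: "F (\<lambda>x. c * v x) = cnj c * F v" if "v \<in> V_loc S l" for v c
    using F'[OF V_loc_zero that, of c] zero by simp
  have cl: "(\<lambda>x. u x + v x) \<in> V_loc S l" "(\<lambda>x. c * v x) \<in> V_loc S l" if "u \<in> V_loc S l" "v \<in> V_loc S l" for u v c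
    using V_loc_add_scaled[OF that, of 1] V_loc_add_scaled[OF V_loc_zero that(2), of c] by simp_all
  have "restrict F (V_loc S l) \<in> antidual (V_loc S l)"
    unfolding antidual_def using add scale cl by auto
  then obtain u where u: "u \<in> V_loc S l" "?A u = restrict F (V_loc S l)"
    using bij unfolding bij_betw_def by (metis (no_types, lifting) imageE)
  show ?thesis
  proof (rule ex1I[of _ u])
    show "u \<in> V_loc S l \<and> (\<forall>v\<in>V_loc S l. form S (strip S l) u v = F v)"
    proof (intro conjI ballI u(1))
      show "form S (strip S l) u v = F v" if "v \<in> V_loc S l" for v
        using fun_cong[OF u(2), of v] that by simp
    qed
    fix u' assume u': "u' \<in> V_loc S l \<and> (\<forall>v\<in>V_loc S l. form S (strip S l) u' v = F v)"
    then have "?A u' = ?A u" unfolding u(2) by (auto simp: restrict_def)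
    then show "u' = u" using bij u(1) u' unfolding bij_betw_def inj_on_def by blast
  qed
qed

lemma T_op_spec:
  assumes j: "j \<in> {1..num_strips S}" and l: "l \<in> {1..num_strips S}" and inv: "locally_invertible S j"
  shows "T_op S j l w \<in> V_loc S j"
    and "v \<in> V_loc S j \<Longrightarrow> form S (strip S j) (T_op S j l w) v = b_form S j (weighted_ext S l w) v"
  using theI'[OF local_problem_unique_solution[OF inv b_form_antilinear[OF j weighted_ext_spec(1)[OF l, of w]]]]
  unfolding T_op_def by blast+

lemma V_trace_restr: "u \<in> V_space S \<Longrightarrow> restr \<Gamma> u \<in> V_trace S \<Gamma>"
  by (simp add: V_trace_def)

lemma V_traceE:
  assumes "v \<in> V_trace S \<Gamma>"
  obtains u where "u \<in> V_space S" "v = restr \<Gamma> u"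
  using assms by (auto simp: V_trace_def)

lemma V_trace_eqI:
  assumes X: "finite X" "X \<subseteq> {x_lo S..x_hi S}" and \<Gamma>: "\<Gamma> = X \<times> {y_lo S..y_hi S}"
    and g: "g \<in> V_trace S \<Gamma>" and h: "h \<in> V_trace S \<Gamma>"
    and eq: "\<And>v. v \<in> V_space S \<Longrightarrow> inner_on \<Gamma> g v = inner_on \<Gamma> h v"
  shows "g = h"
proof -
  obtain g' where g': "g' \<in> V_space S" "g = restr \<Gamma> g'" using V_traceE[OF g] .
  obtain h' where h': "h' \<in> V_space S" "h = restr \<Gamma> h'" using V_traceE[OF h] .
  have "g' z = h' z" if "z \<in> \<Gamma>" for z
  proof (rule trace_eqI[OF X g'(1) h'(1) _ that[unfolded \<Gamma>]])
    fix v assume v: "v \<in> V_space S"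
    have "inner_on \<Gamma> g' v = inner_on \<Gamma> g v" "inner_on \<Gamma> h' v = inner_on \<Gamma> h v"
      by (rule inner_on_cong; simp add: g'(2) h'(2) restr_def)+
    then show "inner_on (X \<times> {y_lo S..y_hi S}) g' v = inner_on (X \<times> {y_lo S..y_hi S}) h' v"
      using eq[OF v] by (simp add: \<Gamma>)
  qed
  then show ?thesis unfolding g'(2) h'(2) by (auto simp: restr_def fun_eq_iff)
qed

text \<open>The assumption says that the functional to be represented depends only on the trace on the interface.\<close>

lemma imp_spec:
  assumes l: "l \<in> {1..num_strips S}" and w: "w \<in> V_loc S l"
    and trace: "\<And>v. v \<in> V_loc S l \<Longrightarrow> (\<And>z. z \<in> Gamma S l \<Longrightarrow> v z = 0) \<Longrightarrow> form S (strip S l) w v = 0"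
  shows "imp S l w \<in> V_trace S (Gamma S l)"
    and "v \<in> V_loc S l \<Longrightarrow> inner_on (Gamma S l) (imp S l w) v = form S (strip S l) w v"
proof -
  let ?\<Gamma> = "Gamma S l" and ?R = "restr (closure (strip S l))"
  note X = interior_ends_subset[OF l]
  note \<Gamma> = Gamma_eq[OF l]
  obtain w' where w': "w' \<in> V_space S" "w = ?R w'" using V_locE[OF w] .
  have ww': "form S (strip S l) w v = form S (strip S l) w' v" for v
    by (rule form_strip_cong) (simp_all add: w'(2) restr_def)
  have R: "?R (\<lambda>x. u x + c * v x) = (\<lambda>x. ?R u x + c * ?R v x)" for u v c
    by (auto simp: restr_def fun_eq_iff)
  have "\<exists>g\<in>V_space S. \<forall>v\<in>V_space S. inner_on (interior_ends l \<times> {y_lo S..y_hi S}) g v = form S (strip S l) w (?R v)"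
  proof (rule trace_riesz_representation[OF X])
    show "form S (strip S l) w (?R (\<lambda>x. u x + c * v x)) = form S (strip S l) w (?R u) + cnj c * form S (strip S l) w (?R v)"
      if "u \<in> V_space S" "v \<in> V_space S" for u v c
      unfolding R ww' using form_strip_antilinear[OF l w'(1)] V_loc_restr[OF that(1)] V_loc_restr[OF that(2)]
      unfolding antilinear_on_def by blast
    show "form S (strip S l) w (?R u) = 0"
      if "u \<in> V_space S" "\<And>z. z \<in> interior_ends l \<times> {y_lo S..y_hi S} \<Longrightarrow> u z = 0" for u
      by (rule trace[OF V_loc_restr[OF that(1)]]) (use that(2) in \<open>auto simp: restr_def \<Gamma>\<close>)
  qed
  then obtain g where g: "g \<in> V_space S" "\<And>v. v \<in> V_space S \<Longrightarrow> inner_on ?\<Gamma> g v = form S (strip S l) w (?R v)"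
    unfolding \<Gamma> by blast
  let ?P = "\<lambda>g. g \<in> V_trace S ?\<Gamma> \<and> (\<forall>v\<in>V_loc S l. inner_on ?\<Gamma> g v = form S (strip S l) w v)"
  have "?P (restr ?\<Gamma> g)"
  proof (intro conjI ballI V_trace_restr g(1))
    fix v assume v: "v \<in> V_loc S l"
    obtain v' where v': "v' \<in> V_space S" "v = ?R v'" using V_locE[OF v] .
    have "inner_on ?\<Gamma> (restr ?\<Gamma> g) v = inner_on ?\<Gamma> g v'"
      by (rule inner_on_cong) (use Gamma_subset[OF l] v'(2) in \<open>auto simp: restr_def\<close>)
    then show "inner_on ?\<Gamma> (restr ?\<Gamma> g) v = form S (strip S l) w v"
      using g(2)[OF v'(1)] by (simp add: v'(2))
  qed
  moreover have "h = h'" if h: "?P h" "?P h'" for h h'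
  proof (rule V_trace_eqI[OF X \<Gamma>])
    show "h \<in> V_trace S ?\<Gamma>" "h' \<in> V_trace S ?\<Gamma>" using h by auto
    fix v assume v: "v \<in> V_space S"
    have "inner_on ?\<Gamma> k v = inner_on ?\<Gamma> k (?R v)" for k
      by (rule inner_on_cong) (use Gamma_subset[OF l] in \<open>auto simp: restr_def\<close>)
    then show "inner_on ?\<Gamma> h v = inner_on ?\<Gamma> h' v"
      using h V_loc_restr[OF v] by metis
  qed
  ultimately have "?P (imp S l w)"
    unfolding imp_def by (intro theI[of ?P "restr ?\<Gamma> g"]) blast+
  then show "imp S l w \<in> V_trace S (Gamma S l)"
    "v \<in> V_loc S l \<Longrightarrow> inner_on (Gamma S l) (imp S l w) v = form S (strip S l) w v"
    by blast+
qed

end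

section \<open>Impedance data of the transfer operator\<close>

lemma antilinear_onD:
  "antilinear_on W F \<Longrightarrow> u \<in> W \<Longrightarrow> v \<in> W \<Longrightarrow> F (\<lambda>x. u x + c * v x) = F u + cnj c * F v"
  by (simp add: antilinear_on_def)

context helmholtz_strips
begin

lemma zero_beyond_abscissa:
  assumes R: "R \<in> V_space S" and c: "resolved_abscissa c"
  shows "(\<And>z. z \<in> nodes S \<Longrightarrow> fst z \<le> c \<Longrightarrow> R z = 0) \<Longrightarrow> fst x \<le> c \<Longrightarrow> R x = 0"
    and "(\<And>z. z \<in> nodes S \<Longrightarrow> c \<le> fst z \<Longrightarrow> R z = 0) \<Longrightarrow> c \<le> fst x \<Longrightarrow> R x = 0"
  using V_space_zero_on_resolved[OF R resolved_half_planes(1)[OF c], of x]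
    V_space_zero_on_resolved[OF R resolved_half_planes(2)[OF c], of x] by auto

text \<open>The strip \<open>j\<close> is the left neighbour of \<open>j + 1\<close>, and all nonzero nodal values of \<open>R\<close> are on the
  right side of the strip \<open>j\<close>. So \<open>R\<close> vanishes on the left side of the strip \<open>j\<close> and beyond it, and on and
  beyond any line \<open>c\<close> to the right of the interface that no element crosses. In both differences only the band between the
  interface and \<open>c\<close> and the integral over the interface survive.\<close>

lemma form_defect_right_interface:
  assumes j: "1 \<le> j" "Suc j \<le> num_strips S"
    and V: "u \<in> V_space S" "w \<in> V_space S" "R \<in> V_space S"
    and R: "\<And>z. z \<in> nodes S \<Longrightarrow> fst z \<noteq> strip_hi S j \<Longrightarrow> R z = 0"
    and c: "strip_hi S j < c" "c \<le> strip_hi S (Suc j)" "resolved_abscissa c"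
    and eq: "\<And>z. strip_hi S j \<le> fst z \<Longrightarrow> fst z \<le> c \<Longrightarrow> u z = w z"
  shows "form S (strip S j) u R - form S (Omega S) u R =
    form S (strip S (Suc j) \<inter> strip S j) w R - form S (strip S (Suc j)) w R"
proof -
  let ?l = "Suc j"
  have jN: "j \<in> {1..num_strips S}" and lN: "?l \<in> {1..num_strips S}" using j by auto
  note bj = strip_bounds[OF jN] and bl = strip_bounds[OF lN] and ord = strip_ends_less_Suc[OF j]
  have Rl: "R x = 0" if "fst x \<le> strip_lo S j" for x
    by (rule zero_beyond_abscissa(1)[OF V(3) resolved_abscissa_strip_end(1)[OF jN] _ that]) (use R bj in auto)
  have Rr: "R x = 0" if "c \<le> fst x" for x
    by (rule zero_beyond_abscissa(2)[OF V(3) c(3) _ that]) (use R c in auto)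
  have s0: "side_integral S x v R = 0" if "x \<le> strip_lo S j \<or> c \<le> x" for x v
    using that Rl Rr by (intro side_integral_zero) auto
  have bulk: "bulk S (strip_hi S j) b v R = bulk S (strip_hi S j) c v R"
    if "c \<le> b" "b \<le> x_hi S" "v \<in> V_space S" for b v
    using bulk_split[of "strip_hi S j" c b v R] bulk_zero[of c b v R] that c bj bl V Rr by auto
  have inter: "strip S ?l \<inter> strip S j = band S (strip_lo S ?l) (strip_hi S j)"
    unfolding strip_eq_band band_eq using ord by auto
  have "bulk S (x_lo S) (strip_lo S j) u R = 0"
    using bulk_zero[of "x_lo S" "strip_lo S j" u R] bj V Rl by auto
  then have left: "form S (strip S j) u R - form S (Omega S) u R =
      - bulk S (strip_hi S j) c u R - \<i> * of_real (wavenumber S) * side_integral S (strip_hi S j) u R"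
    using form_band_difference[OF order_refl bj order_refl V(1,3)] bulk[of "x_hi S" u] bj c bl V
    by (simp add: strip_eq_band Omega_eq_band s0)
  have right: "form S (strip S ?l \<inter> strip S j) w R - form S (strip S ?l) w R =
      - bulk S (strip_hi S j) c w R - \<i> * of_real (wavenumber S) * side_integral S (strip_hi S j) w R"
    using form_band_difference[OF bl(1) order_refl ord(2) less_imp_le[OF ord(3)] bl(3) V(2,3)] bulk[of "strip_hi S ?l" w] c bl V
    unfolding inter by (simp add: strip_eq_band s0 bulk_degenerate)
  have "bulk S (strip_hi S j) c u R = bulk S (strip_hi S j) c w R"
    by (rule bulk_cong) (use bj c bl V eq in auto)
  moreover have "side_integral S (strip_hi S j) u R = side_integral S (strip_hi S j) w R"
    by (rule side_integral_cong) (use c eq in auto)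
  ultimately show ?thesis unfolding left right by simp
qed

text \<open>The mirror image of \<open>form_defect_right_interface\<close>, for the right neighbour \<open>l + 1\<close> of the strip \<open>l\<close>.\<close>

lemma form_defect_left_interface:
  assumes l: "1 \<le> l" "Suc l \<le> num_strips S"
    and V: "u \<in> V_space S" "w \<in> V_space S" "R \<in> V_space S"
    and R: "\<And>z. z \<in> nodes S \<Longrightarrow> fst z \<noteq> strip_lo S (Suc l) \<Longrightarrow> R z = 0"
    and c: "c < strip_lo S (Suc l)" "strip_lo S l \<le> c" "resolved_abscissa c"
    and eq: "\<And>z. c \<le> fst z \<Longrightarrow> fst z \<le> strip_lo S (Suc l) \<Longrightarrow> u z = w z"
  shows "form S (strip S (Suc l)) u R - form S (Omega S) u R =
    form S (strip S l \<inter> strip S (Suc l)) w R - form S (strip S l) w R"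
proof -
  let ?j = "Suc l"
  have lN: "l \<in> {1..num_strips S}" and jN: "?j \<in> {1..num_strips S}" using l by auto
  note bj = strip_bounds[OF jN] and bl = strip_bounds[OF lN] and ord = strip_ends_less_Suc[OF l]
  have Rr: "R x = 0" if "strip_hi S ?j \<le> fst x" for x
    by (rule zero_beyond_abscissa(2)[OF V(3) resolved_abscissa_strip_end(2)[OF jN] _ that]) (use R bj in auto)
  have Rl: "R x = 0" if "fst x \<le> c" for x
    by (rule zero_beyond_abscissa(1)[OF V(3) c(3) _ that]) (use R c in auto)
  have s0: "side_integral S x v R = 0" if "strip_hi S ?j \<le> x \<or> x \<le> c" for x v
    using that Rl Rr by (intro side_integral_zero) auto
  have bulk: "bulk S b (strip_lo S ?j) v R = bulk S c (strip_lo S ?j) v R"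
    if "b \<le> c" "x_lo S \<le> b" "v \<in> V_space S" for b v
    using bulk_split[of b c "strip_lo S ?j" v R] bulk_zero[of b c v R] that c bj bl V Rl by auto
  have inter: "strip S l \<inter> strip S ?j = band S (strip_lo S ?j) (strip_hi S l)"
    unfolding strip_eq_band band_eq using ord by auto
  have "bulk S (strip_hi S ?j) (x_hi S) u R = 0"
    using bulk_zero[of "strip_hi S ?j" "x_hi S" u R] bj V Rr by auto
  then have left: "form S (strip S ?j) u R - form S (Omega S) u R =
      - bulk S c (strip_lo S ?j) u R - \<i> * of_real (wavenumber S) * side_integral S (strip_lo S ?j) u R"
    using form_band_difference[OF order_refl bj order_refl V(1,3)] bulk[of "x_lo S" u] bj c bl V
    by (simp add: strip_eq_band Omega_eq_band s0)
  have right: "form S (strip S l \<inter> strip S ?j) w R - form S (strip S l) w R =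
      - bulk S c (strip_lo S ?j) w R - \<i> * of_real (wavenumber S) * side_integral S (strip_lo S ?j) w R"
    using form_band_difference[OF bl(1) less_imp_le[OF ord(1)] ord(2) order_refl bl(3) V(2,3)] bulk[of "strip_lo S l" w] c bl V
    unfolding inter by (simp add: strip_eq_band s0 bulk_degenerate)
  have "bulk S c (strip_lo S ?j) u R = bulk S c (strip_lo S ?j) w R"
    by (rule bulk_cong) (use bj c bl V eq in auto)
  moreover have "side_integral S (strip_lo S ?j) u R = side_integral S (strip_lo S ?j) w R"
    by (rule side_integral_cong) (use c eq in auto)
  ultimately show ?thesis unfolding left right by simp
qed

text \<open>The strip \<open>l\<close> alone covers the region between \<open>a\<close> and \<open>b\<close>. Its partition function is \<open>1\<close> at all nodes
  there, and the region is bounded by lines that no element crosses, so these nodes determine both sides.\<close>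

lemma weighted_ext_on_core:
  assumes l: "l \<in> {1..num_strips S}" and w: "w \<in> V_space S" "w' = restr (closure (strip S l)) w"
    and a: "resolved_abscissa a" "strip_lo S l \<le> a" "1 < l \<Longrightarrow> strip_hi S (l - 1) \<le> a"
    and b: "resolved_abscissa b" "b \<le> strip_hi S l" "l < num_strips S \<Longrightarrow> b \<le> strip_lo S (l + 1)"
    and x: "a \<le> fst x" "fst x \<le> b"
  shows "weighted_ext S l w' x = w x"
proof (rule V_space_eq_on_resolved[OF weighted_ext_spec(1)[OF l] w(1) resolved_vertical_band[OF a(1) b(1)]])
  show "x \<in> {z. a \<le> fst z \<and> fst z \<le> b}" using x by simp
  fix z assume z: "z \<in> nodes S" "z \<in> {z. a \<le> fst z \<and> fst z \<le> b}"
  then have zO: "z \<in> closure (Omega S)" using nodes_subset by blast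
  then have "z \<in> closure (strip S l)"
    using z a b by (cases z) (auto simp: closure_strip[OF l] closure_Omega)
  moreover have "pou S l z = 1" by (rule pou_eq_1[OF l zO]) (use z a b in auto)
  ultimately show "weighted_ext S l w' z = w z"
    using weighted_ext_spec(2)[OF l z(1)] by (simp add: w(2) restr_def)
qed

text \<open>Replace \<open>v\<close> by its extension and \<open>w\<close> by a representative on the whole domain; then this is one of the two
  form defects, with \<open>c\<close> the facing side of the strip beyond \<open>l\<close>.\<close>

lemma b_form_interface:
  assumes l: "l \<in> {1..num_strips S}" and j: "j \<in> {1..num_strips S}"
    and jt: "(j, t) \<in> {(l - 1, Plus), (l + 1, Minus)}"
    and w: "w \<in> V_loc S l" and v: "v \<in> V_loc S j"
    and nodes0: "\<And>z. z \<in> nodes S \<Longrightarrow> z \<in> closure (strip S j) \<Longrightarrow> fst z \<noteq> strip_end S t j \<Longrightarrow> v z = 0"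
  shows "b_form S j (weighted_ext S l w) v =
    form S (strip S l \<inter> strip S j) w v - form S (strip S l) w (nodal_ext S j v)"
proof -
  let ?R = "nodal_ext S j v" and ?u = "weighted_ext S l w"
  obtain w' where w': "w' \<in> V_space S" "w = restr (closure (strip S l)) w'" using V_locE[OF w] .
  have R: "?R \<in> V_space S" and u: "?u \<in> V_space S" by (rule nodal_ext_spec weighted_ext_spec[OF l])+
  have R0: "?R z = 0" if "z \<in> nodes S" "fst z \<noteq> strip_end S t j" for z
    using nodes0 that by (simp add: nodal_ext_spec(2))
  have Rv: "?R z = v z" if "z \<in> closure (strip S j)" for z
    by (rule nodal_ext_on_strip[OF j v that])
  have "form S (strip S j) ?u ?R - form S (Omega S) ?u ?R =
      form S (strip S l \<inter> strip S j) w' ?R - form S (strip S l) w' ?R"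
  proof (cases t)
    case Plus
    then have jl: "l = Suc j" "1 \<le> j" "Suc j \<le> num_strips S" using jt l j by auto
    \<comment> \<open>For the last strip there is no further neighbour, and \<open>c\<close> is the boundary of the domain.\<close>
    define c where "c = (if Suc j = num_strips S then x_hi S else strip_lo S (Suc (Suc j)))"
    have c: "strip_hi S j < c" "c \<le> strip_hi S (Suc j)" "resolved_abscissa c" "l < num_strips S \<Longrightarrow> c \<le> strip_lo S (l + 1)"
    proof -
      show "strip_hi S j < c"
        using strip_ends_less_Suc(3)[OF jl(2,3)] strip_bounds(3)[OF l] strips_separated[of j "Suc (Suc j)"] jl
        by (auto simp: c_def)
      show "c \<le> strip_hi S (Suc j)"
        using strip_ends_less_Suc(2)[of "Suc j"] jl last_strip_hi by (auto simp: c_def less_imp_le)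
      show "resolved_abscissa c"
        using resolved_abscissa_domain_end(2) resolved_abscissa_strip_end(1)[of "Suc (Suc j)"] jl by (auto simp: c_def)
      show "l < num_strips S \<Longrightarrow> c \<le> strip_lo S (l + 1)" using jl by (simp add: c_def)
    qed
    have "?u z = w' z" if "strip_hi S j \<le> fst z" "fst z \<le> c" for z
      by (rule weighted_ext_on_core[OF l w', where a = "strip_hi S j" and b = c])
         (use that c jl strip_ends_less_Suc(2)[OF jl(2,3)] resolved_abscissa_strip_end(2)[OF j] in auto)
    then show ?thesis
      unfolding jl(1) using form_defect_right_interface[OF jl(2,3) u w'(1) R _ c(1-3)] R0 Plus jl(1) by simp
  next
    case Minus
    then have jl: "j = Suc l" "1 \<le> l" "Suc l \<le> num_strips S" using jt l j by auto
    define c where "c = (if l = 1 then x_lo S else strip_hi S (l - 1))"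
    have c: "c < strip_lo S (Suc l)" "strip_lo S l \<le> c" "resolved_abscissa c" "1 < l \<Longrightarrow> strip_hi S (l - 1) \<le> c"
    proof -
      show "c < strip_lo S (Suc l)"
        using strip_ends_less_Suc(1)[OF jl(2,3)] strip_bounds(1)[OF l] strips_separated[of "l - 1" "Suc l"] jl
        by (auto simp: c_def)
      show "strip_lo S l \<le> c"
      proof (cases "l = 1")
        case False
        then have "1 \<le> l - 1" "Suc (l - 1) = l" using jl(2) by auto
        then show ?thesis using strip_ends_less_Suc(2)[of "l - 1"] jl False by (simp add: c_def)
      qed (simp add: c_def first_strip_lo[unfolded One_nat_def])
      show "resolved_abscissa c"
      proof (cases "l = 1")
        case False
        then have "l - 1 \<in> {1..num_strips S}" using jl by auto
        then show ?thesis using resolved_abscissa_strip_end(2) False by (simp add: c_def)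
      qed (simp add: c_def resolved_abscissa_domain_end(1))
      show "1 < l \<Longrightarrow> strip_hi S (l - 1) \<le> c" using jl by (simp add: c_def)
    qed
    have "?u z = w' z" if "c \<le> fst z" "fst z \<le> strip_lo S (Suc l)" for z
      by (rule weighted_ext_on_core[OF l w', where a = c and b = "strip_lo S (Suc l)"])
         (use that c jl strip_ends_less_Suc(2)[OF jl(2,3)] resolved_abscissa_strip_end(1)[OF j] in auto)
    then show ?thesis
      unfolding jl(1) using form_defect_left_interface[OF jl(2,3) u w'(1) R[unfolded jl(1)] _ c(1-3)] R0[unfolded jl(1)] Minus by simp
  qed
  moreover have "form S (strip S j) ?u v = form S (strip S j) ?u ?R"
    by (rule form_strip_cong) (simp_all add: Rv)
  moreover have "form S (strip S l) w ?R = form S (strip S l) w' ?R"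
    by (rule form_strip_cong) (simp_all add: w'(2) restr_def)
  moreover have "form S (strip S l \<inter> strip S j) w v = form S (strip S l \<inter> strip S j) w' ?R"
  proof (rule helmholtz_form_cong)
    show "open (strip S l \<inter> strip S j)" by (simp add: strip_def open_box open_Int)
    fix z assume "z \<in> closure (strip S l \<inter> strip S j)"
    then have "z \<in> closure (strip S l)" "z \<in> closure (strip S j)"
      using closure_mono[of "strip S l \<inter> strip S j"] by blast+
    then show "w z = w' z" "v z = ?R z" by (simp_all add: w'(2) restr_def Rv)
  qed
  ultimately show ?thesis by (simp add: b_form_def)
qed

text \<open>\<open>T w\<close> satisfies the homogeneous interior equations, hence has impedance data.\<close>

text \<open>The zero extension of \<open>v\<close> vanishes outside the strip, since \<open>v\<close> vanishes on the interfaces. So the forms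
  of the strip and of the domain give the same value, and the right-hand side of the local problem is
  zero. A side of the strip on the boundary of the domain is shared by both, and \<open>v\<close> need not vanish
  there.\<close>

lemma T_op_trace:
  assumes j: "j \<in> {1..num_strips S}" and l: "l \<in> {1..num_strips S}" and inv: "locally_invertible S j"
    and v: "v \<in> V_loc S j" and v0: "\<And>z. z \<in> Gamma S j \<Longrightarrow> v z = 0"
  shows "form S (strip S j) (T_op S j l w) v = 0"
proof -
  let ?R = "nodal_ext S j v" and ?u = "weighted_ext S l w"
  let ?a = "strip_lo S j" and ?b = "strip_hi S j"
  note b = strip_bounds[OF j]
  have V: "?u \<in> V_space S" "?R \<in> V_space S" by (rule nodal_ext_spec weighted_ext_spec[OF l])+
  have Rv: "?R z = v z" if "z \<in> closure (strip S j)" for z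
    by (rule nodal_ext_on_strip[OF j v that])
  have nodes0: "?R z = 0" if z: "z \<in> nodes S" and "fst z \<notin> {?a<..<?b}" and end0: "fst z \<in> {?a, ?b} \<Longrightarrow> fst z \<notin> {x_lo S, x_hi S}" for z
  proof (cases "z \<in> closure (strip S j)")
    case True
    then have "fst z \<in> {?a, ?b}" "snd z \<in> {y_lo S..y_hi S}"
      using that(2) by (auto simp: closure_strip[OF j])
    then have "z \<in> Gamma S j" using end0 by (cases z) (auto simp: Gamma_eq[OF j] interior_ends_def)
    then show ?thesis using v0 Rv[OF True] by simp
  next
    case False
    then show ?thesis using z by (simp add: nodal_ext_spec(2))
  qed
  have left: "?R x = 0" if "x_lo S < ?a" "fst x \<le> ?a" for x
    by (rule zero_beyond_abscissa(1)[OF V(2) resolved_abscissa_strip_end(1)[OF j] _ that(2)])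
       (use nodes0 that(1) b in force)
  have right: "?R x = 0" if "?b < x_hi S" "?b \<le> fst x" for x
    by (rule zero_beyond_abscissa(2)[OF V(2) resolved_abscissa_strip_end(2)[OF j] _ that(2)])
       (use nodes0 that(1) b in force)
  have L: "bulk S (x_lo S) ?a ?u ?R = 0 \<and> side_integral S ?a ?u ?R = side_integral S (x_lo S) ?u ?R"
  proof (cases "x_lo S = ?a")
    case False
    then have "side_integral S c ?u ?R = 0" if "c \<le> ?a" for c
      using b left that by (intro side_integral_zero) auto
    then show ?thesis using False b V left bulk_zero[of "x_lo S" ?a ?u ?R] by simp
  qed (simp add: bulk_degenerate)
  have Rt: "bulk S ?b (x_hi S) ?u ?R = 0 \<and> side_integral S ?b ?u ?R = side_integral S (x_hi S) ?u ?R"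
  proof (cases "x_hi S = ?b")
    case False
    then have "side_integral S c ?u ?R = 0" if "?b \<le> c" for c
      using b right that by (intro side_integral_zero) auto
    then show ?thesis using False b V right bulk_zero[of ?b "x_hi S" ?u ?R] by simp
  qed (simp add: bulk_degenerate)
  have "form S (strip S j) ?u ?R = form S (Omega S) ?u ?R"
    using form_band_difference[OF order_refl b order_refl V] L Rt by (simp add: strip_eq_band Omega_eq_band)
  moreover have "form S (strip S j) ?u v = form S (strip S j) ?u ?R"
    by (rule form_strip_cong) (simp_all add: Rv)
  ultimately show ?thesis using T_op_spec(2)[OF j l inv v] by (simp add: b_form_def)
qed

text \<open>On a vertical side of a strip, functions are determined by the nodes on that side, so the hat function
  equals \<open>v\<close> on its own side and vanishes on the other one.\<close>

lemma hat_on_Gamma: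
  assumes j: "j \<in> {1..num_strips S}" and v: "v \<in> V_space S" and z: "z \<in> Gamma S j"
  shows "hat S t j (restr (Gamma_side S t j) v) z = (if z \<in> Gamma_side S t j then v z else 0)"
proof -
  let ?h = "hat S t j (restr (Gamma_side S t j) v)"
  obtain h where h: "h \<in> V_space S" "?h = restr (closure (strip S j)) h"
    using V_locE[OF hat_spec(1)[OF j]] by blast
  have zs: "z \<in> closure (strip S j)" using z Gamma_subset[OF j] by blast
  have c: "fst z \<in> interior_ends j" using z by (auto simp: Gamma_eq[OF j])
  then have res: "resolved_abscissa (fst z)"
    using resolved_abscissa_strip_end[OF j] by (auto simp: interior_ends_def)
  define v' where "v' = (if z \<in> Gamma_side S t j then v else (\<lambda>x. 0))"
  have v': "v' \<in> V_space S" using v V_space_zero by (simp add: v'_def)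
  have side: "y \<in> Gamma_side S t j \<longleftrightarrow> z \<in> Gamma_side S t j" if "y \<in> closure (strip S j)" "fst y = fst z" for y
    using that c zs by (cases y, cases z) (auto simp: Gamma_side_eq[OF j] closure_strip[OF j])
  have "h z = v' z"
  proof (rule V_space_eq_on_resolved[OF h(1) v' resolved_vertical_band[OF res res]])
    fix y assume y: "y \<in> nodes S" "y \<in> {y. fst z \<le> fst y \<and> fst y \<le> fst z}"
    then have "y \<in> closure (Omega S)" "fst y = fst z" using nodes_subset by auto
    then have ys: "y \<in> closure (strip S j)"
      using zs by (cases y, cases z) (auto simp: closure_strip[OF j] closure_Omega)
    have "h y = ?h y" by (subst h(2)) (simp add: restr_def ys)
    also have "\<dots> = v' y"
      using hat_spec(2)[OF j y(1) ys] side[OF ys \<open>fst y = fst z\<close>] by (simp add: v'_def restr_def)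
    finally show "h y = v' y" .
  qed simp
  moreover have "?h z = h z" by (subst h(2)) (simp add: restr_def zs)
  ultimately show ?thesis by (simp add: v'_def)
qed

lemma inner_on_Gamma_hat:
  assumes j: "j \<in> {1..num_strips S}" and v: "v \<in> V_space S"
  shows "inner_on (Gamma S j) g (hat S t j (restr (Gamma_side S t j) v)) = inner_on (Gamma_side S t j) g v"
proof -
  let ?h = "hat S t j (restr (Gamma_side S t j) v)"
  let ?E = "interior_ends j" and ?E' = "interior_ends j \<inter> {strip_end S t j}"
  have fin: "finite ?E" "finite ?E'" using interior_ends_subset[OF j] by auto
  have hat: "?h (x, y) = (if x \<in> ?E' then v (x, y) else 0)" if "x \<in> ?E" "y_lo S \<le> y" "y \<le> y_hi S" for x y
    using hat_on_Gamma[OF j v, of "(x, y)" t] that by (auto simp: Gamma_eq[OF j] Gamma_side_eq[OF j])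
  have "inner_on (Gamma S j) g ?h = (\<Sum>x\<in>?E. side_integral S x g ?h)"
    unfolding Gamma_eq[OF j] by (rule inner_on_sides[OF fin(1)])
  also have "\<dots> = (\<Sum>x\<in>?E'. side_integral S x g v)"
  proof (rule sum.mono_neutral_cong_right[OF fin(1)])
    show "\<forall>x\<in>?E - ?E'. side_integral S x g ?h = 0"
      by (intro ballI side_integral_zero) (use hat in auto)
    show "side_integral S x g ?h = side_integral S x g v" if "x \<in> ?E'" for x
      by (rule side_integral_cong) (use hat that in auto)
  qed simp
  also have "\<dots> = inner_on (Gamma_side S t j) g v"
    unfolding Gamma_side_eq[OF j] by (rule inner_on_sides[OF fin(2), symmetric])
  finally show ?thesis .
qed

text \<open>Subtracting from a test function its hat function on \<open>\<Gamma>\<^sub>l\<^sup>s\<close> leaves a function that vanishes on \<open>\<Gamma>\<^sub>l\<^sup>s\<close>,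
  on which \<open>a\<^sub>l(w, \<cdot>)\<close> is zero. So test functions may be replaced by their hat functions, for which only
  the part \<open>\<Gamma>\<^sub>l\<^sup>s\<close> of the interface contributes.\<close>

lemma impedance_solution_of_imp_side:
  assumes l: "l \<in> {1..num_strips S}" and inv: "locally_invertible S l" and w: "w \<in> V0_side S s l"
  shows "impedance_solution S s l (imp_side S s l w) = w"
proof -
  let ?\<Gamma> = "Gamma_side S s l" and ?g = "imp S l w"
  have wV: "w \<in> V_loc S l" using w by (simp add: V0_side_def)
  obtain w' where w': "w' \<in> V_space S" "w = restr (closure (strip S l)) w'" using V_locE[OF wV] .
  have H1: "v \<in> H1 (strip S l)" if v: "v \<in> V_loc S l" for v
  proof -
    obtain v' where v': "v' \<in> V_space S" "v = restr (closure (strip S l)) v'" using V_locE[OF v] .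
    have eq: "v x = v' x" if "x \<in> strip S l" for x
      using subsetD[OF closure_subset that] by (simp add: v'(2) restr_def)
    have "weak_gradient (strip S l) v' (grad (Omega S) v')"
      unfolding strip_eq_band using strip_bounds[OF l] v'(1) by (intro weak_gradient_band)
    then have "weak_gradient (strip S l) v (grad (Omega S) v')"
      by (simp only: weak_gradient_cong[of "strip S l" v v', OF eq])
    then show ?thesis unfolding H1_def by blast
  qed
  have w0: "form S (strip S l) w v = 0" if "v \<in> V_loc S l" "\<And>z. z \<in> ?\<Gamma> \<Longrightarrow> v z = 0" for v
    using w that H1[OF that(1)] by (auto simp: V0_side_def H1_0_def)
  have g: "inner_on (Gamma S l) ?g v = form S (strip S l) w v" if "v \<in> V_loc S l" for v
    by (rule imp_spec(2)[OF l wV _ that]) (use w0 Gamma_side_subset in blast)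
  have "form S (strip S l) w = form S (strip S l) w'"
    by (rule ext, rule form_strip_cong) (simp_all add: w'(2) restr_def)
  then have anti: "antilinear_on (V_loc S l) (form S (strip S l) w)"
    using form_strip_antilinear[OF l w'(1)] by simp
  have sol: "form S (strip S l) w v = inner_on ?\<Gamma> (imp_side S s l w) v" if v: "v \<in> V_loc S l" for v
  proof -
    obtain v' where v': "v' \<in> V_space S" "v = restr (closure (strip S l)) v'" using V_locE[OF v] .
    let ?h = "hat S s l (restr ?\<Gamma> v')"
    have hV: "?h \<in> V_loc S l" by (rule hat_spec(1)[OF l])
    have "form S (strip S l) w (\<lambda>x. v x + (-1) * ?h x) = 0"
    proof (rule w0[OF V_loc_add_scaled[OF v hV]])
      fix z assume z: "z \<in> ?\<Gamma>"
      then have "z \<in> Gamma S l" "z \<in> closure (strip S l)"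
        using Gamma_side_subset Gamma_subset[OF l] by blast+
      then show "v z + (-1) * ?h z = 0"
        using hat_on_Gamma[OF l v'(1), of z s] z by (simp add: v'(2) restr_def)
    qed
    moreover have "form S (strip S l) w (\<lambda>x. v x + (-1) * ?h x) = form S (strip S l) w v - form S (strip S l) w ?h"
      using antilinear_onD[OF anti v hV, of "-1"] by simp
    ultimately have "form S (strip S l) w v = form S (strip S l) w ?h" by simp
    also have "\<dots> = inner_on (Gamma S l) ?g ?h" by (rule g[OF hV, symmetric])
    also have "\<dots> = inner_on ?\<Gamma> ?g v'" by (rule inner_on_Gamma_hat[OF l v'(1)])
    also have "\<dots> = inner_on ?\<Gamma> (imp_side S s l w) v"
    proof (rule inner_on_cong)
      fix z assume z: "z \<in> ?\<Gamma>"
      then have "z \<in> closure (strip S l)" using Gamma_side_subset Gamma_subset[OF l] by blast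
      then show "?g z = imp_side S s l w z" "v' z = v z" using z by (simp_all add: imp_side_def restr_def v'(2))
    qed
    finally show ?thesis .
  qed
  have "antilinear_on (V_loc S l) (inner_on ?\<Gamma> (imp_side S s l w))"
    using anti sol V_loc_add_scaled by (simp add: antilinear_on_def)
  from the1_equality[OF local_problem_unique_solution[OF inv this]] wV sol
  show ?thesis unfolding impedance_solution_def by blast
qed

text \<open>The impedance data of \<open>T w\<close>, restricted to \<open>\<Gamma>\<^sub>j\<^sup>t\<close>, satisfy the equations that characterise the image
  under the impedance-to-impedance map: testing with hat functions turns the inner product on the
  whole interface into the one on \<open>\<Gamma>\<^sub>j\<^sup>t\<close>, and \<open>b_form_interface\<close> evaluates the form.\<close>

lemma imp_side_T_op:
  assumes l: "l \<in> {1..num_strips S}" and j: "j \<in> {1..num_strips S}"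
    and inv: "locally_invertible S l" "locally_invertible S j"
    and jt: "(j, t) \<in> {(l - 1, Plus), (l + 1, Minus)}"
    and w: "w \<in> V0_side S s l"
  shows "imp_side S t j (T_op S j l w) = imp_map S s l t j (imp_side S s l w)"
proof -
  let ?\<Gamma> = "Gamma_side S t j" and ?X = "interior_ends j \<inter> {strip_end S t j}" and ?T = "T_op S j l w"
  have wV: "w \<in> V_loc S l" using w by (simp add: V0_side_def)
  have X: "finite ?X" "?X \<subseteq> {x_lo S..x_hi S}" using interior_ends_subset[OF j] by auto
  note \<Gamma> = Gamma_side_eq[OF j, of t]
  define rhs where "rhs v = form S (strip S l \<inter> strip S j) w (hat S t j v) - form S (strip S l) w (nodal_ext S j (hat S t j v))" for v
  let ?P = "\<lambda>u. u \<in> V_trace S ?\<Gamma> \<and> (\<forall>v\<in>V_trace S ?\<Gamma>. inner_on ?\<Gamma> u v = rhs v)"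
  have impT: "imp S j ?T \<in> V_trace S (Gamma S j)" "\<And>v. v \<in> V_loc S j \<Longrightarrow> inner_on (Gamma S j) (imp S j ?T) v = form S (strip S j) ?T v"
    by (rule imp_spec[OF j T_op_spec(1)[OF j l inv(2)] T_op_trace[OF j l inv(2)]]; assumption)+
  have sol: "?P (imp_side S t j ?T)"
  proof (intro conjI ballI)
    obtain g where g: "g \<in> V_space S" "imp S j ?T = restr (Gamma S j) g" using V_traceE[OF impT(1)] .
    have "imp_side S t j ?T = restr ?\<Gamma> g"
      unfolding imp_side_def g(2) using Gamma_side_subset[of t j] by (auto simp: restr_def fun_eq_iff)
    then show "imp_side S t j ?T \<in> V_trace S ?\<Gamma>" using V_trace_restr[OF g(1)] by simp
    fix v assume v: "v \<in> V_trace S ?\<Gamma>"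
    obtain v' where v': "v' \<in> V_space S" "v = restr ?\<Gamma> v'" using V_traceE[OF v] .
    have "inner_on ?\<Gamma> (imp_side S t j ?T) v = inner_on ?\<Gamma> (imp S j ?T) v'"
      by (rule inner_on_cong) (simp_all add: imp_side_def restr_def v'(2))
    also have "\<dots> = inner_on (Gamma S j) (imp S j ?T) (hat S t j v)"
      unfolding v'(2) by (rule inner_on_Gamma_hat[OF j v'(1), symmetric])
    also have "\<dots> = form S (strip S j) ?T (hat S t j v)" by (rule impT(2)[OF hat_spec(1)[OF j]])
    also have "\<dots> = b_form S j (weighted_ext S l w) (hat S t j v)" by (rule T_op_spec(2)[OF j l inv(2) hat_spec(1)[OF j]])
    also have "\<dots> = rhs v"
      unfolding rhs_def
    proof (rule b_form_interface[OF l j jt wV hat_spec(1)[OF j]])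
      fix z assume "z \<in> nodes S" "z \<in> closure (strip S j)" "fst z \<noteq> strip_end S t j"
      then show "hat S t j v z = 0" using hat_spec(2)[OF j, of z t v] by (auto simp: Gamma_side_def)
    qed
    finally show "inner_on ?\<Gamma> (imp_side S t j ?T) v = rhs v" .
  qed
  have unique: "u = u'" if u: "?P u" and u': "?P u'" for u u'
  proof (rule V_trace_eqI[OF X \<Gamma>])
    show "u \<in> V_trace S ?\<Gamma>" "u' \<in> V_trace S ?\<Gamma>" using u u' by auto
    fix v assume v: "v \<in> V_space S"
    have "inner_on ?\<Gamma> k v = rhs (restr ?\<Gamma> v)" if "?P k" for k
    proof (rule trans)
      show "inner_on ?\<Gamma> k v = inner_on ?\<Gamma> k (restr ?\<Gamma> v)"
        by (rule inner_on_cong) (simp_all add: restr_def)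
      show "inner_on ?\<Gamma> k (restr ?\<Gamma> v) = rhs (restr ?\<Gamma> v)"
        using that V_trace_restr[OF v] by blast
    qed
    from this[OF u] this[OF u'] show "inner_on ?\<Gamma> u v = inner_on ?\<Gamma> u' v" by (rule trans[OF _ sym])
  qed
  have "(THE u. ?P u) = imp_side S t j ?T"
    by (rule the_equality[where P = ?P, OF sol unique[OF _ sol]])
  then show ?thesis
    unfolding imp_map_def Let_def impedance_solution_of_imp_side[OF l inv(1) w] rhs_def by (rule sym)
qed

end

theorem theorem4p9:
  fixes S :: strip_setting and s t :: side and l j :: nat and w :: "plane \<Rightarrow> complex"
  assumes "valid_setting S"
    and "\<forall>i\<in>{1..num_strips S}. locally_invertible S i"
    and "l \<in> {1..num_strips S}"
    and "w \<in> V0_side S s l"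
    and "(j, t) \<in> {(l - 1, Plus), (l + 1, Minus)}"
    and "1 \<le> j" and "j \<le> num_strips S"
  shows "imp_side S t j (T_op S j l w) = imp_map S s l t j (imp_side S s l w)"
proof -
  interpret helmholtz_strips S by unfold_locales (rule assms(1))
  have j: "j \<in> {1..num_strips S}" using assms(6,7) by simp
  show ?thesis
    by (rule imp_side_T_op[OF assms(3) j bspec[OF assms(2,3)] bspec[OF assms(2) j] assms(5,4)])
qed

end
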